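(* Suppose that the solution $(\eta,u)$ of the initial-boundary-value problem (SCB) (stated in the context) is such that $\eta\in C(0,T;C^4)$, $\eta_t\in C(0,T;C^2)$, and $u,u_t\in C(0,T;C_0^3)$, and let $(\eta_h,u_h)$ be the solution of the nonstandard semidiscrete Galerkin problem (stated in the context), in which $\eta_h$ is continuous piecewise linear and $u_h$ is $C^1$ piecewise quadratic on the same uniform mesh, with $\eta_h(0)=P\eta_0$, $u_h(0)=R_hu_0$. Then there is a constant $C$ independent of $h$ such that \[ (i)\quad \max_{0\le t\le T}\bigl(\|u(t)-u_h(t)\|+h\|\eta(t)-\eta_h(t)\|\bigr)\le Ch^3, \] \[ (ii)\quad \max_{0\le t\le T}\bigl(\|u(t)-u_h(t)\|_\infty+h\|\eta(t)-\eta_h(t)\|_\infty\bigr)\le Ch^3. \]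
   Context: Function spaces on $[0,1]$: $C^k=C^k[0,1]$, $C_0^k=\{\phi\in C^k:\phi(0)=\phi(1)=0\}$; $(\cdot,\cdot)$ and $\|\cdot\|$ are the inner product and norm of $L^2(0,1)$; $\|\cdot\|_\infty$ is the norm of $L^\infty(0,1)$. $C(0,T;X)$ is the space of functions $\phi=\phi(t)$ with values in the Banach space $X$ for each $t\in[0,T]$ and such that $t\mapsto\|\phi(t)\|_X$ is continuous on $[0,T]$. $0<T<\infty$ is such that the problem below has a solution on $[0,T]$. Problem (SCB): $\eta_t+u_x+\tfrac12(\eta u)_x=0$, $u_t+\eta_x+\tfrac32uu_x+\tfrac12\eta\eta_x-\tfrac13u_{xxt}=0$ for $(x,t)\in[0,1]\times[0,T]$; $\eta(x,0)=\eta_0(x)$, $u(x,0)=u_0(x)$ for $x\in[0,1]$; $u(0,t)=u(1,t)=0$ for $t\in[0,T]$. Mesh and spaces: for an integer $N\ge2$, $h=1/N$, $x_i=(i-1)h$, $i=1,\dots,N+1$; $S_h^2=\{\phi\in C^0[0,1]:\phi|_{[x_j,x_{j+1}]}\in\mathbb P_1,\ 1\le j\le N\}$, $S_{h,0}^3=\{\phi\in C^1[0,1]:\phi|_{[x_j,x_{j+1}]}\in\mathbb P_2,\ 1\le j\le N,\ \phi(0)=\phi(1)=0\}$ ($\mathbb P_r$: polynomials of degree $\le r$). $P:L^2\to S_h^2$ is the $L^2$-projection onto $S_h^2$. $R_h:H_0^1(0,1)\to S_{h,0}^3$ is defined by $((R_hv)',\chi')=(v',\chi')$ for all $\chi\in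 S_{h,0}^3$. $a(\psi,\chi)=(\psi,\chi)+\tfrac13(\psi',\chi')$. Semidiscrete problem: find $\eta_h:[0,T]\to S_h^2$, $u_h:[0,T]\to S_{h,0}^3$ such that for $0\le t\le T$ $(\eta_{ht},\phi)+(u_{hx},\phi)+\tfrac12((\eta_hu_h)_x,\phi)=0$ for all $\phi\in S_h^2$, and $a(u_{ht},\chi)+(\eta_{hx},\chi)+\tfrac32(u_hu_{hx},\chi)+\tfrac12(\eta_h\eta_{hx},\chi)=0$ for all $\chi\in S_{h,0}^3$, with $\eta_h(0)=P\eta_0$, $u_h(0)=R_hu_0$. (This initial-value problem has a unique solution on $[0,T]$.) *)

theory Defs
  imports
    "HOL-Analysis.Analysis"
    "HOL-Probability.Essential_Supremum"
    "HOL-Computational_Algebra.Polynomial"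
begin

text \<open>
  Functions on \<open>[0,1]\<close> are represented by total functions on the reals of which only the
  restriction to \<open>[0,1]\<close> matters.  Functions of space and time are written \<open>u t x\<close>, so that
  \<open>u t\<close> is the function of space at time \<open>t\<close>.
\<close>

text \<open>
  The derivatives are one-sided at the end points of \<open>[0,1]\<close> and \<open>[0,T]\<close>.  For a continuous
  piecewise polynomial, \<open>Dx\<close> is unspecified at the nodes where the derivative jumps; it agrees
  almost everywhere with the weak derivative, and below it is then only used under integrals.
\<close>

definition Dx :: "(real \<Rightarrow> real) \<Rightarrow> real \<Rightarrow> real" where
  "Dx f x = vector_derivative f (at x within {0..1})"

definition Dt :: "real \<Rightarrow> (real \<Rightarrow> real \<Rightarrow> real) \<Rightarrow> real \<Rightarrow> real \<Rightarrow> real" where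
  "Dt T f t x = vector_derivative (\<lambda>s. f s x) (at t within {0..T})"

definition Ck :: "nat \<Rightarrow> (real \<Rightarrow> real) set" where
  "Ck k = {f. (\<forall>j<k. ((Dx ^^ j) f) differentiable_on {0..1})
            \<and> continuous_on {0..1} ((Dx ^^ k) f)}"

definition Ck0 :: "nat \<Rightarrow> (real \<Rightarrow> real) set" where
  "Ck0 k = {f \<in> Ck k. f 0 = 0 \<and> f 1 = 0}"

definition Ck_norm :: "nat \<Rightarrow> (real \<Rightarrow> real) \<Rightarrow> real" where
  "Ck_norm k f = (\<Sum>j\<le>k. SUP x\<in>{0..1}. \<bar>(Dx ^^ j) f x\<bar>)"

text \<open>
  \<open>C(0,T;X)\<close> in the sense that the norm (rather than the function itself, as in the usual
  definition) depends continuously on time.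
\<close>

definition C0T :: "real \<Rightarrow> (real \<Rightarrow> real) set \<Rightarrow> ((real \<Rightarrow> real) \<Rightarrow> real)
    \<Rightarrow> (real \<Rightarrow> real \<Rightarrow> real) set" where
  "C0T T X nrm = {\<phi>. (\<forall>t\<in>{0..T}. \<phi> t \<in> X) \<and> continuous_on {0..T} (\<lambda>t. nrm (\<phi> t))}"

definition ip :: "(real \<Rightarrow> real) \<Rightarrow> (real \<Rightarrow> real) \<Rightarrow> real" where
  "ip f g = (\<integral>x. f x * g x \<partial>lebesgue_on {0<..<1})"

definition L2_norm01 :: "(real \<Rightarrow> real) \<Rightarrow> real" where
  "L2_norm01 f = sqrt (ip f f)"

definition Linf_norm01 :: "(real \<Rightarrow> real) \<Rightarrow> ereal" where
  "Linf_norm01 f = esssup (lebesgue_on {0<..<1}) (\<lambda>x. ereal \<bar>f x\<bar>)"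

definition SCB_solution :: "real \<Rightarrow> (real \<Rightarrow> real) \<Rightarrow> (real \<Rightarrow> real)
    \<Rightarrow> (real \<Rightarrow> real \<Rightarrow> real) \<Rightarrow> (real \<Rightarrow> real \<Rightarrow> real) \<Rightarrow> bool" where
  "SCB_solution T \<eta>0 u0 \<eta> u \<longleftrightarrow>
     (\<forall>t\<in>{0..T}. \<eta> t differentiable_on {0..1} \<and> u t differentiable_on {0..1}
        \<and> Dx (u t) differentiable_on {0..1}) \<and>
     (\<forall>x\<in>{0..1}. (\<lambda>t. \<eta> t x) differentiable_on {0..T} \<and> (\<lambda>t. u t x) differentiable_on {0..T}
        \<and> (\<lambda>t. Dx (Dx (u t)) x) differentiable_on {0..T}) \<and>
     (\<forall>t\<in>{0..T}. \<forall>x\<in>{0..1}.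
        Dt T \<eta> t x + Dx (u t) x + 1/2 * Dx (\<lambda>y. \<eta> t y * u t y) x = 0 \<and>
        Dt T u t x + Dx (\<eta> t) x + 3/2 * u t x * Dx (u t) x + 1/2 * \<eta> t x * Dx (\<eta> t) x
          - 1/3 * Dt T (\<lambda>s. Dx (Dx (u s))) t x = 0) \<and>
     (\<forall>x\<in>{0..1}. \<eta> 0 x = \<eta>0 x \<and> u 0 x = u0 x) \<and>
     (\<forall>t\<in>{0..T}. u t 0 = 0 \<and> u t 1 = 0)"

definition mesh_size :: "nat \<Rightarrow> real" where
  "mesh_size N = 1 / real N"

definition node :: "nat \<Rightarrow> nat \<Rightarrow> real" where
  "node N i = (real i - 1) * mesh_size N"

definition piecewise_poly :: "nat \<Rightarrow> nat \<Rightarrow> (real \<Rightarrow> real) \<Rightarrow> bool" where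
  "piecewise_poly N r \<phi> \<longleftrightarrow> (\<forall>j\<in>{1..N}. \<exists>p :: real poly. degree p \<le> r \<and>
     (\<forall>x\<in>{node N j..node N (Suc j)}. \<phi> x = poly p x))"

definition Sh2 :: "nat \<Rightarrow> (real \<Rightarrow> real) set" where
  "Sh2 N = {\<phi> \<in> Ck 0. piecewise_poly N 1 \<phi>}"

definition Sh30 :: "nat \<Rightarrow> (real \<Rightarrow> real) set" where
  "Sh30 N = {\<phi> \<in> Ck0 1. piecewise_poly N 2 \<phi>}"

text \<open>
  The projections are stated as relations, since an element of the discrete spaces is determined
  only on \<open>[0,1]\<close>: \<open>w\<close> is the \<open>L\<^sup>2\<close> projection, respectively the elliptic projection, of \<open>v\<close>.
\<close>

definition is_L2_projection :: "nat \<Rightarrow> (real \<Rightarrow> real) \<Rightarrow> (real \<Rightarrow> real) \<Rightarrow> bool" where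
  "is_L2_projection N v w \<longleftrightarrow> w \<in> Sh2 N \<and> (\<forall>\<phi>\<in>Sh2 N. ip w \<phi> = ip v \<phi>)"

definition is_elliptic_projection :: "nat \<Rightarrow> (real \<Rightarrow> real) \<Rightarrow> (real \<Rightarrow> real) \<Rightarrow> bool" where
  "is_elliptic_projection N v w \<longleftrightarrow>
     w \<in> Sh30 N \<and> (\<forall>\<psi>\<in>Sh30 N. ip (Dx w) (Dx \<psi>) = ip (Dx v) (Dx \<psi>))"

definition a_form :: "(real \<Rightarrow> real) \<Rightarrow> (real \<Rightarrow> real) \<Rightarrow> real" where
  "a_form v w = ip v w + 1/3 * ip (Dx v) (Dx w)"

definition semidiscrete_solution :: "real \<Rightarrow> nat \<Rightarrow> (real \<Rightarrow> real) \<Rightarrow> (real \<Rightarrow> real)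
    \<Rightarrow> (real \<Rightarrow> real \<Rightarrow> real) \<Rightarrow> (real \<Rightarrow> real \<Rightarrow> real) \<Rightarrow> bool" where
  "semidiscrete_solution T N \<eta>0 u0 \<eta>h uh \<longleftrightarrow>
     (\<forall>t\<in>{0..T}. \<eta>h t \<in> Sh2 N \<and> uh t \<in> Sh30 N) \<and>
     (\<forall>x\<in>{0..1}. (\<lambda>t. \<eta>h t x) differentiable_on {0..T} \<and> (\<lambda>t. uh t x) differentiable_on {0..T}) \<and>
     (\<forall>t\<in>{0..T}. \<forall>\<phi>\<in>Sh2 N.
        ip (Dt T \<eta>h t) \<phi> + ip (Dx (uh t)) \<phi> + 1/2 * ip (Dx (\<lambda>x. \<eta>h t x * uh t x)) \<phi> = 0) \<and>
     (\<forall>t\<in>{0..T}. \<forall>\<psi>\<in>Sh30 N.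
        a_form (Dt T uh t) \<psi> + ip (Dx (\<eta>h t)) \<psi> + 3/2 * ip (\<lambda>x. uh t x * Dx (uh t) x) \<psi>
          + 1/2 * ip (\<lambda>x. \<eta>h t x * Dx (\<eta>h t) x) \<psi> = 0) \<and>
     is_L2_projection N \<eta>0 (\<eta>h 0) \<and>
     is_elliptic_projection N u0 (uh 0)"

end

theory Submission
  imports Defs
begin

text \<open>
  Let \<open>h = 1/N\<close>, let \<open>P\<close> be the \<open>L\<^sup>2\<close> projection onto the continuous piecewise linears and \<open>R\<close> the
  elliptic projection onto the \<open>C\<^sup>1\<close> piecewise quadratics that vanish at the end points.  Split the errors as
  \<open>\<eta> - \<eta>h = \<rho> + \<theta>\<close> with \<open>\<rho> = \<eta> - P \<eta>\<close>, and \<open>u - uh = s + \<xi>\<close> with \<open>s = u - R u\<close>.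
  
  The derivatives of the quadratic space are exactly the piecewise linears of mean zero.  Therefore
  \<open>(R u)' = P (u')\<close>, and both \<open>\<rho>\<close> and \<open>s'\<close> are orthogonal to every continuous piecewise linear function,
  in particular to \<open>\<theta>\<close> and to \<open>\<xi>'\<close>.  So the linear coupling terms between the two equations contribute no
  consistency error, although \<open>\<rho>\<close> and \<open>s'\<close> are only of order \<open>h\<^sup>2\<close>.
  
  Testing the error equations with \<open>\<theta>\<close> and \<open>\<xi>\<close> gives the time derivative of
  \<open>E = \<parallel>\<theta>\<parallel>\<^sup>2 + \<parallel>\<xi>\<parallel>\<^sup>2 + \<parallel>\<xi>'\<parallel>\<^sup>2 / 3\<close>.  The cubic terms \<open>\<theta> \<theta>' \<xi>\<close> and \<open>\<theta>\<^sup>2 \<xi>'\<close> of the two equations combine to the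
  exact derivative of \<open>\<theta>\<^sup>2 \<xi>\<close> (lemma \<open>energy_identity\<close>), and \<open>\<xi>\<^sup>2 \<xi>'\<close> is one already.  Every other product of three errors
  contains a factor \<open>\<rho>\<close> or \<open>s\<close>, which is small.  A linear Gronwall argument therefore works for every mesh,
  without any preliminary bound on the discrete solution.
  
  Most remaining terms are visibly at most a multiple of \<open>h\<^sup>6 + E\<close>, and three are not:
  \<^item> \<open>(s', \<eta> \<theta>)\<close> and \<open>(\<rho>, \<eta> \<xi>')\<close>.  Subtracting from \<open>\<eta> \<theta>\<close> or \<open>\<eta> \<xi>'\<close> its piecewise linear interpolant, which
    orthogonality permits, gains the missing factor \<open>h\<close> (lemma \<open>orthogonal_superapproximation\<close>).
  \<^item> \<open>(\<rho> u, \<theta>')\<close>.  The inverse inequality for \<open>\<theta>'\<close> loses a factor \<open>h\<close>, and therefore the mean of \<open>\<rho> u\<close> over a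
    cell has to be of order \<open>h\<^sup>4\<close>.  This holds because the mesh is uniform and \<open>\<eta>\<close> has four derivatives: up to
    \<open>h\<^sup>3\<close> the error \<open>\<rho>\<close> is on each cell a multiple of the quadratic Legendre polynomial, which is
    orthogonal to affine functions.  The boundary layer in the next order is damped by \<open>u\<close>, which vanishes at
    \<open>0\<close> and \<open>1\<close> (lemmas \<open>cell_expansion\<close>, \<open>Pc_close_quasi_weighted\<close>, \<open>superconvergent_flux\<close>).
  
  Hence \<open>E\<close> is of order \<open>h\<^sup>6\<close>.  The maximum of \<open>\<xi>\<close> is bounded by the integral of \<open>\<bar>\<xi>'\<bar>\<close>, and the maximum of \<open>\<theta>\<close> by
  \<open>h\<close> to the power \<open>- 1/2\<close> times its \<open>L\<^sup>2\<close> norm, which is still better than \<open>h\<^sup>2\<close>.  Together with maximum norm bounds for \<open>\<rho>\<close> and \<open>s\<close>,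
  which come from the diagonal dominance of the mass matrix, this gives pointwise bounds, and both claims
  follow from them.
  
  The hypotheses give boundedness, but not joint continuity, of the time derivatives.  Time derivatives are therefore taken
  under the integral sign by dominated convergence; the bound for \<open>u\<^sub>x\<^sub>x\<^sub>t\<close> comes from the second
  equation of the system itself.
\<close>



section \<open>Piecewise continuous functions and their integrals\<close>

abbreviation J :: "(real \<Rightarrow> real) \<Rightarrow> real" where
  "J f \<equiv> integral {0..1} f"

text \<open>
  Bounded and continuous off a finite set: closed under algebraic operations, integrable, and
  insensitive to the values of \<open>Dx\<close> at nodes where a piecewise polynomial has a kink.  The integrals of the statement
  can thus be replaced by gauge integrals over \<open>[0,1]\<close>, for which the fundamental theorem of calculus tolerates
  finitely many exceptional points.
\<close>

definition pwc :: "(real \<Rightarrow> real) \<Rightarrow> bool" where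
  "pwc f \<longleftrightarrow> (\<exists>S B. finite S \<and> continuous_on ({0..1} - S) f \<and> (\<forall>x\<in>{0..1} - S. \<bar>f x\<bar> \<le> B))"

lemma pwc_continuous: "continuous_on {0..1} f \<Longrightarrow> pwc f"
proof -
  assume f: "continuous_on {0..1} f"
  then have "bounded (f ` {0..1})"
    by (intro compact_imp_bounded compact_continuous_image) auto
  then obtain B where "\<forall>x\<in>{0..1}. \<bar>f x\<bar> \<le> B" by (auto simp: bounded_iff)
  then show ?thesis using f unfolding pwc_def by (intro exI[of _ "{}"] exI[of _ B]) auto
qed

lemma pwc_const [intro!, simp]: "pwc (\<lambda>x. c)" 
  by (intro pwc_continuous continuous_intros)

lemma pwc_ident [intro!, simp]: "pwc (\<lambda>x. x)"
  by (intro pwc_continuous continuous_on_id)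

lemma pwc_binop:
  assumes "pwc f" "pwc g"
    and cont: "\<And>S. continuous_on S f \<Longrightarrow> continuous_on S g \<Longrightarrow> continuous_on S k"
    and bound: "\<And>A B. \<exists>C. \<forall>x. \<bar>f x\<bar> \<le> A \<longrightarrow> \<bar>g x\<bar> \<le> B \<longrightarrow> \<bar>k x\<bar> \<le> C"
  shows "pwc k"
proof -
  obtain S A where S: "finite S" "continuous_on ({0..1} - S) f" "\<forall>x\<in>{0..1} - S. \<bar>f x\<bar> \<le> A"
    using assms(1) unfolding pwc_def by auto
  obtain T B where T: "finite T" "continuous_on ({0..1} - T) g" "\<forall>x\<in>{0..1} - T. \<bar>g x\<bar> \<le> B"
    using assms(2) unfolding pwc_def by auto
  obtain C where C: "\<forall>x. \<bar>f x\<bar> \<le> A \<longrightarrow> \<bar>g x\<bar> \<le> B \<longrightarrow> \<bar>k x\<bar> \<le> C"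
    using bound by blast
  show ?thesis unfolding pwc_def
  proof (intro exI conjI ballI)
    show "finite (S \<union> T)" using S T by auto
    show "continuous_on ({0..1} - (S \<union> T)) k"
      by (rule cont) (use S T in \<open>auto intro: continuous_on_subset\<close>)
    show "\<bar>k x\<bar> \<le> C" if "x \<in> {0..1} - (S \<union> T)" for x using that S T C by auto
  qed
qed

lemma pwc_add [intro!]: "pwc f \<Longrightarrow> pwc g \<Longrightarrow> pwc (\<lambda>x. f x + g x)"
proof (rule pwc_binop[of f g])
  show "\<exists>C. \<forall>x. \<bar>f x\<bar> \<le> A \<longrightarrow> \<bar>g x\<bar> \<le> B \<longrightarrow> \<bar>f x + g x\<bar> \<le> C" for A B
    by (rule exI[of _ "A + B"]) auto
qed (auto intro: continuous_intros)

lemma pwc_mult [intro!]: "pwc f \<Longrightarrow> pwc g \<Longrightarrow> pwc (\<lambda>x. f x * g x)"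
proof (rule pwc_binop[of f g])
  show "\<exists>C. \<forall>x. \<bar>f x\<bar> \<le> A \<longrightarrow> \<bar>g x\<bar> \<le> B \<longrightarrow> \<bar>f x * g x\<bar> \<le> C" for A B
    by (rule exI[of _ "A * B"]) (auto simp: abs_mult intro!: mult_mono)
qed (auto intro: continuous_intros)

lemma pwc_abs [intro!]: "pwc f \<Longrightarrow> pwc (\<lambda>x. \<bar>f x\<bar>)"
  by (rule pwc_binop[of f f]) (auto intro: continuous_intros)

lemma pwc_uminus [intro!]: "pwc f \<Longrightarrow> pwc (\<lambda>x. - f x)"
  by (rule pwc_binop[of f f]) (auto intro: continuous_intros)

lemma pwc_diff [intro!]: "pwc f \<Longrightarrow> pwc g \<Longrightarrow> pwc (\<lambda>x. f x - g x)"
  using pwc_add[OF _ pwc_uminus, of f g] by simp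

lemma pwc_divide [intro!]: "pwc f \<Longrightarrow> pwc (\<lambda>x. f x / c)"
  using pwc_mult[OF _ pwc_const, of f "1/c"] by simp

lemma pwc_power [intro!]: "pwc f \<Longrightarrow> pwc (\<lambda>x. f x ^ n)"
  by (induction n) auto

lemma pwc_sum [intro!]: "(\<And>i. i \<in> I \<Longrightarrow> pwc (f i)) \<Longrightarrow> pwc (\<lambda>x. \<Sum>i\<in>I. f i x)"
  by (induction I rule: infinite_finite_induct) auto

lemmas pwc_rules = pwc_const pwc_ident pwc_add pwc_diff pwc_uminus pwc_mult pwc_divide pwc_power pwc_abs pwc_sum

lemma pwc_cong_finite:
  assumes "pwc f" "finite S" "\<And>x. x \<in> {0..1} - S \<Longrightarrow> g x = f x"
  shows "pwc g"
proof -
  obtain T B where T: "finite T" "continuous_on ({0..1} - T) f" "\<forall>x\<in>{0..1} - T. \<bar>f x\<bar> \<le> B"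
    using assms(1) unfolding pwc_def by auto
  have "continuous_on ({0..1} - (S \<union> T)) f" by (rule continuous_on_subset[OF T(2)]) auto
  then have "continuous_on ({0..1} - (S \<union> T)) g"
    by (subst continuous_on_cong[OF refl, of _ _ f]) (use assms in auto)
  then show ?thesis unfolding pwc_def using T assms
    by (intro exI[of _ "S \<union> T"] exI[of _ B]) auto
qed

lemma pwc_absolutely_integrable: 
  assumes "pwc f" shows "f absolutely_integrable_on {0..1}"
proof -
  obtain S B where S: "finite S" "continuous_on ({0..1} - S) f" "\<forall>x\<in>{0..1} - S. \<bar>f x\<bar> \<le> B"
    using assms unfolding pwc_def by auto
  let ?K = "{0..1} - S"
  have K: "?K \<in> sets lebesgue" using S(1) by (intro sets.Diff) (auto intro: negligible_imp_sets negligible_finite)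
  have "negligible S" using S by (simp add: negligible_finite)
  have eq: "g absolutely_integrable_on ?K \<longleftrightarrow> g absolutely_integrable_on {0..1}" for g :: "real \<Rightarrow> real"
    by (rule absolutely_integrable_spike_set_eq)
       (auto intro: negligible_subset[OF \<open>negligible S\<close>])
  have "f absolutely_integrable_on ?K"
  proof (rule measurable_bounded_by_integrable_imp_absolutely_integrable)
    show "f \<in> borel_measurable (lebesgue_on ?K)"
      by (rule continuous_imp_measurable_on_sets_lebesgue[OF S(2) K])
    have "(\<lambda>x. B) absolutely_integrable_on {0..1::real}" by (intro absolutely_integrable_on_const) auto
    then show "(\<lambda>x. B) integrable_on ?K" using eq set_lebesgue_integral_eq_integral(1) by blast
  qed (use S K in auto)
  then show ?thesis using eq by simp
qed

lemma pwc_integrable: "pwc f \<Longrightarrow> f integrable_on {0..1}"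
  using pwc_absolutely_integrable set_lebesgue_integral_eq_integral(1) by blast

lemma pwc_integrable_sub: "pwc f \<Longrightarrow> 0 \<le> a \<Longrightarrow> b \<le> 1 \<Longrightarrow> f integrable_on {a..b}"
  using pwc_integrable integrable_on_subinterval by fastforce

lemma ip_eq_J:
  assumes "pwc f" "pwc g" shows "ip f g = J (\<lambda>x. f x * g x)"
proof -
  have "(\<lambda>x. f x * g x) absolutely_integrable_on {0<..<1}"
    using pwc_absolutely_integrable[OF pwc_mult[OF assms]]
    by (simp add: absolutely_integrable_on_Icc_iff_Ioo)
  then have "ip f g = integral {0<..<1} (\<lambda>x. f x * g x)"
    unfolding ip_def
    by (intro lebesgue_integral_eq_integral absolutely_integrable_imp_integrable) auto
  then show ?thesis by (simp add: integral_open_interval_real)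
qed

lemma J_add: "pwc f \<Longrightarrow> pwc g \<Longrightarrow> J (\<lambda>x. f x + g x) = J f + J g"
  by (intro integral_add pwc_integrable)
lemma J_diff: "pwc f \<Longrightarrow> pwc g \<Longrightarrow> J (\<lambda>x. f x - g x) = J f - J g"
  by (intro integral_diff pwc_integrable)
lemma J_cmult: "J (\<lambda>x. c * f x) = c * J f"
  by simp
lemma J_sum: "finite I \<Longrightarrow> (\<And>i. i \<in> I \<Longrightarrow> pwc (f i)) \<Longrightarrow> J (\<lambda>x. \<Sum>i\<in>I. f i x) = (\<Sum>i\<in>I. J (f i))"
  by (intro integral_sum pwc_integrable)

lemma J_cong_finite:
  assumes "finite S" "\<And>x. x \<in> {0..1} - S \<Longrightarrow> g x = f x"
  shows "J f = J g"
  by (rule integral_spike[of S]) (use assms in \<open>auto simp: negligible_finite\<close>)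

lemma J_mono_finite:
  assumes "pwc f" "pwc g" "finite S" "\<And>x. x \<in> {0..1} - S \<Longrightarrow> f x \<le> g x"
  shows "J f \<le> J g"
proof -
  have "J f = J (\<lambda>x. if x \<in> S then g x else f x)" 
    by (rule J_cong_finite[of S]) (use assms in auto)
  also have "... \<le> J g"
    by (rule integral_le) (use assms in \<open>auto intro!: pwc_integrable pwc_cong_finite[OF assms(1,3)]\<close>)
  finally show ?thesis .
qed

lemma J_nonneg: "(\<And>x. x \<in> {0..1} \<Longrightarrow> 0 \<le> f x) \<Longrightarrow> 0 \<le> J f"
  by (cases "f integrable_on {0..1}") (auto intro: integral_nonneg simp: not_integrable_integral)

lemma abs_J_le:
  assumes "pwc f" "pwc g" "finite S" "\<And>x. x \<in> {0..1} - S \<Longrightarrow> \<bar>f x\<bar> \<le> g x"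
  shows "\<bar>J f\<bar> \<le> J g"
proof -
  have "J f \<le> J g" by (rule J_mono_finite[OF assms(1,2,3)]) (use assms(4) in fastforce)
  moreover have "J (\<lambda>x. - f x) \<le> J g" 
    by (rule J_mono_finite[OF _ assms(2,3)]) (use assms in fastforce)+
  ultimately show ?thesis by simp
qed

lemma J_FTC:
  assumes "finite S" "continuous_on {0..1} F"
    and "\<And>x. x \<in> {0<..<1} - S \<Longrightarrow> (F has_real_derivative f x) (at x within {0..1})"
  shows "J f = F 1 - F 0"
proof -
  have "(f has_integral (F 1 - F 0)) {0..1}"
  proof (rule fundamental_theorem_of_calculus_interior_strong[OF assms(1)])
    fix x assume x: "x \<in> {0<..<1} - S"
    then have "(F has_real_derivative f x) (at x)"
      using assms(3)[OF x] at_within_Icc_at[of 0 x 1] by auto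
    then show "(F has_vector_derivative f x) (at x)"
      by (simp add: has_real_derivative_iff_has_vector_derivative)
  qed (use assms in auto)
  then show ?thesis by (rule integral_unique)
qed

section \<open>One-sided derivatives and the spaces of smooth functions\<close>

lemma Dx_eqI:
  assumes "(f has_real_derivative D) (at x within {0..1})" "x \<in> {0..1}"
  shows "Dx f x = D"
  unfolding Dx_def
  by (rule vector_derivative_within_closed_interval)
     (use assms in \<open>auto simp: has_real_derivative_iff_has_vector_derivative\<close>)

lemma Dt_eqI:
  assumes "((\<lambda>s. f s x) has_real_derivative D) (at t within {0..T})" "t \<in> {0..T}" "0 < T"
  shows "Dt T f t x = D"
  unfolding Dt_def
  by (rule vector_derivative_within_closed_interval)
     (use assms in \<open>auto simp: has_real_derivative_iff_has_vector_derivative\<close>)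

lemma differentiable_Dx:
  assumes "f differentiable_on {0..1}" "x \<in> {0..1}"
  shows "(f has_real_derivative Dx f x) (at x within {0..1})"
  using assms unfolding Dx_def differentiable_on_def
  by (simp add: has_real_derivative_iff_has_vector_derivative vector_derivative_works)

lemma differentiable_Dt:
  assumes "(\<lambda>s. f s x) differentiable_on {0..T}" "t \<in> {0..T}"
  shows "((\<lambda>s. f s x) has_real_derivative Dt T f t x) (at t within {0..T})"
  using assms unfolding Dt_def differentiable_on_def
  by (simp add: has_real_derivative_iff_has_vector_derivative vector_derivative_works)

lemma Ck_has_derivative:
  assumes "f \<in> Ck k" "j < k" "x \<in> {0..1}"
  shows "((Dx ^^ j) f has_real_derivative (Dx ^^ (Suc j)) f x) (at x within {0..1})"
  using assms differentiable_Dx[of "(Dx ^^ j) f" x] unfolding Ck_def by auto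

lemma Ck_continuous:
  assumes "f \<in> Ck k" "j \<le> k" shows "continuous_on {0..1} ((Dx ^^ j) f)"
  using assms unfolding Ck_def
  by (cases "j = k") (auto intro: differentiable_imp_continuous_on)

lemma Ck_norm_bounds:
  assumes "f \<in> Ck k" "j \<le> k" "x \<in> {0..1}"
  shows "\<bar>(Dx ^^ j) f x\<bar> \<le> Ck_norm k f"
proof -
  have bdd: "bdd_above ((\<lambda>x. \<bar>(Dx ^^ i) f x\<bar>) ` {0..1})" if "i \<le> k" for i
    using Ck_continuous[OF assms(1) that]
    by (intro bounded_imp_bdd_above compact_imp_bounded compact_continuous_image continuous_intros) auto
  have up: "\<bar>(Dx ^^ i) f y\<bar> \<le> (SUP x\<in>{0..1}. \<bar>(Dx ^^ i) f x\<bar>)" if "i \<le> k" "y \<in> {0..1}" for i y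
    using bdd[OF that(1)] that(2) by (intro cSUP_upper) auto
  have nn: "0 \<le> (SUP x\<in>{0..1}. \<bar>(Dx ^^ i) f x\<bar>)" if "i \<le> k" for i
    using up[OF that, of 0] by (auto intro: order_trans[OF abs_ge_zero])
  have "(SUP x\<in>{0..1}. \<bar>(Dx ^^ j) f x\<bar>) \<le> Ck_norm k f"
    unfolding Ck_norm_def by (rule member_le_sum) (use nn assms in auto)
  then show ?thesis using up[OF assms(2,3)] by simp
qed

text \<open>
  Each derivative is dominated by the norm, and the norm, being continuous in time, is bounded on the compact
  time interval.
\<close>

lemma C0T_uniform_bound:
  assumes "\<phi> \<in> C0T T X (Ck_norm k)" "X \<subseteq> Ck k" "0 < T"
  obtains M where "1 \<le> M" "\<And>t j x. t \<in> {0..T} \<Longrightarrow> j \<le> k \<Longrightarrow> x \<in> {0..1} \<Longrightarrow> \<bar>(Dx ^^ j) (\<phi> t) x\<bar> \<le> M"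
proof -
  have "bounded ((\<lambda>t. Ck_norm k (\<phi> t)) ` {0..T})"
    using assms unfolding C0T_def by (intro compact_imp_bounded compact_continuous_image) auto
  then obtain B where B: "\<And>t. t \<in> {0..T} \<Longrightarrow> \<bar>Ck_norm k (\<phi> t)\<bar> \<le> B"
    unfolding bounded_iff by (metis image_eqI real_norm_def)
  show ?thesis
  proof (rule that[of "max 1 B"])
    fix t j x assume "t \<in> {0..T}" "j \<le> k" "x \<in> {0..1::real}"
    then show "\<bar>(Dx ^^ j) (\<phi> t) x\<bar> \<le> max 1 B"
      using Ck_norm_bounds[of "\<phi> t" k j x] B[of t] assms unfolding C0T_def by fastforce
  qed auto
qed

lemma Taylor_Icc:
  fixes f :: "nat \<Rightarrow> real \<Rightarrow> real"
  assumes "\<And>i x. x \<in> {0..1} \<Longrightarrow> i \<le> n \<Longrightarrow> (f i has_real_derivative f (Suc i) x) (at x within {0..1})"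
      and "\<And>x. x \<in> {0..1} \<Longrightarrow> \<bar>f (Suc n) x\<bar> \<le> B"
      and "w \<in> {0..1}" "z \<in> {0..1}"
    shows "\<bar>f 0 z - (\<Sum>i\<le>n. f i w * (z-w) ^ i / (fact i))\<bar> \<le> B * \<bar>z - w\<bar>^(Suc n) / fact n"
  using field_Taylor[of "{0..1}" n f B w z] assms by (simp add: real_norm_def)

section \<open>Differentiation under the integral sign and a Gronwall inequality\<close>

text \<open>
  Dominated convergence for the difference quotients, which the mean value inequality bounds by \<open>B\<close>.
  The derivative \<open>f'\<close> may be discontinuous in \<open>t\<close>.
\<close>

lemma J_has_derivative_in_time:
  fixes f f' :: "real \<Rightarrow> real \<Rightarrow> real"
  assumes cont: "\<And>t. t \<in> {0..T} \<Longrightarrow> continuous_on {0..1} (f t)"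
    and der: "\<And>t x. t \<in> {0..T} \<Longrightarrow> x \<in> {0..1} \<Longrightarrow> ((\<lambda>s. f s x) has_real_derivative f' t x) (at t within {0..T})"
    and bnd: "\<And>t x. t \<in> {0..T} \<Longrightarrow> x \<in> {0..1} \<Longrightarrow> \<bar>f' t x\<bar> \<le> B"
    and \<psi>: "pwc \<psi>" and t: "t \<in> {0..T}"
  shows "((\<lambda>s. J (\<lambda>x. f s x * \<psi> x)) has_real_derivative J (\<lambda>x. f' t x * \<psi> x)) (at t within {0..T})"
  unfolding has_field_derivative_iff tendsto_at_iff_sequentially comp_def
proof (intro allI impI)
  fix X :: "nat \<Rightarrow> real" assume X: "\<forall>i. X i \<in> {0..T} - {t}" and lim: "X \<longlonglongrightarrow> t"
  let ?q = "\<lambda>k x. (f (X k) x - f t x) / (X k - t) * \<psi> x"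
  have B: "0 \<le> B" using bnd[OF t, of 0] by auto
  have pf: "pwc (f s)" if "s \<in> {0..T}" for s using cont[OF that] by (rule pwc_continuous)
  have "(\<lambda>k. J (?q k)) \<longlonglongrightarrow> J (\<lambda>x. f' t x * \<psi> x)"
  proof (rule dominated_convergence(2))
    show "?q k integrable_on {0..1}" for k
      using X \<psi> pf t by (intro pwc_integrable pwc_mult pwc_divide pwc_diff) auto
    show "(\<lambda>x. B * \<bar>\<psi> x\<bar>) integrable_on {0..1}" using \<psi> by (intro pwc_integrable) auto
    show "norm (?q k x) \<le> B * \<bar>\<psi> x\<bar>" if "x \<in> {0..1}" for k x
    proof -
      have "\<bar>f (X k) x - f t x\<bar> \<le> B * \<bar>X k - t\<bar>"
        using field_differentiable_bound[of "{0..T}" "\<lambda>s. f s x" "\<lambda>s. f' s x" B "X k" t] 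
          der bnd that X t by (auto simp: real_norm_def)
      moreover have "X k \<noteq> t" using X by auto
      ultimately have "\<bar>(f (X k) x - f t x) / (X k - t)\<bar> \<le> B" by (simp add: divide_simps)
      then have "\<bar>(f (X k) x - f t x) / (X k - t)\<bar> * \<bar>\<psi> x\<bar> \<le> B * \<bar>\<psi> x\<bar>"
        by (rule mult_right_mono) simp
      then show ?thesis by (simp only: real_norm_def abs_mult)
    qed
    show "(\<lambda>k. ?q k x) \<longlonglongrightarrow> f' t x * \<psi> x" if x: "x \<in> {0..1}" for x
      using der[OF t x] X lim unfolding has_field_derivative_iff tendsto_at_iff_sequentially comp_def
      by (intro tendsto_mult tendsto_const) auto
  qed
  moreover have "J (?q k) = (J (\<lambda>x. f (X k) x * \<psi> x) - J (\<lambda>x. f t x * \<psi> x)) / (X k - t)" for k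
  proof -
    have "J (?q k) = J (\<lambda>x. (1 / (X k - t)) * (f (X k) x * \<psi> x - f t x * \<psi> x))"
      by (rule arg_cong[of _ _ J]) (auto simp: field_simps diff_divide_distrib)
    also have "... = (1 / (X k - t)) * (J (\<lambda>x. f (X k) x * \<psi> x) - J (\<lambda>x. f t x * \<psi> x))"
      using X \<psi> pf t by (subst J_cmult, subst J_diff) auto
    finally show ?thesis by simp
  qed
  ultimately show "(\<lambda>k. (J (\<lambda>x. f (X k) x * \<psi> x) - J (\<lambda>x. f t x * \<psi> x)) / (X k - t)) \<longlonglongrightarrow> J (\<lambda>x. f' t x * \<psi> x)" by (simp only:)
qed

text \<open>
  The function \<open>(E + d) exp (- K t)\<close> is nonincreasing.
\<close>

lemma Gronwall_linear:
  fixes E E' :: "real \<Rightarrow> real"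
  assumes der: "\<And>t. t \<in> {0..T} \<Longrightarrow> (E has_real_derivative E' t) (at t within {0..T})"
    and le: "\<And>t. t \<in> {0..T} \<Longrightarrow> E' t \<le> K * (E t + d)"
    and E0: "E 0 = 0" and t: "t \<in> {0..T}" and K: "0 \<le> K" and d: "0 \<le> d"
  shows "E t \<le> exp (K * T) * d"
proof -
  define F where "F = (\<lambda>s. (E s + d) * exp (- K * s))"
  have F: "(F has_real_derivative (E' s - K * (E s + d)) * exp (- K * s)) (at s within {0..t})"
    if "s \<in> {0..t}" for s
  proof -
    have "(E has_real_derivative E' s) (at s within {0..t})"
      using der[of s] that t by (auto intro: DERIV_subset)
    then show ?thesis unfolding F_def
      by (auto intro!: derivative_eq_intros simp: algebra_simps)
  qed
  have "F t \<le> F 0"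
  proof (cases "t = 0")
    case False
    then have "0 < t" using t by auto
    have "\<exists>s\<in>{0<..<t}. F t - F 0 = ((E' s - K * (E s + d)) * exp (- K * s)) * (t - 0)"
      by (rule mvt_simple[OF \<open>0 < t\<close>]) (use F in \<open>auto simp: has_field_derivative_def\<close>)
    then obtain s where s: "s \<in> {0<..<t}" "F t - F 0 = ((E' s - K * (E s + d)) * exp (- K * s)) * t" by auto
    have "(E' s - K * (E s + d)) * exp (- K * s) * t \<le> 0"
      using le[of s] s t by (intro mult_nonpos_nonneg) auto
    then show ?thesis using s by simp
  qed auto
  then have "(E t + d) * exp (- K * t) \<le> d" using E0 by (simp add: F_def)
  then have "((E t + d) * exp (- K * t)) * exp (K * t) \<le> d * exp (K * t)" by (intro mult_right_mono) auto
  then have "E t + d \<le> d * exp (K * t)" by (simp add: mult.assoc flip: exp_add)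
  also have "... \<le> d * exp (K * T)" using K t d by (intro mult_left_mono) (auto intro: mult_left_mono)
  finally show ?thesis using d by (simp add: mult.commute)
qed



section \<open>Continuous piecewise linear functions\<close>

definition hat :: "nat \<Rightarrow> nat \<Rightarrow> real \<Rightarrow> real" where
  "hat N i x = max 0 (1 - \<bar>real N * x - real i\<bar>)"

definition lin :: "nat \<Rightarrow> (nat \<Rightarrow> real) \<Rightarrow> real \<Rightarrow> real" where
  "lin N c x = (\<Sum>i\<le>N. c i * hat N i x)"

text \<open>
  The piecewise constant derivative of \<open>lin N c\<close>.  Its values at the nodes carry no meaning; at \<open>1\<close> it even refers to
  the coefficient with index \<open>N + 1\<close>.
\<close>

definition slope :: "nat \<Rightarrow> (nat \<Rightarrow> real) \<Rightarrow> real \<Rightarrow> real" where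
  "slope N c x = real N * (c (Suc (nat \<lfloor>real N * x\<rfloor>)) - c (nat \<lfloor>real N * x\<rfloor>))"

text \<open>
  The elements of the quadratic space are handled through their derivatives: they are the \<open>prim N d\<close> with
  \<open>prim N d 1 = 0\<close>, where \<open>d\<close> lists the nodal values of the derivative.
\<close>

definition prim :: "nat \<Rightarrow> (nat \<Rightarrow> real) \<Rightarrow> real \<Rightarrow> real" where
  "prim N d x = integral {0..x} (lin N d)"

abbreviation nd :: "nat \<Rightarrow> nat \<Rightarrow> real" where
  "nd N i \<equiv> real i / real N"

abbreviation mesh :: "nat \<Rightarrow> real set" where
  "mesh N \<equiv> nd N ` {..N}"

abbreviation cell :: "nat \<Rightarrow> nat \<Rightarrow> real set" where
  "cell N i \<equiv> {nd N i..nd N (Suc i)}"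

abbreviation K :: "nat \<Rightarrow> nat \<Rightarrow> (real \<Rightarrow> real) \<Rightarrow> real" where
  "K N i f \<equiv> integral (cell N i) f"

lemma cell_bounds:
  assumes "1 \<le> N" "i < N" "x \<in> cell N i"
  shows "real i \<le> real N * x" "real N * x \<le> real i + 1" "0 \<le> x" "x \<le> 1"
proof -
  have N: "0 < real N" using assms by simp
  show "real i \<le> real N * x" "real N * x \<le> real i + 1"
    using assms N by (auto simp: field_simps)
  show "0 \<le> x" using assms by (auto intro: order_trans[rotated])
  have "x \<le> nd N (Suc i)" using assms by simp
  also have "... \<le> 1" using assms N by (simp add: field_simps)
  finally show "x \<le> 1" .
qed

lemma nd_in: "i \<le> N \<Longrightarrow> nd N i \<in> {0..1}"
  by (auto simp: divide_simps)

lemma exists_cell: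
  assumes "1 \<le> N" "x \<in> {0..1}"
  obtains i where "i < N" "x \<in> cell N i"
proof (cases "x = 1")
  case True
  then show ?thesis using assms by (intro that[of "N - 1"]) (auto simp: divide_simps)
next
  case False
  have N: "0 < real N" using assms by simp
  define i where "i = nat \<lfloor>real N * x\<rfloor>"
  have nn: "0 \<le> \<lfloor>real N * x\<rfloor>" using assms by simp
  have fl: "real i = of_int \<lfloor>real N * x\<rfloor>" using nn unfolding i_def by simp
  then have b: "real i \<le> real N * x" "real N * x < real i + 1" by linarith+
  moreover have "real N * x < real N" using False assms N by auto
  ultimately have "i < N" by linarith
  moreover have "x \<in> cell N i" using b N by (auto simp: field_simps)
  ultimately show ?thesis by (rule that)
qed

lemma exists_open_cell:
  assumes "1 \<le> N" "x \<in> {0..1} - mesh N"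
  obtains i where "i < N" "x \<in> {nd N i<..<nd N (Suc i)}"
proof -
  obtain i where i: "i < N" "x \<in> cell N i"
    using exists_cell[OF assms(1), of x] assms(2) by auto
  moreover have "nd N i \<in> mesh N" "nd N (Suc i) \<in> mesh N" using i by (auto simp del: of_nat_Suc)
  ultimately show ?thesis using assms(2) that[of i] by (metis DiffD2 atLeastAtMost_iff greaterThanLessThan_iff order_le_imp_less_or_eq)
qed

lemma finite_mesh [simp]: "finite (mesh N)" by simp

lemma lin_cell:
  assumes "1 \<le> N" "i < N" "x \<in> cell N i"
  shows "lin N c x = c i * (real i + 1 - real N * x) + c (Suc i) * (real N * x - real i)"
proof -
  note b = cell_bounds[OF assms]
  have "lin N c x = (\<Sum>j\<in>{i, Suc i}. c j * hat N j x)"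
    unfolding lin_def
  proof (rule sum.mono_neutral_right)
    show "\<forall>j\<in>{..N} - {i, Suc i}. c j * hat N j x = 0"
    proof
      fix j assume "j \<in> {..N} - {i, Suc i}"
      then have "j + 1 \<le> i \<or> i + 2 \<le> j" by auto
      then have "real j + 1 \<le> real i \<or> real i + 2 \<le> real j" by linarith
      then have "hat N j x = 0" unfolding hat_def using b by (auto simp: max_def)
      then show "c j * hat N j x = 0" by simp
    qed
  qed (use assms in auto)
  also have "... = c i * hat N i x + c (Suc i) * hat N (Suc i) x" by simp
  also have "hat N i x = real i + 1 - real N * x" using b by (auto simp: hat_def)
  also have "hat N (Suc i) x = real N * x - real i" using b by (auto simp: hat_def)
  finally show ?thesis .
qed

lemma lin_node: "1 \<le> N \<Longrightarrow> i \<le> N \<Longrightarrow> lin N c (nd N i) = c i"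
proof (cases "i < N")
  case True
  assume "1 \<le> N"
  then show ?thesis using True lin_cell[of N i "nd N i" c] by (auto simp: divide_simps)
next
  case False
  assume "1 \<le> N" "i \<le> N"
  then show ?thesis using False lin_cell[of N "i - 1" "nd N i" c] by (auto simp: divide_simps)
qed

lemma hat_continuous [continuous_intros]: "continuous_on S (hat N i)"
  unfolding hat_def by (intro continuous_intros)

lemma lin_continuous [continuous_intros]: "continuous_on S (lin N c)"
  unfolding lin_def by (intro continuous_intros)

lemma pwc_hat [intro!, simp]: "pwc (hat N i)" by (intro pwc_continuous continuous_intros)
lemma pwc_lin [intro!, simp]: "pwc (lin N c)" by (intro pwc_continuous continuous_intros)

lemma lin_diff: "lin N (\<lambda>i. c i - d i) x = lin N c x - lin N d x"
  unfolding lin_def by (simp add: algebra_simps sum_subtractf)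


lemma hat_eq_lin: "k \<le> N \<Longrightarrow> hat N k = lin N (\<lambda>j. if j = k then 1 else 0)"
  by (rule ext) (simp add: lin_def if_distrib[where f="\<lambda>c. c * _"] cong: if_cong)

lemma slope_cell:
  assumes "1 \<le> N" "i < N" "x \<in> {nd N i<..<nd N (Suc i)}"
  shows "slope N c x = real N * (c (Suc i) - c i)"
proof -
  have "real i < real N * x" "real N * x < real i + 1" using assms by (auto simp: field_simps)
  then have "\<lfloor>real N * x\<rfloor> = int i" by (intro floor_unique) auto
  then show ?thesis unfolding slope_def by simp
qed

lemma slope_diff: "slope N (\<lambda>i. c i - d i) x = slope N c x - slope N d x"
  unfolding slope_def by (simp add: algebra_simps)

lemma lin_has_derivative:
  assumes "1 \<le> N" "x \<in> {0..1} - mesh N"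
  shows "(lin N c has_real_derivative slope N c x) (at x within S)"
proof -
  obtain i where i: "i < N" "x \<in> {nd N i<..<nd N (Suc i)}" using exists_open_cell[OF assms] .
  let ?g = "\<lambda>x. c i * (real i + 1 - real N * x) + c (Suc i) * (real N * x - real i)"
  have "(?g has_real_derivative slope N c x) (at x)"
    unfolding slope_cell[OF assms(1) i]
    by (auto intro!: derivative_eq_intros simp: algebra_simps)
  then have "(lin N c has_real_derivative slope N c x) (at x)"
    by (rule has_field_derivative_transform_within_open[where S = "{nd N i<..<nd N (Suc i)}"])
       (use i lin_cell[OF assms(1) i(1)] in auto)
  then show ?thesis by (rule has_field_derivative_at_within)
qed

lemma pwc_slope [intro!, simp]: assumes "1 \<le> N" shows "pwc (slope N c)"
  unfolding pwc_def
proof (intro exI conjI ballI)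
  show "finite (mesh N)" by simp
  show "continuous_on ({0..1} - mesh N) (slope N c)"
  proof (rule continuous_at_imp_continuous_on, intro ballI)
    fix x assume x: "x \<in> {0..1} - mesh N"
    obtain i where i: "i < N" "x \<in> {nd N i<..<nd N (Suc i)}" using exists_open_cell[OF assms x] .
    have "((\<lambda>x. real N * (c (Suc i) - c i)) has_real_derivative 0) (at x)" by simp
    then have "(slope N c has_real_derivative 0) (at x)"
      by (rule has_field_derivative_transform_within_open[where S = "{nd N i<..<nd N (Suc i)}"])
         (use i slope_cell[OF assms(1) i(1)] in auto)
    then show "isCont (slope N c) x" by (rule DERIV_isCont)
  qed
  show "\<bar>slope N c x\<bar> \<le> (\<Sum>i<N. \<bar>real N * (c (Suc i) - c i)\<bar>)" if x: "x \<in> {0..1} - mesh N" for x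
  proof -
    obtain i where i: "i < N" "x \<in> {nd N i<..<nd N (Suc i)}" using exists_open_cell[OF assms x] .
    then show ?thesis unfolding slope_cell[OF assms(1) i]
      by (intro member_le_sum) auto
  qed
qed

lemma J_cells:
  assumes "1 \<le> N" "pwc f"
  shows "J f = (\<Sum>i<N. K N i f)"
proof -
  have "integral {0..nd N k} f = (\<Sum>i<k. K N i f)" if "k \<le> N" for k
    using that
  proof (induction k)
    case (Suc k)
    have "integral {0..nd N k} f + integral (cell N k) f = integral {0..nd N (Suc k)} f"
      by (rule Henstock_Kurzweil_Integration.integral_combine)
         (use Suc nd_in[of "Suc k" N] in \<open>auto simp: divide_right_mono intro!: pwc_integrable_sub[OF assms(2)]\<close>)
    then show ?case using Suc by simp
  qed auto
  from this[of N] show ?thesis using assms by simp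
qed

lemma cell_integrable:
  assumes "1 \<le> N" "i < N" "pwc f"
  shows "f integrable_on cell N i"
  by (rule pwc_integrable_sub) (use assms in \<open>auto simp: divide_simps\<close>)

lemma K_FTC:
  assumes "1 \<le> N" "\<And>x. (F has_real_derivative f x) (at x)"
     "\<And>x. x \<in> {nd N i<..<nd N (Suc i)} \<Longrightarrow> g x = f x"
  shows "K N i g = F (nd N (Suc i)) - F (nd N i)"
proof -
  have "(f has_integral (F (nd N (Suc i)) - F (nd N i))) (cell N i)"
    by (rule fundamental_theorem_of_calculus)
       (use assms in \<open>auto simp: divide_right_mono simp flip: has_real_derivative_iff_has_vector_derivative intro: has_field_derivative_at_within\<close>)
  then have "(g has_integral (F (nd N (Suc i)) - F (nd N i))) (cell N i)"
    by (rule has_integral_spike[of "{nd N i, nd N (Suc i)}", rotated 2])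
       (use assms(3) in auto)
  then show ?thesis by (rule integral_unique)
qed

lemma K_affine_product:
  assumes "1 \<le> N" "\<And>x. x \<in> {nd N i<..<nd N (Suc i)} \<Longrightarrow> 
      g x = (a * (real i + 1 - real N * x) + b * (real N * x - real i)) * (p * (real i + 1 - real N * x) + q * (real N * x - real i))"
  shows "K N i g = (2*a*p + a*q + b*p + 2*b*q) / (6 * real N)"
proof -
  let ?F = "\<lambda>x. (- a*p * (real i + 1 - real N * x)^3 / 3 + b*q * (real N * x - real i)^3/3 
     + (a*q+b*p) * ((real N * x - real i)^2/2 - (real N * x - real i)^3/3)) / real N"
  have "K N i g = ?F (nd N (Suc i)) - ?F (nd N i)"
  proof (rule K_FTC[OF assms(1)])
    fix x
    show "(?F has_real_derivative (a * (real i + 1 - real N * x) + b * (real N * x - real i)) * (p * (real i + 1 - real N * x) + q * (real N * x - real i))) (at x)"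
      using assms(1) by (auto intro!: derivative_eq_intros simp: field_simps power2_eq_square)
  qed (rule assms(2))
  also have "... = (2*a*p + a*q + b*p + 2*b*q) / (6 * real N)"
    using assms(1) by (simp add: field_simps)
  finally show ?thesis .
qed

lemma K_lin_lin:
  assumes "1 \<le> N" "i < N"
  shows "K N i (\<lambda>x. lin N c x * lin N d x) =
    (2*c i*d i + c i*d (Suc i) + c (Suc i)*d i + 2*c (Suc i)*d (Suc i)) / (6 * real N)"
  by (rule K_affine_product) (use assms lin_cell in auto)

text \<open>
  On a cell with end values \<open>a\<close> and \<open>b\<close> this is \<open>(b - a)\<^sup>2 \<le> 4 (a\<^sup>2 + a b + b\<^sup>2)\<close>, that is, \<open>0 \<le> 3 (a + b)\<^sup>2\<close>.
\<close>

lemma slope_inverse_inequality: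
  assumes "1 \<le> N"
  shows "(1 / real N)\<^sup>2 * J (\<lambda>x. (slope N c x)\<^sup>2) \<le> 12 * J (\<lambda>x. (lin N c x)\<^sup>2)"
proof -
  have N: "0 < real N" using assms by simp
  have "(1 / real N)\<^sup>2 * K N i (\<lambda>x. (slope N c x)\<^sup>2) \<le> 12 * K N i (\<lambda>x. (lin N c x)\<^sup>2)" if i: "i < N" for i
  proof -
    have "K N i (\<lambda>x. (slope N c x)\<^sup>2) = (real N * (c (Suc i) - c i))\<^sup>2 * nd N (Suc i) - (real N * (c (Suc i) - c i))\<^sup>2 * nd N i"
      by (rule K_FTC[where f = "\<lambda>x. (real N * (c (Suc i) - c i))\<^sup>2"]) 
         (use assms i slope_cell in \<open>auto intro!: derivative_eq_intros\<close>)
    also have "... = real N * (c (Suc i) - c i)\<^sup>2" using N by (simp add: field_simps power2_eq_square)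
    finally have 1: "(1 / real N)\<^sup>2 * K N i (\<lambda>x. (slope N c x)\<^sup>2) = (c (Suc i) - c i)\<^sup>2 / real N"
      using N by (simp add: field_simps power2_eq_square)
    have 2: "12 * K N i (\<lambda>x. (lin N c x)\<^sup>2) = 4 * ((c i)\<^sup>2 + c i * c (Suc i) + (c (Suc i))\<^sup>2) / real N"
      using K_lin_lin[OF assms i, of c c] N by (simp add: power2_eq_square field_simps)
    have "0 \<le> 3 * (c i + c (Suc i))\<^sup>2" by simp
    then have "(c (Suc i) - c i)\<^sup>2 \<le> 4 * ((c i)\<^sup>2 + c i * c (Suc i) + (c (Suc i))\<^sup>2)"
      by (simp add: power2_eq_square algebra_simps)
    then show ?thesis unfolding 1 2 using N by (intro divide_right_mono) auto
  qed
  then have "(\<Sum>i<N. (1 / real N)\<^sup>2 * K N i (\<lambda>x. (slope N c x)\<^sup>2)) \<le> (\<Sum>i<N. 12 * K N i (\<lambda>x. (lin N c x)\<^sup>2))"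
    by (intro sum_mono) auto
  then show ?thesis
    using assms by (simp add: J_cells[OF assms] pwc_power sum_distrib_left)
qed

text \<open>
  On a cell with end values \<open>a\<close> and \<open>b\<close>, the square is at most \<open>a\<^sup>2 + b\<^sup>2\<close>, and the integral of the square over that one cell
  is already at least \<open>h (a\<^sup>2 + b\<^sup>2) / 6\<close>.
\<close>

lemma lin_sup_bound:
  assumes "1 \<le> N" "x \<in> {0..1}"
  shows "(lin N c x)\<^sup>2 \<le> 6 * real N * J (\<lambda>x. (lin N c x)\<^sup>2)"
proof -
  have N: "0 < real N" using assms by simp
  obtain i where i: "i < N" "x \<in> cell N i" using exists_cell[OF assms] .
  note b = cell_bounds[OF assms(1) i]
  define l where "l = real N * x - real i"
  define p q where "p = c i" and "q = c (Suc i)"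
  have l: "0 \<le> l" "l \<le> 1" using b by (auto simp: l_def)
  have "lin N c x = p * (1 - l) + q * l" unfolding lin_cell[OF assms(1) i, of c] by (simp add: l_def p_def q_def algebra_simps)
  moreover have "(p * (1 - l) + q * l)\<^sup>2 \<le> p\<^sup>2 + q\<^sup>2"
  proof -
    have "(p * (1 - l) + q * l)\<^sup>2 = (1-l) * p\<^sup>2 + l * q\<^sup>2 - l * (1 - l) * (p - q)\<^sup>2"
      by (simp add: power2_eq_square algebra_simps)
    moreover have "0 \<le> l * (1 - l) * (p - q)\<^sup>2" using l by simp
    moreover have "(1-l) * p\<^sup>2 \<le> 1 * p\<^sup>2" "l * q\<^sup>2 \<le> 1 * q\<^sup>2" using l by (intro mult_right_mono; simp)+
    ultimately show ?thesis by linarith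
  qed
  moreover have "p\<^sup>2 + q\<^sup>2 \<le> 6 * real N * K N i (\<lambda>x. (lin N c x)\<^sup>2)"
  proof -
    have "6 * real N * K N i (\<lambda>x. (lin N c x)\<^sup>2) = 2*p*p + p*q + q*p + 2*q*q"
      using K_lin_lin[OF assms(1) i(1), of c c] N by (simp add: power2_eq_square field_simps p_def q_def)
    moreover have "0 \<le> (p + q)\<^sup>2" by simp
    ultimately show ?thesis by (simp add: power2_eq_square algebra_simps)
  qed
  moreover have "K N i (\<lambda>x. (lin N c x)\<^sup>2) \<le> J (\<lambda>x. (lin N c x)\<^sup>2)"
  proof -
    have "J (\<lambda>x. (lin N c x)\<^sup>2) = (\<Sum>i<N. K N i (\<lambda>x. (lin N c x)\<^sup>2))"
      by (rule J_cells) (use assms in auto)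
    moreover have "0 \<le> K N i (\<lambda>x. (lin N c x)\<^sup>2)" if "i < N" for i
      by (rule integral_nonneg[OF cell_integrable[OF assms(1) that]]) auto
    ultimately show ?thesis
      by (simp only:) (rule member_le_sum, use i(1) in auto)
  qed
  ultimately show ?thesis using N by (smt (verit, best) mult_left_mono zero_le_mult_iff of_nat_0_le_iff)
qed

lemma J_hat:
  assumes "1 \<le> N" "k \<le> N" "pwc f"
  shows "J (\<lambda>x. f x * hat N k x) = 
    (if 0 < k then K N (k - 1) (\<lambda>x. f x * (real N * x - (real k - 1))) else 0)
    + (if k < N then K N k (\<lambda>x. f x * (real k + 1 - real N * x)) else 0)"
proof -
  have "J (\<lambda>x. f x * hat N k x) = (\<Sum>i<N. K N i (\<lambda>x. f x * hat N k x))"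
    by (rule J_cells) (use assms in auto)
  also have "... = (\<Sum>i<N. (if Suc i = k then K N (k - 1) (\<lambda>x. f x * (real N * x - (real k - 1))) else 0)
         + (if i = k then K N k (\<lambda>x. f x * (real k + 1 - real N * x)) else 0))"
  proof (rule sum.cong[OF refl])
    fix i assume "i \<in> {..<N}"
    then have i: "i < N" by simp
    have eq: "hat N k x = (if i = k then 1 else 0) * (real i + 1 - real N * x) + (if Suc i = k then 1 else 0) * (real N * x - real i)"
      if "x \<in> cell N i" for x
      unfolding hat_eq_lin[OF assms(2)] by (rule lin_cell) (use that i assms in auto)
    have "K N i (\<lambda>x. f x * hat N k x) = K N i (\<lambda>x. f x * ((if i = k then 1 else 0) * (real i + 1 - real N * x) + (if Suc i = k then 1 else 0) * (real N * x - real i)))"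
      by (rule integral_cong) (simp add: eq)
    also have "... = (if Suc i = k then K N (k - 1) (\<lambda>x. f x * (real N * x - (real k - 1))) else 0)
         + (if i = k then K N k (\<lambda>x. f x * (real k + 1 - real N * x)) else 0)"
      by (auto)
    finally show "K N i (\<lambda>x. f x * hat N k x) = (if Suc i = k then K N (k - 1) (\<lambda>x. f x * (real N * x - (real k - 1))) else 0)
         + (if i = k then K N k (\<lambda>x. f x * (real k + 1 - real N * x)) else 0)" .
  qed
  also have "... = (if 0 < k then K N (k - 1) (\<lambda>x. f x * (real N * x - (real k - 1))) else 0)
    + (if k < N then K N k (\<lambda>x. f x * (real k + 1 - real N * x)) else 0)"
  proof -
    have "(\<Sum>i<N. (if Suc i = k then a else 0)) = (if 0 < k then a else 0)" for a :: real
      using assms(2) by (cases k) auto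
    moreover have "(\<Sum>i<N. (if i = k then a else 0)) = (if k < N then a else 0)" for a :: real by simp
    ultimately show ?thesis by (simp only: sum.distrib)
  qed
  finally show ?thesis .
qed

text \<open>
  The mass matrix multiplied by \<open>6 N\<close>: rows \<open>(1, 4, 1)\<close> inside, and \<open>(2, 1)\<close> and \<open>(1, 2)\<close> at the two ends.
\<close>

definition mass :: "nat \<Rightarrow> (nat \<Rightarrow> real) \<Rightarrow> nat \<Rightarrow> real" where
  "mass N c k = (if 0 < k then c (k - 1) + 2 * c k else 0) + (if k < N then 2 * c k + c (Suc k) else 0)"

lemma J_lin_hat:
  assumes "1 \<le> N" "k \<le> N"
  shows "J (\<lambda>x. lin N c x * hat N k x) = mass N c k / (6 * real N)"
proof -
  have 1: "K N (k - 1) (\<lambda>x. lin N c x * (real N * x - (real k - 1))) = (c (k - 1) + 2 * c k) / (6 * real N)" if "0 < k"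
  proof -
    have "K N (k - 1) (\<lambda>x. lin N c x * (real N * x - (real k - 1))) = (2*c (k-1)*0 + c (k-1) * 1 + c k * 0 + 2 * c k * 1)/ (6 * real N)"
      by (rule K_affine_product) (use that assms lin_cell[of N "k - 1" _ c] in \<open>auto simp: of_nat_diff\<close>)
    then show ?thesis by simp
  qed
  have 2: "K N k (\<lambda>x. lin N c x * (real k + 1 - real N * x)) = (2 * c k + c (Suc k)) / (6 * real N)" if "k < N"
  proof -
    have "K N k (\<lambda>x. lin N c x * (real k + 1 - real N * x)) = (2*c k*1 + c k * 0 + c (Suc k) * 1 + 2 * c (Suc k) * 0)/ (6 * real N)"
      by (rule K_affine_product) (use that assms lin_cell[of N k _ c] in \<open>auto\<close>)
    then show ?thesis by simp
  qed
  show ?thesis by (subst J_hat) (use assms 1 2 in \<open>auto simp: mass_def add_divide_distrib\<close>)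
qed

section \<open>The discrete spaces in coordinates\<close>

lemma prim_0 [simp]: "prim N d 0 = 0" by (simp add: prim_def)

lemma prim_has_derivative:
  "x \<in> {0..1} \<Longrightarrow> (prim N d has_real_derivative lin N d x) (at x within {0..1})"
  unfolding prim_def by (rule integral_has_real_derivative) (auto intro: continuous_intros)

lemma prim_differentiable_on: "prim N d differentiable_on {0..1}"
  unfolding differentiable_on_def
proof
  fix x :: real assume "x \<in> {0..1}"
  from prim_has_derivative[OF this, of N d] show "prim N d differentiable at x within {0..1}"
    unfolding has_field_derivative_def differentiable_def by (intro exI)
qed

lemma prim_continuous: "continuous_on {0..1} (prim N d)"
  by (rule DERIV_continuous_on) (rule prim_has_derivative)

lemma pwc_prim [intro!, simp]: "pwc (prim N d)" by (rule pwc_continuous[OF prim_continuous])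


lemma prim_eq_sum: 
  assumes "x \<in> {0..1}" shows "prim N d x = (\<Sum>i\<le>N. d i * integral {0..x} (hat N i))"
  unfolding prim_def lin_def 
  by (subst integral_sum) (auto intro!: integrable_continuous_real continuous_intros)

lemma prim_diff: "x \<in> {0..1} \<Longrightarrow> prim N (\<lambda>i. c i - d i) x = prim N c x - prim N d x"
  by (simp add: prim_eq_sum algebra_simps sum_subtractf)



lemma prim_cell:
  assumes "1 \<le> N" "i < N" "x \<in> cell N i"
  shows "prim N d x = prim N d (nd N i) + 
     (d i * ((real N * x - real i) - (real N * x - real i)\<^sup>2 / 2) + d (Suc i) * (real N * x - real i)\<^sup>2 / 2) / real N"
proof -
  let ?F = "\<lambda>x. (d i * ((real N * x - real i) - (real N * x - real i)\<^sup>2 / 2) + d (Suc i) * (real N * x - real i)\<^sup>2 / 2) / real N"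
  note b = cell_bounds[OF assms]
  have "(lin N d has_integral (?F x - ?F (nd N i))) {nd N i..x}"
  proof (rule fundamental_theorem_of_calculus)
    fix y assume "y \<in> {nd N i..x}"
    then have y: "y \<in> cell N i" using assms by auto
    show "(?F has_vector_derivative lin N d y) (at y within {nd N i..x})"
      unfolding lin_cell[OF assms(1,2) y] has_real_derivative_iff_has_vector_derivative[symmetric]
      using assms(1) by (auto intro!: derivative_eq_intros simp: field_simps)
  qed (use assms in auto)
  then have "integral {nd N i..x} (lin N d) = ?F x - ?F (nd N i)" by (rule integral_unique)
  moreover have "?F (nd N i) = 0" using assms by simp
  moreover have "integral {0..nd N i} (lin N d) + integral {nd N i..x} (lin N d) = integral {0..x} (lin N d)"
    by (rule Henstock_Kurzweil_Integration.integral_combine)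
       (use assms b in \<open>auto intro!: integrable_continuous_real continuous_intros\<close>)
  ultimately show ?thesis unfolding prim_def by linarith
qed

lemma node_eq_nd: "node N (Suc i) = nd N i"
  by (simp add: node_def mesh_size_def)

lemma piecewise_poly_cells:
  "piecewise_poly N r \<phi> \<longleftrightarrow> (\<forall>i<N. \<exists>p. degree p \<le> r \<and> (\<forall>x\<in>cell N i. \<phi> x = poly p x))"
proof -
  have "{1..N} = Suc ` {..<N}" by (auto simp: image_iff) (metis Suc_le_D Suc_le_lessD lessThan_iff One_nat_def)
  then show ?thesis unfolding piecewise_poly_def by (simp only: ball_simps node_eq_nd) blast
qed

lemma poly_affine: "degree p \<le> 1 \<Longrightarrow> poly p x = coeff p 0 + coeff p 1 * (x::real)"
proof -
  assume "degree p \<le> 1"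
  then have "degree p = 0 \<or> degree p = 1" by linarith
  then show ?thesis unfolding poly_altdef by (auto simp: coeff_eq_0)
qed

lemma affine_on_cells_eq_lin:
  assumes "1 \<le> N" "\<And>i. i < N \<Longrightarrow> \<exists>p. degree p \<le> 1 \<and> (\<forall>x\<in>cell N i. \<phi> x = poly p x)"
    and "x \<in> {0..1}"
  shows "\<phi> x = lin N (\<lambda>i. \<phi> (nd N i)) x"
proof -
  have N: "0 < real N" using assms by simp
  obtain i where i: "i < N" "x \<in> cell N i" using exists_cell[OF assms(1,3)] .
  obtain p where p: "degree p \<le> 1" "\<forall>x\<in>cell N i. \<phi> x = poly p x" using assms(2)[OF i(1)] by auto
  have "nd N i \<le> nd N (Suc i)" by (simp add: divide_right_mono)
  then have e: "\<phi> x = coeff p 0 + coeff p 1 * x" "\<phi> (nd N i) = coeff p 0 + coeff p 1 * nd N i"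
    "\<phi> (nd N (Suc i)) = coeff p 0 + coeff p 1 * nd N (Suc i)" using p i poly_affine by auto
  show ?thesis unfolding lin_cell[OF assms(1) i] unfolding e using N by (simp add: field_simps)
qed

lemma Sh2_eq_lin:
  assumes "1 \<le> N" "\<phi> \<in> Sh2 N" "x \<in> {0..1}"
  shows "\<phi> x = lin N (\<lambda>i. \<phi> (nd N i)) x"
  by (rule affine_on_cells_eq_lin) (use assms in \<open>auto simp: Sh2_def piecewise_poly_cells\<close>)

lemma lin_in_Sh2: "1 \<le> N \<Longrightarrow> lin N c \<in> Sh2 N"
  unfolding Sh2_def Ck_def piecewise_poly_cells
proof (intro CollectI conjI allI impI)
  fix i assume N: "1 \<le> N" and i: "i < N"
  let ?p = "[:c i * (real i + 1) - c (Suc i) * real i, real N * (c (Suc i) - c i):]"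
  have "lin N c x = poly ?p x" if "x \<in> cell N i" for x
    unfolding lin_cell[OF N i that] by (simp add: algebra_simps)
  then show "\<exists>p. degree p \<le> 1 \<and> (\<forall>x\<in>cell N i. lin N c x = poly p x)"
    by (intro exI[of _ ?p]) auto
qed (auto intro: continuous_intros)

lemma Dx_prim: "x \<in> {0..1} \<Longrightarrow> Dx (prim N d) x = lin N d x"
  by (rule Dx_eqI[OF prim_has_derivative])

lemma prim_in_Sh30: 
  assumes "1 \<le> N" "prim N d 1 = 0" shows "prim N d \<in> Sh30 N"
  unfolding Sh30_def Ck0_def Ck_def piecewise_poly_cells
proof (intro CollectI conjI allI impI)
  fix j :: nat assume "j < 1"
  then show "(Dx ^^ j) (prim N d) differentiable_on {0..1}"
    by (simp add: prim_differentiable_on)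
next
  show "continuous_on {0..1} ((Dx ^^ 1) (prim N d))"
    by (subst continuous_on_cong[OF refl, of _ _ "lin N d"]) (auto simp: Dx_prim intro: continuous_intros)
next
  fix i assume i: "i < N"
  let ?i = "real i" and ?N = "real N"
  let ?p = "[:prim N d (nd N i) + (d i * (- ?i - ?i\<^sup>2/2) + d (Suc i) * ?i\<^sup>2 / 2) / ?N,
       d i * (1 + ?i) - d (Suc i) * ?i, (d (Suc i) - d i) * ?N / 2:]"
  have "prim N d x = poly ?p x" if "x \<in> cell N i" for x
    unfolding prim_cell[OF assms(1) i that, of d] using assms(1) 
    by (simp add: field_simps power2_eq_square)
  moreover have "degree ?p \<le> 2" by (auto intro: order_trans[OF degree_pCons_le])
  ultimately show "\<exists>p. degree p \<le> 2 \<and> (\<forall>x\<in>cell N i. prim N d x = poly p x)"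
    by blast
qed (use assms in auto)

text \<open>
  On an open cell \<open>Dx \<psi>\<close> is the derivative of a quadratic polynomial; continuity of \<open>Dx \<psi>\<close> extends this to the
  end points of the cell, so that the affine pieces fit together.
\<close>

lemma Sh30_derivative:
  assumes "1 \<le> N" "\<psi> \<in> Sh30 N" "x \<in> {0..1}"
  shows "Dx \<psi> x = lin N (\<lambda>i. Dx \<psi> (nd N i)) x"
proof (rule affine_on_cells_eq_lin[OF assms(1) _ assms(3)])
  fix i assume i: "i < N"
  have N: "0 < real N" using assms by simp
  have C: "\<psi> \<in> Ck 1" and "piecewise_poly N 2 \<psi>" using assms unfolding Sh30_def Ck0_def by auto
  then obtain p where p: "degree p \<le> 2" "\<forall>x\<in>cell N i. \<psi> x = poly p x"
    unfolding piecewise_poly_cells using i by auto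
  let ?U = "{nd N i<..<nd N (Suc i)}"
  have cl: "closure ?U = (cell N i)" using N by (subst closure_greaterThanLessThan) (auto simp: divide_strict_right_mono)
  have sub: "cell N i \<subseteq> {0..1}" using cell_bounds[OF assms(1) i] by auto
  have "Dx \<psi> y - poly (pderiv p) y = 0" if "y \<in> cell N i" for y
  proof (rule continuous_constant_on_closure[of ?U "\<lambda>y. Dx \<psi> y - poly (pderiv p) y"])
    show "continuous_on (closure ?U) (\<lambda>y. Dx \<psi> y - poly (pderiv p) y)" unfolding cl
      by (intro continuous_on_diff continuous_on_poly continuous_on_id continuous_on_subset[OF _ sub])
         (use Ck_continuous[OF C, of 1] in simp)
    show "y \<in> closure ?U" using that cl by simp
    fix z assume z: "z \<in> ?U"
    have "(poly p has_real_derivative poly (pderiv p) z) (at z)" by (rule poly_DERIV)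
    then have "(\<psi> has_real_derivative poly (pderiv p) z) (at z)"
      by (rule has_field_derivative_transform_within_open[where S = ?U]) (use z p in auto)
    then have "Dx \<psi> z = poly (pderiv p) z"
      by (rule Dx_eqI[OF has_field_derivative_at_within])
         (meson sub z greaterThanLessThan_subseteq_atLeastAtMost_iff order_refl subsetD)
    then show "Dx \<psi> z - poly (pderiv p) z = 0" by simp
  qed
  moreover have "degree (pderiv p) \<le> 1" using p by (simp add: degree_pderiv)
  ultimately show "\<exists>q. degree q \<le> 1 \<and> (\<forall>x\<in>cell N i. Dx \<psi> x = poly q x)" by auto
qed

lemma Sh30_eq_prim:
  assumes "1 \<le> N" "\<psi> \<in> Sh30 N" "x \<in> {0..1}"
  shows "\<psi> x = prim N (\<lambda>i. Dx \<psi> (nd N i)) x"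
proof -
  have C: "\<psi> \<in> Ck 1" "\<psi> 0 = 0" using assms unfolding Sh30_def Ck0_def by auto
  let ?d = "\<lambda>i. Dx \<psi> (nd N i)"
  have "((\<lambda>y. \<psi> y - prim N ?d y) has_real_derivative 0) (at y within {0..1})" if "y \<in> {0..1}" for y
    using Ck_has_derivative[OF C(1), of 0 y] that Sh30_derivative[OF assms(1,2) that]
    by (auto intro!: derivative_eq_intros prim_has_derivative)
  then have "\<exists>c. \<forall>y\<in>{0..1}. \<psi> y - prim N ?d y = c"
    by (intro has_field_derivative_zero_constant convex_real_interval)
  then obtain c where c: "\<forall>y\<in>{0..1}. \<psi> y - prim N ?d y = c" by auto
  have "\<psi> 0 - prim N ?d 0 = c" by (rule c[rule_format]) simp
  then have "c = 0" using C(2) by simp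
  then show ?thesis using c[rule_format, OF assms(3)] by (simp only:)
qed



section \<open>The projection onto the piecewise linear functions\<close>

text \<open>
  Apply the hypothesis at an index where \<open>\<bar>e i\<bar>\<close> is maximal, with \<open>m\<close> that maximum.
\<close>

lemma diagonal_dominance_bound:
  fixes e :: "nat \<Rightarrow> real"
  assumes "\<And>i m. i \<le> N \<Longrightarrow> (\<And>j. j \<le> N \<Longrightarrow> \<bar>e j\<bar> \<le> m) \<Longrightarrow> 2 * \<bar>e i\<bar> \<le> B + m"
    and "i \<le> N"
  shows "\<bar>e i\<bar> \<le> B"
proof -
  define m where "m = Max ((\<lambda>j. \<bar>e j\<bar>) ` {..N})"
  have m: "\<bar>e j\<bar> \<le> m" if "j \<le> N" for j unfolding m_def using that by (intro Max_ge) auto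
  have "m \<in> (\<lambda>j. \<bar>e j\<bar>) ` {..N}" unfolding m_def by (intro Max_in) auto
  then obtain k where "k \<le> N" "m = \<bar>e k\<bar>" by auto
  then have "2 * m \<le> B + m" using assms(1)[OF \<open>k \<le> N\<close>, of m] m by simp
  then show ?thesis using m[OF assms(2)] by linarith
qed

lemma mass_0: "1 \<le> N \<Longrightarrow> mass N c 0 = 2 * c 0 + c 1" by (simp add: mass_def)
lemma mass_N: "1 \<le> N \<Longrightarrow> mass N c N = c (N - 1) + 2 * c N" by (simp add: mass_def)
lemma mass_interior: "0 < k \<Longrightarrow> k < N \<Longrightarrow> mass N c k = c (k - 1) + 4 * c k + c (Suc k)" by (simp add: mass_def)

lemma mass_bound:
  assumes N: "1 \<le> N" and B: "\<And>k. k \<le> N \<Longrightarrow> \<bar>mass N c k\<bar> \<le> B" and "i \<le> N"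
  shows "\<bar>c i\<bar> \<le> B"
proof (rule diagonal_dominance_bound[OF _ assms(3)])
  fix k m assume k: "k \<le> N" and m: "\<And>j. j \<le> N \<Longrightarrow> \<bar>c j\<bar> \<le> m"
  consider "k = 0" | "k = N" "0 < k" | "0 < k" "k < N" using k by linarith
  then show "2 * \<bar>c k\<bar> \<le> B + m"
  proof cases
    case 1
    then show ?thesis using B[of 0] m[of 1] N by (auto simp: mass_0)
  next
    case 2
    then show ?thesis using B[of N] m[of "N - 1"] N by (auto simp: mass_N)
  next
    case 3
    then have "k - 1 \<le> N" "Suc k \<le> N" by auto
    then show ?thesis using B[OF k] m[of "k - 1"] m[of "Suc k"] m[OF k] mass_interior[OF 3, of c] by linarith
  qed
qed

text \<open>
  Solves the rows \<open>0, ..., N - 1\<close> of the tridiagonal system by forward substitution from the initial value \<open>a\<close>, which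
  is then chosen such that the last row holds as well.
\<close>

fun shoot :: "(nat \<Rightarrow> real) \<Rightarrow> real \<Rightarrow> nat \<Rightarrow> real" where
  "shoot b a 0 = a"
| "shoot b a (Suc 0) = b 0 - 2 * a"
| "shoot b a (Suc (Suc k)) = b (Suc k) - 4 * shoot b a (Suc k) - shoot b a k"

lemma shoot_affine: "shoot b a k = shoot b 0 k + a * shoot (\<lambda>_. 0) 1 k"
  by (induction b a k rule: shoot.induct) (simp_all add: algebra_simps)

lemma mass_shoot: "k < N \<Longrightarrow> mass N (shoot b a) k = b k"
  by (cases k) (simp_all add: mass_def)

text \<open>
  The last row depends on the initial value \<open>a\<close> through the factor \<open>mass N (shoot (\<lambda>_. 0) 1) N\<close>.  Were it zero,
  the mass matrix would have a nontrivial kernel, against its diagonal dominance.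
\<close>

lemma mass_solvable:
  assumes N: "1 \<le> N"
  shows "\<exists>c. \<forall>k\<le>N. mass N c k = b k"
proof -
  let ?p = "shoot (\<lambda>_. 0) 1"
  have p: "mass N ?p N \<noteq> 0"
  proof
    assume 0: "mass N ?p N = 0"
    have "\<bar>mass N ?p k\<bar> \<le> 0" if "k \<le> N" for k
      using 0 mass_shoot[of k N "\<lambda>_. 0" 1] that by (cases "k = N") auto
    from mass_bound[OF N this, of 0] show False by simp
  qed
  define a where "a = (b N - mass N (shoot b 0) N) / mass N ?p N"
  have "mass N (shoot b a) N = mass N (shoot b 0) N + a * mass N ?p N"
    unfolding mass_def shoot_affine[of b a] by (simp add: algebra_simps)
  also have "... = b N" using p by (simp add: a_def)
  finally have "mass N (shoot b a) k = b k" if "k \<le> N" for k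
    using mass_shoot[of k N b a] that by (cases "k = N") auto
  then show ?thesis by blast
qed

text \<open>
  The columns of the inverse mass matrix, that is, the basis dual to the hat functions.  It does not depend on time.
\<close>

definition dual :: "nat \<Rightarrow> nat \<Rightarrow> nat \<Rightarrow> real" where
  "dual N i = (SOME c. \<forall>k\<le>N. J (\<lambda>x. lin N c x * hat N k x) = (if k = i then 1 else 0))"

lemma dual_moment:
  assumes "1 \<le> N" "k \<le> N"
  shows "J (\<lambda>x. lin N (dual N i) x * hat N k x) = (if k = i then 1 else 0)"
proof -
  obtain c where "\<forall>k\<le>N. mass N c k = (if k = i then 6 * real N else 0)"
    using mass_solvable[OF assms(1), of "\<lambda>k. if k = i then 6 * real N else 0"] by auto
  then have "\<forall>k\<le>N. J (\<lambda>x. lin N c x * hat N k x) = (if k = i then 1 else 0)"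
    using assms(1) by (simp add: J_lin_hat)
  then have "\<exists>c. \<forall>k\<le>N. J (\<lambda>x. lin N c x * hat N k x) = (if k = i then 1 else 0)" by blast
  from someI_ex[OF this] show ?thesis unfolding dual_def[symmetric] using assms(2) by blast
qed

text \<open>
  The nodal values of the \<open>L\<^sup>2\<close> projection of \<open>f\<close>.  Through the dual basis they are a fixed linear combination of integrals of \<open>f\<close>,
  which makes them differentiable in time whenever those integrals are.
\<close>

definition Pc :: "nat \<Rightarrow> (real \<Rightarrow> real) \<Rightarrow> nat \<Rightarrow> real" where
  "Pc N f j = (\<Sum>i\<le>N. J (\<lambda>x. f x * hat N i x) * dual N i j)"

lemma lin_Pc: "lin N (Pc N f) x = (\<Sum>i\<le>N. J (\<lambda>x. f x * hat N i x) * lin N (dual N i) x)"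
  unfolding lin_def Pc_def sum_distrib_left sum_distrib_right
  by (subst sum.swap) (simp add: mult.assoc)

lemma Pc_moment:
  assumes "1 \<le> N" "k \<le> N"
  shows "J (\<lambda>x. lin N (Pc N f) x * hat N k x) = J (\<lambda>x. f x * hat N k x)"
proof -
  have "J (\<lambda>x. lin N (Pc N f) x * hat N k x) = 
     J (\<lambda>x. \<Sum>i\<le>N. J (\<lambda>x. f x * hat N i x) * (lin N (dual N i) x * hat N k x))"
    unfolding lin_Pc sum_distrib_right by (simp add: mult.assoc)
  also have "... = (\<Sum>i\<le>N. J (\<lambda>x. f x * hat N i x) * J (\<lambda>x. lin N (dual N i) x * hat N k x))"
    by (subst J_sum) auto
  also have "... = (\<Sum>i\<le>N. if k = i then J (\<lambda>x. f x * hat N i x) else 0)"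
    by (rule sum.cong) (auto simp: dual_moment[OF assms])
  also have "... = J (\<lambda>x. f x * hat N k x)" using assms by simp
  finally show ?thesis .
qed

lemma J_mult_lin:
  assumes "pwc f"
  shows "J (\<lambda>x. f x * lin N c x) = (\<Sum>k\<le>N. c k * J (\<lambda>x. f x * hat N k x))"
proof -
  have "J (\<lambda>x. f x * lin N c x) = J (\<lambda>x. \<Sum>k\<le>N. c k * (f x * hat N k x))"
    unfolding lin_def sum_distrib_left by (simp add: mult_ac)
  then show ?thesis using assms by (subst (asm) J_sum) auto
qed

lemma Pc_orthogonal:
  assumes "1 \<le> N" "pwc f"
  shows "J (\<lambda>x. (f x - lin N (Pc N f) x) * lin N c x) = 0"
proof -
  have "J (\<lambda>x. (f x - lin N (Pc N f) x) * hat N k x) = 0" if "k \<le> N" for k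
    using Pc_moment[OF assms(1) that, of f] assms(2)
    by (simp only: left_diff_distrib) (subst J_diff, auto)
  then show ?thesis using assms(2) by (subst J_mult_lin) auto
qed

lemma L2_projection_unique:
  assumes "1 \<le> N" "pwc f" "\<And>k. k \<le> N \<Longrightarrow> J (\<lambda>x. lin N c x * hat N k x) = J (\<lambda>x. f x * hat N k x)" "i \<le> N"
  shows "c i = Pc N f i"
proof -
  have "\<bar>mass N (\<lambda>i. c i - Pc N f i) k\<bar> \<le> 0" if k: "k \<le> N" for k
  proof -
    have "J (\<lambda>x. lin N (\<lambda>i. c i - Pc N f i) x * hat N k x) = 0"
      unfolding lin_diff left_diff_distrib
      using assms(3)[OF k] Pc_moment[OF assms(1) k, of f] by (subst J_diff) auto
    then show ?thesis unfolding J_lin_hat[OF assms(1) k] using assms(1) by simp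
  qed
  from mass_bound[OF assms(1) this assms(4)] show ?thesis by simp
qed

lemma hat_nonneg: "0 \<le> hat N k x" by (simp add: hat_def)

lemma lin_one: "1 \<le> N \<Longrightarrow> x \<in> {0..1} \<Longrightarrow> lin N (\<lambda>_. 1) x = 1"
  by (rule exists_cell[of N x]) (auto simp: lin_cell)

lemma lin_abs_bound:
  assumes "1 \<le> N" "x \<in> {0..1}" "\<And>i. i \<le> N \<Longrightarrow> \<bar>c i\<bar> \<le> B"
  shows "\<bar>lin N c x\<bar> \<le> B"
proof -
  have "\<bar>lin N c x\<bar> \<le> (\<Sum>i\<le>N. \<bar>c i * hat N i x\<bar>)" unfolding lin_def by (rule sum_abs)
  also have "... \<le> (\<Sum>i\<le>N. B * hat N i x)"
    by (rule sum_mono) (use assms(3) hat_nonneg in \<open>auto simp: abs_mult intro!: mult_right_mono\<close>)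
  also have "... = B * lin N (\<lambda>_. 1) x" by (simp add: lin_def sum_distrib_left)
  finally show ?thesis using lin_one[OF assms(1,2)] by simp
qed

lemma J_hat_le: "1 \<le> N \<Longrightarrow> k \<le> N \<Longrightarrow> J (hat N k) \<le> 1 / real N"
proof -
  assume a: "1 \<le> N" "k \<le> N"
  have "J (hat N k) = J (\<lambda>x. lin N (\<lambda>_. 1) x * hat N k x)"
    by (rule integral_cong) (simp only: lin_one[OF a(1)] mult_1)
  also have "... = mass N (\<lambda>_. 1) k / (6 * real N)" using J_lin_hat[OF a] .
  also have "... \<le> 1 / real N" using a by (auto simp: mass_def field_simps)
  finally show ?thesis .
qed

lemma Pc_nodal_bound:
  assumes N: "1 \<le> N" and f: "pwc f" and "i \<le> N"
    and B: "\<And>k. k \<le> N \<Longrightarrow> \<bar>J (\<lambda>x. (f x - lin N c x) * hat N k x)\<bar> \<le> B / (6 * real N)"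
  shows "\<bar>Pc N f i - c i\<bar> \<le> B"
proof (rule mass_bound[OF N _ assms(3)])
  fix k assume k: "k \<le> N"
  have "J (\<lambda>x. (f x - lin N c x) * hat N k x) = J (\<lambda>x. lin N (\<lambda>i. Pc N f i - c i) x * hat N k x)"
    unfolding lin_diff left_diff_distrib
    using Pc_moment[OF N k, of f] f by (simp add: J_diff pwc_mult)
  then have "\<bar>mass N (\<lambda>i. Pc N f i - c i) k / (6 * real N)\<bar> \<le> B / (6 * real N)"
    using B[OF k] J_lin_hat[OF N k] by simp
  then show "\<bar>mass N (\<lambda>i. Pc N f i - c i) k\<bar> \<le> B" using N by (simp add: abs_divide divide_le_cancel)
qed

text \<open>
  The maximum norm stability of the projection: the moments of \<open>f - lin N c\<close> are at most \<open>B / N\<close>, and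
  the mass matrix bound turns this into nodal errors of at most \<open>6 B\<close>.
\<close>

lemma Pc_stable:
  assumes N: "1 \<le> N" and f: "pwc f" 
    and B: "\<And>x. x \<in> {0..1} \<Longrightarrow> \<bar>f x - lin N c x\<bar> \<le> B" and x: "x \<in> {0..1}"
  shows "\<bar>f x - lin N (Pc N f) x\<bar> \<le> 7 * B"
proof -
  have "\<bar>Pc N f i - c i\<bar> \<le> 6 * B" if "i \<le> N" for i
  proof (rule Pc_nodal_bound[OF N f that])
    fix k assume k: "k \<le> N"
    have B0: "0 \<le> B" using B[of 0] by auto
    have "\<bar>J (\<lambda>x. (f x - lin N c x) * hat N k x)\<bar> \<le> J (\<lambda>x. B * hat N k x)"
      by (rule abs_J_le[where S="{}"]) (use f B hat_nonneg in \<open>auto simp: abs_mult intro!: mult_right_mono\<close>)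
    also have "... \<le> B * (1 / real N)" using J_hat_le[OF N k] B0 by (simp add: mult_left_mono del: times_divide_eq_right)
    finally show "\<bar>J (\<lambda>x. (f x - lin N c x) * hat N k x)\<bar> \<le> 6 * B / (6 * real N)" by simp
  qed
  then have "\<bar>lin N (\<lambda>i. Pc N f i - c i) x\<bar> \<le> 6 * B" by (intro lin_abs_bound[OF N x])
  then show ?thesis using B[OF x] unfolding lin_diff by linarith
qed

text \<open>
  Compare with the nodal interpolant.  On a cell both \<open>f\<close> and its interpolant differ from the tangent at the left
  node by at most \<open>M h\<^sup>2\<close>.
\<close>

lemma Pc_approximation:
  assumes N: "1 \<le> N" and f: "f \<in> Ck 2" and M: "\<And>x. x \<in> {0..1} \<Longrightarrow> \<bar>(Dx ^^ 2) f x\<bar> \<le> M" and x: "x \<in> {0..1}"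
  shows "\<bar>f x - lin N (Pc N f) x\<bar> \<le> 14 * M * (1 / real N)\<^sup>2"
proof -
  have "\<bar>f y - lin N (\<lambda>i. f (nd N i)) y\<bar> \<le> 2 * M * (1 / real N)\<^sup>2" if y: "y \<in> {0..1}" for y
  proof -
    obtain i where i: "i < N" "y \<in> cell N i" using exists_cell[OF N y] .
    note b = cell_bounds[OF N i]
    have M0: "0 \<le> M" using M[of 0] by auto
    define D where "D = (\<lambda>z. f z - f (nd N i) - Dx f (nd N i) * (z - nd N i))"
    have D: "\<bar>D z\<bar> \<le> M * (1 / real N)\<^sup>2" if z: "z \<in> cell N i" for z
    proof -
      have "\<bar>D z\<bar> \<le> M * \<bar>z - nd N i\<bar> ^ 2"
        using Taylor_Icc[of 1 "\<lambda>j. (Dx ^^ j) f" M "nd N i" z] Ck_has_derivative[OF f] M nd_in[of i N] i cell_bounds[OF N i(1) z]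
        by (simp add: D_def numeral_2_eq_2 algebra_simps)
      also have "... \<le> M * (1 / real N)\<^sup>2"
        using z M0 by (intro mult_left_mono power_mono) (auto simp: field_simps add_divide_distrib)
      finally show ?thesis .
    qed
    let ?l = "real N * y - real i"
    have N': "0 < real N" using N by simp
    have e: "f y - lin N (\<lambda>i. f (nd N i)) y = D y - ?l * D (nd N (Suc i))"
      unfolding lin_cell[OF N i] D_def using N' by (simp add: field_simps)
    have "\<bar>?l * D (nd N (Suc i))\<bar> \<le> 1 * (M * (1 / real N)\<^sup>2)" unfolding abs_mult
      by (intro mult_mono) (use b D[of "nd N (Suc i)"] in \<open>auto simp: divide_right_mono\<close>)
    then show ?thesis unfolding e using D[OF i(2)] by linarith
  qed
  from Pc_stable[OF N pwc_continuous[OF Ck_continuous[OF f, of 0, simplified]] this x]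
  show ?thesis by simp
qed

lemma abs_integral_le:
  fixes f :: "real \<Rightarrow> real"
  assumes "f integrable_on {a..b}" "a \<le> b" "\<And>x. x \<in> {a..b} \<Longrightarrow> \<bar>f x\<bar> \<le> B"
  shows "\<bar>integral {a..b} f\<bar> \<le> B * (b - a)"
  using integral_norm_bound_integral[of f "{a..b}" "\<lambda>_. B"] assms
  by (simp add: mult.commute integrable_const_ivl)

text \<open>
  The primitive at \<open>y\<close> is the integral of \<open>w\<close> against the indicator function of \<open>[0,y]\<close>.  That indicator differs
  from a piecewise linear cut-off function only on one cell of length \<open>1 / N\<close>, and \<open>w\<close> does not see the cut-off.
  This gains the power of \<open>h\<close> that separates the error of the elliptic projection from that of its derivative.
\<close>

lemma orthogonal_primitive_bound:
  assumes N: "1 \<le> N" and w: "pwc w" and orth: "\<And>c. J (\<lambda>x. w x * lin N c x) = 0"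
    and B: "\<And>x. x \<in> {0..1} \<Longrightarrow> \<bar>w x\<bar> \<le> B" and y: "y \<in> {0..1}"
  shows "\<bar>integral {0..y} w\<bar> \<le> 2 * B / real N"
proof -
  obtain i where i: "i < N" "y \<in> cell N i" using exists_cell[OF N y] .
  have N': "0 < real N" using N by simp
  let ?\<psi> = "lin N (\<lambda>j. if j \<le> i then 1 else 0)"
  have B0: "0 \<le> B" using B[of 0] by auto
  have nn: "0 \<le> nd N i" "nd N i \<le> nd N (Suc i)" "nd N (Suc i) \<le> 1"
    using nd_in[of "Suc i" N] i by (auto simp: divide_right_mono)
  have p: "pwc (\<lambda>x. w x * ?\<psi> x)" using w by auto
  have left: "?\<psi> x = 1" if x: "x \<in> {0..nd N i}" for x
  proof -
    have "x \<in> {0..1}" using x nn by auto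
    obtain k where k: "k < N" "x \<in> cell N k" using exists_cell[OF N \<open>x \<in> {0..1}\<close>] .
    have "nd N k \<le> nd N i" using k x by auto
    then have "k \<le> i" using N' by (simp add: divide_le_cancel)
    moreover have "real N * x - real k = 0" if "k = i" using x k N' that by (auto simp: field_simps)
    ultimately show ?thesis unfolding lin_cell[OF N k] by (cases "k = i") auto
  qed
  have right: "?\<psi> x = 0" if x: "x \<in> {nd N (Suc i)..1}" for x
  proof -
    have "x \<in> {0..1}" using x order_trans[OF order_trans[OF nn(1,2)], of x] by (simp del: of_nat_Suc)
    obtain k where k: "k < N" "x \<in> cell N k" using exists_cell[OF N \<open>x \<in> {0..1}\<close>] .
    have "nd N (Suc i) \<le> nd N (Suc k)" using k x by auto
    then have "i \<le> k" using N' by (simp add: divide_le_cancel)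
    moreover have "real k + 1 - real N * x = 0" if "k = i" using x k N' that by (auto simp: field_simps)
    ultimately show ?thesis unfolding lin_cell[OF N k] by (cases "k = i") auto
  qed
  have "integral {0..nd N i} (\<lambda>x. w x * ?\<psi> x) + K N i (\<lambda>x. w x * ?\<psi> x) = integral {0..nd N (Suc i)} (\<lambda>x. w x * ?\<psi> x)"
    by (rule Henstock_Kurzweil_Integration.integral_combine) (use nn in \<open>auto intro!: pwc_integrable_sub[OF p] simp del: of_nat_Suc\<close>)
  moreover have "integral {0..nd N (Suc i)} (\<lambda>x. w x * ?\<psi> x) + integral {nd N (Suc i)..1} (\<lambda>x. w x * ?\<psi> x) = J (\<lambda>x. w x * ?\<psi> x)"
    by (rule Henstock_Kurzweil_Integration.integral_combine) (use nn in \<open>auto intro!: pwc_integrable_sub[OF p] simp del: of_nat_Suc\<close>)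
  moreover have "integral {0..nd N i} (\<lambda>x. w x * ?\<psi> x) = integral {0..nd N i} w"
    by (rule integral_cong) (simp add: left)
  moreover have "integral {nd N (Suc i)..1} (\<lambda>x. w x * ?\<psi> x) = integral {nd N (Suc i)..1} (\<lambda>x. 0)"
    by (rule integral_cong) (simp add: right del: of_nat_Suc)
  moreover have "integral {0..nd N i} w + integral {nd N i..y} w = integral {0..y} w"
    by (rule Henstock_Kurzweil_Integration.integral_combine) (use nn i y in \<open>auto intro!: pwc_integrable_sub[OF w] simp del: of_nat_Suc\<close>)
  ultimately have e: "integral {0..y} w = integral {nd N i..y} w - K N i (\<lambda>x. w x * ?\<psi> x)"
    using orth[of "\<lambda>j. if j \<le> i then 1 else 0"] by (simp del: of_nat_Suc)
  have "\<bar>integral {nd N i..y} w\<bar> \<le> B * (y - nd N i)"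
    by (rule abs_integral_le)
       (use nn i y B order_trans[OF nn(1)] in \<open>auto intro!: pwc_integrable_sub[OF w] simp del: of_nat_Suc\<close>)
  also have "... \<le> B * (1 / real N)" using i B0 by (intro mult_left_mono) (auto simp: add_divide_distrib)
  finally have 1: "\<bar>integral {nd N i..y} w\<bar> \<le> B / real N" by simp
  have "\<bar>K N i (\<lambda>x. w x * ?\<psi> x)\<bar> \<le> B * (nd N (Suc i) - nd N i)"
  proof (rule abs_integral_le)
    fix x assume x: "x \<in> cell N i"
    have x01: "x \<in> {0..1}" using cell_bounds[OF N i(1) x] by simp
    have "\<bar>w x\<bar> * \<bar>?\<psi> x\<bar> \<le> B * 1"
      by (intro mult_mono lin_abs_bound[OF N x01] B x01) (use B0 in auto)
    then show "\<bar>w x * ?\<psi> x\<bar> \<le> B" by (simp add: abs_mult)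
  qed (use nn in \<open>auto intro!: pwc_integrable_sub[OF p] simp del: of_nat_Suc\<close>)
  also have "nd N (Suc i) - nd N i = 1 / real N" using N' by (simp add: field_simps)
  finally have 2: "\<bar>K N i (\<lambda>x. w x * ?\<psi> x)\<bar> \<le> B / real N" by simp
  have "2 * B / real N = B / real N + B / real N" by simp
  then show ?thesis unfolding e using 1 2 by linarith
qed

section \<open>Superconvergence of the projection error on uniform meshes\<close>

abbreviation mid :: "nat \<Rightarrow> nat \<Rightarrow> real" where
  "mid N i \<equiv> (real i + 1/2) / real N"

text \<open>
  The two leading terms of the projection error on a cell, in the distance \<open>s\<close> from its midpoint.  The even term is a scaled
  quadratic Legendre polynomial, hence orthogonal to affine functions on the cell; the odd term is smaller by a factor \<open>h\<close>.
\<close>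

definition leg :: "nat \<Rightarrow> real \<Rightarrow> real \<Rightarrow> real \<Rightarrow> real" where
  "leg N a b s = a * (s\<^sup>2 - (1 / real N)\<^sup>2 / 12) + b * (s ^ 3 + (1 / real N)\<^sup>2 * s / 4)"

lemma K_leg_affine:
  assumes "1 \<le> N"
  shows "K N i (\<lambda>x. leg N a b (x - mid N i) * (p + q * (x - mid N i))) = b * q * (1 / real N) ^ 5 / 30"
proof -
  define h where "h = 1 / real N"
  let ?s = "\<lambda>x. x - mid N i"
  define G where "G = (\<lambda>s. (- (a*p*h\<^sup>2/12)) * s + (b*p*h\<^sup>2/4 - a*q*h\<^sup>2/12) * s ^ 2 / 2 + (a * p + b*q*h\<^sup>2/4) * s ^ 3 / 3
     + (a*q+b*p) * s ^ 4 / 4 + b * q * s ^ 5 / 5)"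
  have G: "(G has_real_derivative leg N a b s * (p + q * s)) (at s)" for s
    unfolding leg_def h_def[symmetric] G_def
    by (auto intro!: derivative_eq_intros simp: field_simps power2_eq_square power3_eq_cube power4_eq_xxxx)
  have "K N i (\<lambda>x. leg N a b (?s x) * (p + q * ?s x)) = G (?s (nd N (Suc i))) - G (?s (nd N i))"
  proof (rule K_FTC[OF assms])
    fix x
    have "(?s has_real_derivative 1) (at x)" by (auto intro!: derivative_eq_intros)
    from DERIV_chain2[OF G this]
    show "((\<lambda>x. G (?s x)) has_real_derivative leg N a b (?s x) * (p + q * ?s x)) (at x)" by simp
  qed auto
  also have "?s (nd N (Suc i)) = h / 2" using assms by (auto simp: h_def field_simps)
  also have "?s (nd N i) = - (h / 2)" using assms by (auto simp: h_def field_simps)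
  also have "G (h / 2) - G (- (h / 2)) = b * q * h ^ 5 / 30" unfolding G_def
    by (simp add: power2_eq_square eval_nat_numeral field_simps)
  finally show ?thesis unfolding h_def .
qed

lemma cell_mid:
  assumes "1 \<le> N" "x \<in> cell N i"
  shows "\<bar>x - mid N i\<bar> \<le> 1 / (2 * real N)"
  using assms by (auto simp: field_simps abs_le_iff)

lemma mid_in: "1 \<le> N \<Longrightarrow> i < N \<Longrightarrow> mid N i \<in> {0..1}"
  by (auto simp: field_simps)

text \<open>
  An explicit approximation of the projection.  For a quadratic function the projection is the interpolant
  of \<open>f - h\<^sup>2/12 f''\<close> exactly, up to the boundary, because the error has the Legendre shape on each cell.
\<close>

definition quasi :: "nat \<Rightarrow> (real \<Rightarrow> real) \<Rightarrow> nat \<Rightarrow> real" where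
  "quasi N f i = f (nd N i) - (1 / real N)\<^sup>2 / 12 * (Dx ^^ 2) f (nd N i)"

text \<open>
  Replace \<open>f\<close> and \<open>f''\<close> by their Taylor polynomials of degree three and one at the midpoint, for which the difference is
  exactly \<open>leg\<close>.
\<close>

lemma cell_expansion:
  assumes N: "1 \<le> N" and f: "f \<in> Ck 4" and M: "\<And>x. x \<in> {0..1} \<Longrightarrow> \<bar>(Dx ^^ 4) f x\<bar> \<le> M"
    and i: "i < N" "x \<in> cell N i"
  shows "\<bar>f x - lin N (quasi N f) x - leg N ((Dx ^^ 2) f (mid N i) / 2) ((Dx ^^ 3) f (mid N i) / 6) (x - mid N i)\<bar> \<le> M * (1 / real N) ^ 4"
proof -
  define h where "h = 1 / real N"
  define m where "m = mid N i"
  have N': "0 < real N" using N by simp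
  have h: "0 < h" using N' by (simp add: h_def)
  have m: "m \<in> {0..1}" unfolding m_def by (rule mid_in[OF N i(1)])
  have M0: "0 \<le> M" using M[of 0] by auto
  note b = cell_bounds[OF N i]
  define f0 f1 c d where "f0 = f m" and "f1 = Dx f m" and "c = (Dx ^^ 2) f m / 2" and "d = (Dx ^^ 3) f m / 6"
  define r where "r = (\<lambda>y. f y - (f0 + f1 * (y - m) + c * (y - m)\<^sup>2 + d * (y - m) ^ 3))"
  define r2 where "r2 = (\<lambda>y. (Dx ^^ 2) f y - (2 * c + 6 * d * (y - m)))"
  have near: "\<bar>y - m\<bar> \<le> h / 2" "y \<in> {0..1}" if "y \<in> cell N i" for y
    using cell_mid[OF N that] cell_bounds[OF N i(1) that] by (auto simp: m_def h_def)
  have T3: "(\<Sum>i\<le>3. (Dx ^^ i) f m * s ^ i / fact i) = f0 + f1 * s + c * s\<^sup>2 + d * s ^ 3" for s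
    by (simp add: f0_def f1_def c_def d_def numeral_eq_Suc)
  have T1: "(\<Sum>i\<le>1. (Dx ^^ (Suc (Suc i))) f m * s ^ i / fact i) = 2 * c + 6 * d * s" for s
    by (simp add: c_def d_def numeral_eq_Suc)
  have r: "\<bar>r y\<bar> \<le> M * h ^ 4 / 96" if y: "y \<in> cell N i" for y
  proof -
    have "\<bar>r y\<bar> \<le> M * \<bar>y - m\<bar> ^ 4 / 6"
      using Taylor_Icc[of 3 "\<lambda>j. (Dx ^^ j) f" M m y] Ck_has_derivative[OF f] M m near(2)[OF y]
      unfolding r_def T3[symmetric] by (simp add: numeral_eq_Suc)
    also have "... \<le> M * (h / 2) ^ 4 / 6" using near(1)[OF y] M0 by (intro divide_right_mono mult_left_mono power_mono) auto
    finally show ?thesis by (simp add: power_divide)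
  qed
  have r2: "\<bar>r2 y\<bar> \<le> M * h\<^sup>2 / 4" if y: "y \<in> cell N i" for y
  proof -
    have "\<bar>r2 y\<bar> \<le> M * \<bar>y - m\<bar> ^ 2"
      using Taylor_Icc[of 1 "\<lambda>j. (Dx ^^ (Suc (Suc j))) f" M m y] Ck_has_derivative[OF f, of "Suc (Suc j)" for j] M m near(2)[OF y]
      unfolding r2_def T1[symmetric] by (simp add: numeral_eq_Suc)
    also have "... \<le> M * (h / 2) ^ 2" using near(1)[OF y] M0 by (intro mult_left_mono power_mono) auto
    finally show ?thesis by (simp add: power_divide)
  qed
  let ?s = "x - m"
  let ?a = "nd N i" and ?b = "nd N (Suc i)"
  have ab: "?a \<in> {?a..?b}" "?b \<in> {?a..?b}" by (auto simp: divide_right_mono)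
  have ma: "?a - m = - (h/2)" "?b - m = h/2" using N' by (auto simp: m_def h_def field_simps)
  define w where "w = real N * x - real i"
  have w: "0 \<le> w" "w \<le> 1" using b by (auto simp: w_def)
  have sw: "?s = h * (w - 1/2)" using N' by (simp add: m_def h_def w_def field_simps)
  have qa: "quasi N f i = r ?a - h\<^sup>2 / 12 * r2 ?a + (f0 - f1 * h/2 + c * h\<^sup>2/4 - d * h^3/8 - h\<^sup>2/12 * (2 * c - 3 * d * h))"
    unfolding quasi_def r_def r2_def ma h_def[symmetric] by (simp add: field_simps power2_eq_square power3_eq_cube)
  have qb: "quasi N f (Suc i) = r ?b - h\<^sup>2 / 12 * r2 ?b + (f0 + f1 * h/2 + c * h\<^sup>2/4 + d * h^3/8 - h\<^sup>2/12 * (2 * c + 3 * d * h))"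
    unfolding quasi_def r_def r2_def ma h_def[symmetric] by (simp add: field_simps power2_eq_square power3_eq_cube)
  have l: "lin N (quasi N f) x = quasi N f i * (1 - w) + quasi N f (Suc i) * w"
    unfolding lin_cell[OF N i] by (simp add: w_def algebra_simps)
  have fx: "f x = r x + (f0 + f1 * ?s + c * ?s\<^sup>2 + d * ?s ^ 3)" by (simp add: r_def)
  have "f x - lin N (quasi N f) x - leg N c d ?s = 
     r x - (1 - w) * (r ?a - h\<^sup>2 / 12 * r2 ?a) - w * (r ?b - h\<^sup>2 / 12 * r2 ?b)"
    unfolding l qa qb fx leg_def h_def[symmetric] sw
    by (simp add: field_simps power2_eq_square power3_eq_cube)
  moreover have e: "\<bar>r y - h\<^sup>2 / 12 * r2 y\<bar> \<le> M * h ^ 4 / 32" if y: "y \<in> {?a..?b}" for y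
  proof -
    have "\<bar>h\<^sup>2 / 12 * r2 y\<bar> \<le> h\<^sup>2 / 12 * (M * h\<^sup>2 / 4)" unfolding abs_mult
      by (intro mult_mono r2[OF y]) auto
    also have "... = M * h ^ 4 / 48" by (simp add: power2_eq_square power4_eq_xxxx)
    finally show ?thesis using r[OF y] by linarith
  qed
  moreover have "\<bar>(1 - w) * (r ?a - h\<^sup>2 / 12 * r2 ?a)\<bar> \<le> 1 * (M * h ^ 4 / 32)"
    unfolding abs_mult by (intro mult_mono e ab) (use w in auto)
  moreover have "\<bar>w * (r ?b - h\<^sup>2 / 12 * r2 ?b)\<bar> \<le> 1 * (M * h ^ 4 / 32)"
    unfolding abs_mult by (intro mult_mono e ab) (use w in auto)
  moreover have "0 \<le> M * h ^ 4" using M0 by simp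
  ultimately have "\<bar>f x - lin N (quasi N f) x - leg N c d ?s\<bar> \<le> M * h ^ 4"
    using r[OF i(2)] by linarith
  then show ?thesis by (simp add: h_def c_def d_def m_def)
qed

text \<open>
  Against a hat function the even terms contribute nothing.  The odd terms contribute \<open>h\<^sup>4/30\<close> times a sixth of the third derivative at the two
  adjacent midpoints, with opposite signs: at an interior node they cancel up to \<open>h\<^sup>5\<close>, at a boundary node one of them
  is missing and the bound is worse by a factor \<open>h\<close>.
\<close>

lemma quasi_moment:
  assumes N: "1 \<le> N" and f: "f \<in> Ck 4" and M: "\<And>j x. j \<le> 4 \<Longrightarrow> x \<in> {0..1} \<Longrightarrow> \<bar>(Dx ^^ j) f x\<bar> \<le> M"
    and k: "k \<le> N"
  shows "\<bar>J (\<lambda>x. (f x - lin N (quasi N f) x) * hat N k x)\<bar> \<le> 3 * M * (1 / real N) ^ 4"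
    and "0 < k \<Longrightarrow> k < N \<Longrightarrow> \<bar>J (\<lambda>x. (f x - lin N (quasi N f) x) * hat N k x)\<bar> \<le> 3 * M * (1 / real N) ^ 5"
proof -
  define h where "h = 1 / real N"
  have N': "0 < real N" using N by simp
  have h: "0 < h" "h \<le> 1" using N by (auto simp: h_def)
  have M0: "0 \<le> M" using M[of 0 0] by auto
  have M4: "\<bar>(Dx ^^ 4) f x\<bar> \<le> M" if "x \<in> {0..1}" for x using M[of 4] that by simp
  define g where "g = (\<lambda>x. f x - lin N (quasi N f) x)"
  have g: "pwc g" unfolding g_def using Ck_continuous[OF f, of 0]
    by (intro pwc_diff[OF pwc_continuous pwc_lin]) auto
  define a b where "a = (\<lambda>i. (Dx ^^ 2) f (mid N i) / 2)" and "b = (\<lambda>i. (Dx ^^ 3) f (mid N i) / 6)"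
  \<comment> \<open>Both halves of a hat function are affine with absolute value at most one on their cell.\<close>
  have cell: "\<bar>K N i (\<lambda>x. g x * (p + q * (x - mid N i))) - b i * q * h ^ 5 / 30\<bar> \<le> M * h ^ 5"
    if i: "i < N" and w: "\<And>x. x \<in> cell N i \<Longrightarrow> \<bar>p + q * (x - mid N i)\<bar> \<le> 1" for i p q
  proof -
    let ?L = "\<lambda>x. leg N (a i) (b i) (x - mid N i) * (p + q * (x - mid N i))"
    let ?G = "\<lambda>x. g x * (p + q * (x - mid N i))"
    have "pwc ?L" unfolding leg_def by (intro pwc_rules)
    from cell_integrable[OF N i this] have iL: "?L integrable_on cell N i" .
    have "pwc ?G" by (intro pwc_rules g)
    from cell_integrable[OF N i this] have iG: "?G integrable_on cell N i" .
    have "K N i ?G - K N i ?L = K N i (\<lambda>x. ?G x - ?L x)" by (rule integral_diff[OF iG iL, symmetric])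
    also have "\<bar>K N i (\<lambda>x. ?G x - ?L x)\<bar> \<le> (M * h ^ 4) * (nd N (Suc i) - nd N i)"
    proof (rule abs_integral_le)
      show "(\<lambda>x. ?G x - ?L x) integrable_on cell N i" by (rule integrable_diff[OF iG iL])
      fix x assume x: "x \<in> cell N i"
      have "\<bar>(g x - leg N (a i) (b i) (x - mid N i)) * (p + q * (x - mid N i))\<bar> \<le> (M * h ^ 4) * 1"
        unfolding abs_mult
        by (intro mult_mono w x) (use cell_expansion[OF N f M4 i x] M0 in \<open>auto simp: g_def a_def b_def h_def\<close>)
      then show "\<bar>?G x - ?L x\<bar> \<le> M * h ^ 4" by (simp add: algebra_simps)
    qed (auto simp: divide_right_mono)
    also have "nd N (Suc i) - nd N i = h" using N' by (simp add: h_def field_simps)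
    finally show ?thesis unfolding K_leg_affine[OF N] h_def[symmetric] by (simp add: eval_nat_numeral algebra_simps)
  qed
  have left: "\<bar>K N (k - 1) (\<lambda>x. g x * (real N * x - (real k - 1))) - b (k - 1) * h ^ 4 / 30\<bar> \<le> M * h ^ 5" if "0 < k"
  proof -
    have i: "k - 1 < N" using k that by auto
    have e: "real N * x - (real k - 1) = 1/2 + real N * (x - mid N (k - 1))" for x
      using that N' by (simp add: of_nat_diff field_simps)
    have "\<bar>K N (k - 1) (\<lambda>x. g x * (1/2 + real N * (x - mid N (k - 1)))) - b (k - 1) * real N * h ^ 5 / 30\<bar> \<le> M * h ^ 5"
    proof (rule cell[OF i])
      fix x assume x: "x \<in> cell N (k - 1)"
      show "\<bar>1/2 + real N * (x - mid N (k - 1))\<bar> \<le> 1" unfolding e[symmetric]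
        using cell_bounds[OF N i x] that by (simp add: of_nat_diff abs_le_iff)
    qed
    moreover have "real N * h ^ 5 = h ^ 4" using N' by (simp add: h_def eval_nat_numeral)
    ultimately show ?thesis unfolding e by (simp add: mult.assoc)
  qed
  have right: "\<bar>K N k (\<lambda>x. g x * (real k + 1 - real N * x)) - (- b k * h ^ 4 / 30)\<bar> \<le> M * h ^ 5" if i: "k < N"
  proof -
    have e: "real k + 1 - real N * x = 1/2 + (- real N) * (x - mid N k)" for x
      using that N' by (simp add: field_simps)
    have "\<bar>K N k (\<lambda>x. g x * (1/2 + (- real N) * (x - mid N k))) - b k * (- real N) * h ^ 5 / 30\<bar> \<le> M * h ^ 5"
    proof (rule cell[OF i])
      fix x assume x: "x \<in> cell N k"
      show "\<bar>1/2 + (- real N) * (x - mid N k)\<bar> \<le> 1" unfolding e[symmetric]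
        using cell_bounds[OF N i x] by (simp add: abs_le_iff)
    qed
    moreover have "real N * h ^ 5 = h ^ 4" using N' by (simp add: h_def eval_nat_numeral)
    ultimately show ?thesis unfolding e by (simp add: mult.assoc)
  qed
  have bb: "\<bar>b i\<bar> \<le> M / 6" if "i < N" for i
    using M[of 3, OF _ mid_in[OF N that]] by (simp add: b_def)
  have h45: "h ^ 5 \<le> h ^ 4" using h by (intro power_decreasing) auto
  have h4: "0 \<le> h ^ 4" using h by simp
  have bh: "\<bar>b i * h ^ 4 / 30\<bar> \<le> M / 6 * h ^ 4 / 30" if "i < N" for i
    using mult_right_mono[OF bb[OF that] h4] h by (simp add: abs_mult)
  note JH = J_hat[OF N k g]
  have "\<bar>J (\<lambda>x. g x * hat N k x)\<bar> \<le> 3 * M * h ^ 4"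
  proof -
    have "\<bar>J (\<lambda>x. g x * hat N k x)\<bar> \<le> 2 * (M * h ^ 5) + 2 * (M / 6 * h ^ 4 / 30)"
    proof -
      have z: "0 \<le> M * h ^ 5" "0 \<le> M / 6 * h ^ 4 / 30" using M0 h by auto
      have L: "\<bar>if 0 < k then K N (k - 1) (\<lambda>x. g x * (real N * x - (real k - 1))) else 0\<bar> \<le> M * h ^ 5 + M / 6 * h ^ 4 / 30"
      proof (cases "0 < k")
        case True
        then have "k - 1 < N" using k by simp
        from left[OF True] bh[OF this] show ?thesis unfolding if_P[OF True] by linarith
      qed (use z in simp)
      have R: "\<bar>if k < N then K N k (\<lambda>x. g x * (real k + 1 - real N * x)) else 0\<bar> \<le> M * h ^ 5 + M / 6 * h ^ 4 / 30"
      proof (cases "k < N")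
        case True
        from right[OF True] bh[OF True] show ?thesis unfolding if_P[OF True] by linarith
      qed (use z in simp)
      show ?thesis unfolding JH using L R by linarith
    qed
    moreover have "M * h ^ 5 \<le> M * h ^ 4" "0 \<le> M * h ^ 4" using h45 M0 h by (auto intro: mult_left_mono)
    ultimately show ?thesis by linarith
  qed
  then show "\<bar>J (\<lambda>x. (f x - lin N (quasi N f) x) * hat N k x)\<bar> \<le> 3 * M * (1 / real N) ^ 4"
    by (simp add: g_def h_def)
  assume k': "0 < k" "k < N"
  have "\<bar>(Dx ^^ 3) f (mid N (k - 1)) - (Dx ^^ 3) f (mid N k)\<bar> \<le> M * h"
  proof -
    have "\<bar>(Dx ^^ 3) f (mid N (k - 1)) - (Dx ^^ 3) f (mid N k)\<bar> \<le> M * \<bar>mid N (k - 1) - mid N k\<bar>"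
      using field_differentiable_bound[of "{0..1}" "(Dx ^^ 3) f" "(Dx ^^ 4) f" M "mid N (k - 1)" "mid N k"]
        Ck_has_derivative[OF f, of 3] M4 mid_in[OF N, of k] mid_in[OF N, of "k - 1"] k' 
      by (simp add: eval_nat_numeral)
    also have "\<bar>mid N (k - 1) - mid N k\<bar> = h" using k' N' by (simp add: h_def of_nat_diff field_simps)
    finally show ?thesis .
  qed
  then have "\<bar>b (k - 1) - b k\<bar> \<le> M * h / 6" unfolding b_def by linarith
  from mult_right_mono[OF this h4] have "\<bar>b (k - 1) * h ^ 4 / 30 - b k * h ^ 4 / 30\<bar> \<le> M * h ^ 5 / 180"
  proof -
    assume le: "\<bar>b (k - 1) - b k\<bar> * h ^ 4 \<le> M * h / 6 * h ^ 4"
    have "b (k - 1) * h ^ 4 / 30 - b k * h ^ 4 / 30 = (b (k - 1) - b k) * (h ^ 4 / 30)"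
      by (simp add: algebra_simps)
    then have "\<bar>b (k - 1) * h ^ 4 / 30 - b k * h ^ 4 / 30\<bar> = \<bar>b (k - 1) - b k\<bar> * h ^ 4 / 30"
      using h by (simp only: abs_mult) simp
    also have "... \<le> M * h / 6 * h ^ 4 / 30" using le by (rule divide_right_mono) simp
    also have "... = M * h ^ 5 / 180" by (simp add: eval_nat_numeral)
    finally show ?thesis .
  qed
  moreover have "0 \<le> M * h ^ 5" using M0 h by auto
  ultimately have "\<bar>J (\<lambda>x. g x * hat N k x)\<bar> \<le> 3 * M * h ^ 5"
    unfolding JH using left[OF k'(1)] right[OF k'(2)] k' by (simp only: if_True) linarith
  then show "\<bar>J (\<lambda>x. (f x - lin N (quasi N f) x) * hat N k x)\<bar> \<le> 3 * M * (1 / real N) ^ 5"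
    by (simp add: g_def h_def)
qed

lemma Pc_close_quasi:
  assumes N: "1 \<le> N" and f: "f \<in> Ck 4" and M: "\<And>j x. j \<le> 4 \<Longrightarrow> x \<in> {0..1} \<Longrightarrow> \<bar>(Dx ^^ j) f x\<bar> \<le> M"
    and k: "k \<le> N"
  shows "\<bar>Pc N f k - quasi N f k\<bar> \<le> 18 * M * (1 / real N) ^ 3"
proof (rule Pc_nodal_bound[OF N _ k])
  show "pwc f" using Ck_continuous[OF f, of 0] by (intro pwc_continuous) auto
  fix k assume "k \<le> N"
  from quasi_moment(1)[OF N f M this] 
  show "\<bar>J (\<lambda>x. (f x - lin N (quasi N f) x) * hat N k x)\<bar> \<le> 18 * M * (1 / real N) ^ 3 / (6 * real N)"
    using N by (simp add: eval_nat_numeral)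
qed

text \<open>
  The nodal errors \<open>e\<close> are of order \<open>h\<^sup>3\<close> only, because of the two boundary rows.  The products \<open>u e\<close> vanish in these
  rows, and in the others they satisfy the same tridiagonal equations up to the commutators
  \<open>(u k - u (k \<plusminus> 1)) e (k \<plusminus> 1)\<close>, which are of order \<open>h\<^sup>4\<close>.  Diagonal dominance then bounds the products.
\<close>

lemma Pc_close_quasi_weighted:
  assumes N: "1 \<le> N" and f: "f \<in> Ck 4" and M: "\<And>j x. j \<le> 4 \<Longrightarrow> x \<in> {0..1} \<Longrightarrow> \<bar>(Dx ^^ j) f x\<bar> \<le> M"
    and u: "u \<in> Ck0 1" "\<And>j x. j \<le> 1 \<Longrightarrow> x \<in> {0..1} \<Longrightarrow> \<bar>(Dx ^^ j) u x\<bar> \<le> M"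
    and k: "k \<le> N"
  shows "\<bar>u (nd N k) * (Pc N f k - quasi N f k)\<bar> \<le> 54 * M\<^sup>2 * (1 / real N) ^ 4"
proof -
  define h where "h = 1 / real N"
  define e where "e = (\<lambda>k. Pc N f k - quasi N f k)"
  define g where "g = (\<lambda>k. u (nd N k) * e k)"
  have N': "0 < real N" using N by simp
  have h: "0 < h" using N by (simp add: h_def)
  have M0: "0 \<le> M" using M[of 0 0] by auto
  have e: "\<bar>e k\<bar> \<le> 18 * M * h ^ 3" if "k \<le> N" for k
    using Pc_close_quasi[OF N f M that] by (simp add: e_def h_def)
  have f': "pwc f" using Ck_continuous[OF f, of 0] by (intro pwc_continuous) auto
  have uu: "\<bar>u x - u y\<bar> \<le> M * \<bar>x - y\<bar>" if "x \<in> {0..1}" "y \<in> {0..1}" for x y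
    using field_differentiable_bound[of "{0..1}" u "Dx u" M x y] Ck_has_derivative[of u 1 0] u that
    by (fastforce simp: Ck0_def)
  have u_bd: "u (nd N 0) = 0" "u (nd N N) = 0" using u N' by (auto simp: Ck0_def)
  have "\<bar>g k\<bar> \<le> 54 * M\<^sup>2 * h ^ 4"
  proof (rule diagonal_dominance_bound[OF _ k])
    fix k m assume k: "k \<le> N" and m: "\<And>j. j \<le> N \<Longrightarrow> \<bar>g j\<bar> \<le> m"
    have m0: "0 \<le> m" using m[of 0] by auto
    have B0: "0 \<le> 54 * M\<^sup>2 * h ^ 4" using h by simp
    show "2 * \<bar>g k\<bar> \<le> 54 * M\<^sup>2 * h ^ 4 + m"
    proof (cases "0 < k \<and> k < N")
      case False
      then have "k = 0 \<or> k = N" using k by auto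
      then have "g k = 0" using u_bd by (auto simp: g_def)
      then show ?thesis using m0 B0 by simp
    next
      case True
      then have k': "k - 1 \<le> N" "Suc k \<le> N" by auto
      have "\<bar>mass N e k\<bar> \<le> 18 * M * h ^ 4"
      proof -
        have "J (\<lambda>x. (f x - lin N (quasi N f) x) * hat N k x) = J (\<lambda>x. lin N e x * hat N k x)"
          unfolding e_def lin_diff left_diff_distrib
          using Pc_moment[OF N k, of f] f' by (simp add: J_diff pwc_mult)
        then have "\<bar>mass N e k / (6 * real N)\<bar> \<le> 3 * M * h ^ 5"
          using quasi_moment(2)[OF N f M k] True J_lin_hat[OF N k] by (simp add: h_def)
        then have "\<bar>mass N e k\<bar> \<le> 3 * M * h ^ 5 * (6 * real N)" using N' by (simp add: abs_divide divide_le_eq)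
        also have "... = 18 * M * h ^ 4" using N' by (simp add: h_def eval_nat_numeral)
        finally show ?thesis .
      qed
      then have 1: "\<bar>u (nd N k) * mass N e k\<bar> \<le> M * (18 * M * h ^ 4)"
        unfolding abs_mult using u(2)[of 0 "nd N k"] nd_in[OF k] M0 h by (intro mult_mono) auto
      have d: "\<bar>(u (nd N k) - u (nd N j)) * e j\<bar> \<le> (M * h) * (18 * M * h ^ 3)" 
        if j: "j \<le> N" "\<bar>nd N k - nd N j\<bar> = h" for j
        unfolding abs_mult using uu[OF nd_in[OF k] nd_in[OF j(1)]] j(2) e[OF j(1)] M0 h by (intro mult_mono) auto
      have "\<bar>nd N k - nd N (k - 1)\<bar> = h" "\<bar>nd N k - nd N (Suc k)\<bar> = h"
        using True N' by (auto simp: h_def of_nat_diff field_simps)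
      note 2 = d[OF k'(1) this(1)] and 3 = d[OF k'(2) this(2)]
      have 4: "4 * g k = u (nd N k) * mass N e k - (u (nd N k) - u (nd N (k - 1))) * e (k - 1) - (u (nd N k) - u (nd N (Suc k))) * e (Suc k) - g (k - 1) - g (Suc k)"
        using True by (simp add: mass_interior g_def algebra_simps)
      have 5: "M * (18 * M * h ^ 4) = 18 * (M\<^sup>2 * h ^ 4)" "(M * h) * (18 * M * h ^ 3) = 18 * (M\<^sup>2 * h ^ 4)"
        by (auto simp: eval_nat_numeral)
      have "4 * \<bar>g k\<bar> = \<bar>4 * g k\<bar>" by (simp add: abs_mult)
      also have "... \<le> 54 * (M\<^sup>2 * h ^ 4) + 2 * m"
        unfolding 4 using 1 2 3 m[OF k'(1)] m[OF k'(2)] unfolding 5 by linarith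
      finally have "4 * \<bar>g k\<bar> \<le> 54 * (M\<^sup>2 * h ^ 4) + 2 * m" .
      moreover have "54 * M\<^sup>2 * h ^ 4 = 54 * (M\<^sup>2 * h ^ 4)" by simp
      ultimately show ?thesis using B0 by linarith
    qed
  qed
  then show ?thesis by (simp add: g_def e_def h_def)
qed

text \<open>
  Up to terms that are pointwise of order \<open>h\<^sup>4\<close>, the integrand is \<open>leg\<close> times the tangent of \<open>u\<close> at the midpoint, whose
  integral over the cell has order \<open>h\<^sup>5\<close> by symmetry.
\<close>

lemma cell_moment_superclose:
  assumes N: "1 \<le> N" and f: "f \<in> Ck 4" and M: "\<And>j x. j \<le> 4 \<Longrightarrow> x \<in> {0..1} \<Longrightarrow> \<bar>(Dx ^^ j) f x\<bar> \<le> M"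
    and u: "u \<in> Ck0 2" "\<And>j x. j \<le> 2 \<Longrightarrow> x \<in> {0..1} \<Longrightarrow> \<bar>(Dx ^^ j) u x\<bar> \<le> M"
    and i: "i < N"
  shows "\<bar>K N i (\<lambda>x. (f x - lin N (Pc N f) x) * u x)\<bar> \<le> 80 * M\<^sup>2 * (1 / real N) ^ 5"
proof -
  define h where "h = 1 / real N"
  define m where "m = mid N i"
  define e where "e = (\<lambda>k. Pc N f k - quasi N f k)"
  define a b where "a = (Dx ^^ 2) f m / 2" and "b = (Dx ^^ 3) f m / 6"
  have N': "0 < real N" using N by simp
  have h: "0 < h" "h \<le> 1" using N by (auto simp: h_def)
  have M0: "0 \<le> M" using M[of 0 0] by auto
  have M4: "\<bar>(Dx ^^ 4) f x\<bar> \<le> M" if "x \<in> {0..1}" for x using M[of 4] that by simp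
  have m: "m \<in> {0..1}" unfolding m_def by (rule mid_in[OF N i])
  have u2: "u \<in> Ck 2" using u by (simp add: Ck0_def)
  have u1: "u \<in> Ck0 1" using u unfolding Ck0_def Ck_def
    by (auto intro: differentiable_imp_continuous_on simp: numeral_2_eq_2 less_Suc_eq)
  have f': "pwc f" using Ck_continuous[OF f, of 0] by (intro pwc_continuous) auto
  have pu: "pwc u" using Ck_continuous[OF u2, of 0] by (intro pwc_continuous) auto
  have uu: "\<bar>u x - u y\<bar> \<le> M * \<bar>x - y\<bar>" if "x \<in> {0..1}" "y \<in> {0..1}" for x y
    using field_differentiable_bound[of "{0..1}" u "Dx u" M x y] Ck_has_derivative[OF u2, of 0] u(2)[of 1] that
    by (auto)
  let ?C = "cell N i"
  let ?L = "\<lambda>x. leg N a b (x - m) * (u m + Dx u m * (x - m))"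
  let ?G = "\<lambda>x. (f x - lin N (Pc N f) x) * u x"
  have "pwc ?L" unfolding leg_def by (intro pwc_rules)
  from cell_integrable[OF N i this] have iL: "?L integrable_on ?C" .
  have "pwc ?G" by (intro pwc_rules f' pu pwc_lin)
  from cell_integrable[OF N i this] have iG: "?G integrable_on ?C" .
  have main: "\<bar>?G x - ?L x\<bar> \<le> 76 * M\<^sup>2 * h ^ 4" if x: "x \<in> ?C" for x
  proof -
    note bx = cell_bounds[OF N i x]
    have x01: "x \<in> {0..1}" using bx by simp
    have s: "\<bar>x - m\<bar> \<le> h / 2" using cell_mid[OF N x] by (simp add: m_def h_def)
    define s where "s = x - m"
    define r where "r = f x - lin N (quasi N f) x - leg N a b s"
    have r: "\<bar>r\<bar> \<le> M * h ^ 4" using cell_expansion[OF N f M4 i x] by (simp add: r_def a_def b_def m_def s_def h_def)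
    define ru where "ru = u x - (u m + Dx u m * s)"
    have ru: "\<bar>ru\<bar> \<le> M * h\<^sup>2 / 4"
    proof -
      have "(\<Sum>i\<le>1. (Dx ^^ i) u m * s ^ i / fact i) = u m + Dx u m * s" by simp
      then have "\<bar>ru\<bar> \<le> M * \<bar>s\<bar> ^ 2"
        using Taylor_Icc[of 1 "\<lambda>j. (Dx ^^ j) u" M m x] Ck_has_derivative[OF u2] u(2)[of 2] m x01
        unfolding ru_def s_def by (simp add: numeral_eq_Suc)
      also have "... \<le> M * (h / 2) ^ 2" using s M0 by (intro mult_left_mono power_mono) (auto simp: s_def)
      finally show ?thesis by (simp add: power_divide)
    qed
    have lg: "\<bar>leg N a b s\<bar> \<le> M * h\<^sup>2"
    proof -
      have s2: "s\<^sup>2 \<le> (h/2)\<^sup>2" using s abs_le_square_iff[of s "h/2"] h by (simp add: s_def)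
      have a: "\<bar>a\<bar> \<le> M / 2" using M[of 2 m] m by (simp add: a_def)
      have b: "\<bar>b\<bar> \<le> M / 6" using M[of 3 m] m by (simp add: b_def)
      have "s\<^sup>2 \<le> h\<^sup>2 / 4" using s2 by (simp add: power_divide)
      then have "\<bar>s\<^sup>2 - h\<^sup>2 / 12\<bar> \<le> h\<^sup>2 / 2" using zero_le_power2[of s] zero_le_power2[of h]
        by (intro abs_leI; linarith)
      with a have 1: "\<bar>a * (s\<^sup>2 - h\<^sup>2 / 12)\<bar> \<le> M / 2 * (h\<^sup>2 / 2)" unfolding abs_mult by (intro mult_mono) auto
      have "s ^ 3 + h\<^sup>2 * s / 4 = s * (s\<^sup>2 + h\<^sup>2 / 4)" by (simp add: power2_eq_square power3_eq_cube algebra_simps)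
      also have "\<bar>...\<bar> \<le> 1 * (h\<^sup>2 / 2)" unfolding abs_mult
        by (intro mult_mono) (use s s2 h in \<open>auto simp: s_def power_divide\<close>)
      finally have "\<bar>s ^ 3 + h\<^sup>2 * s / 4\<bar> \<le> h\<^sup>2 / 2" by simp
      with b have 2: "\<bar>b * (s ^ 3 + h\<^sup>2 * s / 4)\<bar> \<le> M / 6 * (h\<^sup>2 / 2)" unfolding abs_mult by (intro mult_mono) auto
      have "\<bar>leg N a b s\<bar> \<le> \<bar>a * (s\<^sup>2 - h\<^sup>2 / 12)\<bar> + \<bar>b * (s ^ 3 + h\<^sup>2 * s / 4)\<bar>"
        unfolding leg_def h_def[symmetric] by (rule abs_triangle_ineq)
      moreover have "0 \<le> M * h\<^sup>2" using M0 by simp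
      ultimately show ?thesis using 1 2 by linarith
    qed
    define w where "w = real N * x - real i"
    have w: "0 \<le> w" "w \<le> 1" using bx by (auto simp: w_def)
    have dist: "\<bar>x - nd N i\<bar> \<le> h" "\<bar>x - nd N (Suc i)\<bar> \<le> h" using x by (auto simp: h_def add_divide_distrib abs_le_iff)
    have eu: "\<bar>e k * u x\<bar> \<le> 72 * M\<^sup>2 * h ^ 4" if k: "k \<le> N" "\<bar>x - nd N k\<bar> \<le> h" for k
    proof -
      have "\<bar>u (nd N k) * e k\<bar> \<le> 54 * M\<^sup>2 * h ^ 4"
        using Pc_close_quasi_weighted[OF N f M u1 _ k(1)] u(2) by (auto simp: e_def h_def)
      moreover have "\<bar>(u x - u (nd N k)) * e k\<bar> \<le> (M * h) * (18 * M * h ^ 3)" unfolding abs_mult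
      proof (rule mult_mono)
        show "\<bar>u x - u (nd N k)\<bar> \<le> M * h" using uu[OF x01 nd_in[OF k(1)]] mult_left_mono[OF k(2) M0] by linarith
        show "\<bar>e k\<bar> \<le> 18 * M * h ^ 3" using Pc_close_quasi[OF N f M k(1)] by (simp add: e_def h_def)
      qed (use M0 h in auto)
      moreover have "(M * h) * (18 * M * h ^ 3) = 18 * M\<^sup>2 * h ^ 4" by (simp add: eval_nat_numeral)
      moreover have "e k * u x = u (nd N k) * e k + (u x - u (nd N k)) * e k" by (simp add: algebra_simps)
      ultimately show ?thesis by linarith
    qed
    have le: "lin N e x * u x = (1 - w) * (e i * u x) + w * (e (Suc i) * u x)"
      unfolding lin_cell[OF N i x] w_def by (simp add: algebra_simps)
    have "\<bar>(1 - w) * (e i * u x)\<bar> \<le> (1 - w) * (72 * M\<^sup>2 * h ^ 4)"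
      using eu[of i] i dist w by (simp only: abs_mult[of "1 - w"]) (intro mult_mono, auto)
    moreover have "\<bar>w * (e (Suc i) * u x)\<bar> \<le> w * (72 * M\<^sup>2 * h ^ 4)"
      using eu[of "Suc i"] i dist w by (simp only: abs_mult[of w]) (intro mult_mono, auto)
    ultimately have E: "\<bar>lin N e x * u x\<bar> \<le> 72 * M\<^sup>2 * h ^ 4" unfolding le by (simp add: algebra_simps)
    have "lin N e x = lin N (Pc N f) x - lin N (quasi N f) x" unfolding e_def by (rule lin_diff)
    then have "lin N (Pc N f) x = lin N (quasi N f) x + lin N e x" by simp
    then have "?G x - ?L x = r * u x + leg N a b s * ru - lin N e x * u x"
      unfolding r_def ru_def s_def by (simp only:) (simp add: algebra_simps)
    moreover have "\<bar>r * u x\<bar> \<le> (M * h ^ 4) * M" unfolding abs_mult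
      by (intro mult_mono r) (use u(2)[of 0 x] x01 M0 h in auto)
    moreover have "\<bar>leg N a b s * ru\<bar> \<le> (M * h\<^sup>2) * (M * h\<^sup>2 / 4)" unfolding abs_mult
      by (intro mult_mono lg ru) (use M0 in auto)
    moreover have "(M * h ^ 4) * M = M\<^sup>2 * h ^ 4" "(M * h\<^sup>2) * (M * h\<^sup>2 / 4) = M\<^sup>2 * h ^ 4 / 4"
      by (simp_all add: eval_nat_numeral)
    moreover have "0 \<le> M\<^sup>2 * h ^ 4" by simp
    ultimately show ?thesis using E by linarith
  qed
  have "K N i ?G - K N i ?L = K N i (\<lambda>x. ?G x - ?L x)" by (rule integral_diff[OF iG iL, symmetric])
  also have "\<bar>...\<bar> \<le> (76 * M\<^sup>2 * h ^ 4) * (nd N (Suc i) - nd N i)"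
    by (rule abs_integral_le[OF integrable_diff[OF iG iL] _ main]) (auto simp: divide_right_mono)
  also have "nd N (Suc i) - nd N i = h" using N' by (simp add: h_def field_simps)
  also have "(76 * M\<^sup>2 * h ^ 4) * h = 76 * (M\<^sup>2 * h ^ 5)" by (simp add: eval_nat_numeral)
  finally have 1: "\<bar>K N i ?G - K N i ?L\<bar> \<le> 76 * (M\<^sup>2 * h ^ 5)" .
  have 2: "K N i ?L = b * Dx u m * h ^ 5 / 30"
    unfolding m_def h_def by (rule K_leg_affine[OF N])
  have "\<bar>b * Dx u m\<bar> \<le> M * M" unfolding abs_mult
    by (intro mult_mono) (use u(2)[of 1 m] M[of 3 m] m M0 in \<open>auto simp: b_def\<close>)
  then have "\<bar>b * Dx u m\<bar> * (h ^ 5 / 30) \<le> (M * M) * (h ^ 5 / 30)" using h by (intro mult_right_mono) auto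
  then have "\<bar>K N i ?L\<bar> \<le> M\<^sup>2 * h ^ 5 / 30" unfolding 2 using h by (simp add: abs_mult power2_eq_square)
  moreover have "0 \<le> M\<^sup>2 * h ^ 5" using h by simp
  ultimately have "\<bar>K N i ?G\<bar> \<le> 80 * (M\<^sup>2 * h ^ 5)" using 1 by linarith
  then show ?thesis by (simp add: h_def)
qed

text \<open>
  The slope is constant on each cell and multiplies an integral of order \<open>h\<^sup>5\<close>.  The split \<open>2 h\<^sup>3 (h \<bar>slope\<bar>) \<le> h\<^sup>6 + h\<^sup>2 slope\<^sup>2\<close>
  and the inverse inequality do the rest.
\<close>

lemma superconvergent_flux:
  assumes N: "1 \<le> N" and f: "f \<in> Ck 4" and M: "\<And>j x. j \<le> 4 \<Longrightarrow> x \<in> {0..1} \<Longrightarrow> \<bar>(Dx ^^ j) f x\<bar> \<le> M"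
    and u: "u \<in> Ck0 2" "\<And>j x. j \<le> 2 \<Longrightarrow> x \<in> {0..1} \<Longrightarrow> \<bar>(Dx ^^ j) u x\<bar> \<le> M"
  shows "\<bar>J (\<lambda>x. (f x - lin N (Pc N f) x) * u x * slope N c x)\<bar>
     \<le> 40 * M\<^sup>2 * ((1 / real N) ^ 6 + 12 * J (\<lambda>x. (lin N c x)\<^sup>2))"
proof -
  define h where "h = 1 / real N"
  have N': "0 < real N" using N by simp
  have h: "0 < h" using N by (simp add: h_def)
  have f': "pwc f" using Ck_continuous[OF f, of 0] by (intro pwc_continuous) auto
  have pu: "pwc u" using Ck_continuous[of u 2 0] u by (intro pwc_continuous) (auto simp: Ck0_def)
  let ?\<rho> = "\<lambda>x. (f x - lin N (Pc N f) x) * u x"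
  let ?S = "\<lambda>x. h ^ 6 + h\<^sup>2 * (slope N c x)\<^sup>2"
  have p: "pwc (\<lambda>x. ?\<rho> x * slope N c x)" by (intro pwc_rules f' pu pwc_lin pwc_slope[OF N])
  have q: "pwc ?S" by (intro pwc_rules pwc_slope[OF N])
  have cell: "\<bar>K N i (\<lambda>x. ?\<rho> x * slope N c x)\<bar> \<le> 40 * M\<^sup>2 * K N i ?S" if i: "i < N" for i
  proof -
    let ?d = "real N * (c (Suc i) - c i)"
    have "K N i (\<lambda>x. ?\<rho> x * slope N c x) = K N i (\<lambda>x. ?d * ?\<rho> x)"
      by (rule integral_spike[of "{nd N i, nd N (Suc i)}"]) (use slope_cell[OF N i] in auto)
    then have 1: "\<bar>K N i (\<lambda>x. ?\<rho> x * slope N c x)\<bar> = \<bar>?d\<bar> * \<bar>K N i ?\<rho>\<bar>" by (simp add: abs_mult)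
    have "K N i ?S = (h ^ 6 + h\<^sup>2 * ?d\<^sup>2) * nd N (Suc i) - (h ^ 6 + h\<^sup>2 * ?d\<^sup>2) * nd N i"
      by (rule K_FTC[OF N, where f = "\<lambda>x. h ^ 6 + h\<^sup>2 * ?d\<^sup>2"]) 
         (use slope_cell[OF N i] in \<open>auto intro!: derivative_eq_intros\<close>)
    also have "... = (h ^ 6 + h\<^sup>2 * ?d\<^sup>2) * h" using N' by (simp add: h_def field_simps)
    finally have 2: "K N i ?S = (h ^ 6 + h\<^sup>2 * ?d\<^sup>2) * h" .
    have "\<bar>?d\<bar> * \<bar>K N i ?\<rho>\<bar> \<le> \<bar>?d\<bar> * (80 * M\<^sup>2 * h ^ 5)"
      using cell_moment_superclose[OF N f M u i] by (intro mult_left_mono) (auto simp: h_def)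
    also have "... = 40 * M\<^sup>2 * (2 * h ^ 3 * (h * \<bar>?d\<bar>)) * h" by (simp add: eval_nat_numeral)
    also have "... \<le> 40 * M\<^sup>2 * (h ^ 6 + h\<^sup>2 * ?d\<^sup>2) * h"
    proof -
      have "0 \<le> (h ^ 3 - h * \<bar>?d\<bar>)\<^sup>2" by simp
      then have "2 * h ^ 3 * (h * \<bar>?d\<bar>) \<le> (h ^ 3)\<^sup>2 + (h * \<bar>?d\<bar>)\<^sup>2" by (simp only: power2_diff)
      also have "(h ^ 3)\<^sup>2 = h ^ 6" by (simp flip: power_mult)
      also have "(h * \<bar>?d\<bar>)\<^sup>2 = h\<^sup>2 * ?d\<^sup>2" by (simp only: power_mult_distrib power2_abs)
      finally show ?thesis using h by (intro mult_right_mono mult_left_mono) auto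
    qed
    finally show ?thesis unfolding 1 2 by (simp only: mult.assoc)
  qed
  have "\<bar>J (\<lambda>x. ?\<rho> x * slope N c x)\<bar> \<le> (\<Sum>i<N. \<bar>K N i (\<lambda>x. ?\<rho> x * slope N c x)\<bar>)"
    unfolding J_cells[OF N p] by (rule sum_abs)
  also have "... \<le> (\<Sum>i<N. 40 * M\<^sup>2 * K N i ?S)" by (rule sum_mono) (use cell in auto)
  also have "... = 40 * M\<^sup>2 * J ?S" unfolding J_cells[OF N q] by (simp only: sum_distrib_left)
  also have "J ?S = h ^ 6 + h\<^sup>2 * J (\<lambda>x. (slope N c x)\<^sup>2)"
    by (subst J_add) (auto intro!: pwc_rules pwc_slope[OF N])
  also have "40 * M\<^sup>2 * ... \<le> 40 * M\<^sup>2 * (h ^ 6 + 12 * J (\<lambda>x. (lin N c x)\<^sup>2))"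
    using slope_inverse_inequality[OF N, of c] by (intro mult_left_mono) (auto simp: h_def)
  finally show ?thesis by (simp add: h_def)
qed



section \<open>The energy identity\<close>

lemma Ck_mono: "f \<in> Ck k \<Longrightarrow> j \<le> k \<Longrightarrow> f \<in> Ck j"
  using Ck_continuous[of f k j] unfolding Ck_def by auto

text \<open>
  Here \<open>f\<close> and \<open>v\<close> stand for the exact \<open>\<eta>\<close> and \<open>u\<close> at a fixed time, and \<open>r\<close> and \<open>s\<close> for their projection errors, while a suffix \<open>x\<close> marks derivatives.
  On the left are the error equations tested with \<open>\<theta>\<close> and \<open>\<xi>\<close>.  The derivatives of \<open>r\<close> and the cubic products of
  \<open>\<theta>\<close> and \<open>\<xi>\<close> alone enter only through exact derivatives of products that vanish at the end points; in the proof \<open>?G\<close> collects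
  these products.
\<close>

lemma energy_identity:
  fixes f v r s \<theta> \<xi> :: "real \<Rightarrow> real"
  assumes S: "finite S"
    and der: "\<And>x. x \<in> {0..1} - S \<Longrightarrow> (f has_real_derivative fx x) (at x within {0..1})"
      "\<And>x. x \<in> {0..1} - S \<Longrightarrow> (v has_real_derivative vx x) (at x within {0..1})"
      "\<And>x. x \<in> {0..1} - S \<Longrightarrow> (r has_real_derivative rx x) (at x within {0..1})"
      "\<And>x. x \<in> {0..1} - S \<Longrightarrow> (s has_real_derivative sx x) (at x within {0..1})"
      "\<And>x. x \<in> {0..1} - S \<Longrightarrow> (\<theta> has_real_derivative \<theta>x x) (at x within {0..1})"
      "\<And>x. x \<in> {0..1} - S \<Longrightarrow> (\<xi> has_real_derivative \<xi>x x) (at x within {0..1})"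
    and cont: "continuous_on {0..1} f" "continuous_on {0..1} v" "continuous_on {0..1} r"
      "continuous_on {0..1} s" "continuous_on {0..1} \<theta>" "continuous_on {0..1} \<xi>"
    and pw: "pwc fx" "pwc vx" "pwc rx" "pwc sx" "pwc \<theta>x" "pwc \<xi>x"
    and bd: "v 0 = 0" "v 1 = 0" "s 0 = 0" "s 1 = 0" "\<xi> 0 = 0" "\<xi> 1 = 0"
    and orth: "J (\<lambda>x. sx x * \<theta> x) = 0" "J (\<lambda>x. r x * \<xi>x x) = 0"
  shows "J (\<lambda>x. - (sx x + \<xi>x x) * \<theta> x
       - 1/2 * ((fx x * v x + f x * vx x) - ((fx x - rx x - \<theta>x x) * (v x - s x - \<xi> x) + (f x - r x - \<theta> x) * (vx x - sx x - \<xi>x x))) * \<theta> x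
       - (rx x + \<theta>x x) * \<xi> x
       - 3/2 * (v x * vx x - (v x - s x - \<xi> x) * (vx x - sx x - \<xi>x x)) * \<xi> x
       - 1/2 * (f x * fx x - (f x - r x - \<theta> x) * (fx x - rx x - \<theta>x x)) * \<xi> x) =
     - 1/2 * J (\<lambda>x. sx x * (f x * \<theta> x)) + 1/2 * J (\<lambda>x. r x * v x * \<theta>x x) + 1/2 * J (\<lambda>x. r x * (f x * \<xi>x x))
     + J (\<lambda>x. - 1/2 * (fx x * s x * \<theta> x) - 1/2 * (fx x * \<xi> x * \<theta> x) - 1/2 * (f x * \<xi>x x * \<theta> x) 
        - 1/4 * (vx x * \<theta> x * \<theta> x) - 1/2 * (r x * s x * \<theta>x x) - 1/2 * (r x * \<xi> x * \<theta>x x) - 1/2 * (s x * \<theta> x * \<theta>x x) 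
        + 1/2 * (f x * \<theta> x * \<xi>x x) - 1/4 * (r x * r x * \<xi>x x) - 1/2 * (r x * \<theta> x * \<xi>x x)
        + 3/2 * (v x * s x * \<xi>x x) + 3/2 * (v x * \<xi> x * \<xi>x x) - 3/4 * (s x * s x * \<xi>x x) - 3/2 * (s x * \<xi> x * \<xi>x x))"
    (is "J ?L = - 1/2 * J ?T1 + 1/2 * J ?T2 + 1/2 * J ?T3 + J ?R")
proof -
  let ?G = "\<lambda>x. - (\<theta> x + r x) * \<xi> x - 1/2 * ((r x + \<theta> x) * v x - (r x + \<theta> x) * (s x + \<xi> x)) * \<theta> x
     + 1/4 * v x * (\<theta> x)\<^sup>2 - 1/4 * \<xi> x * (\<theta> x)\<^sup>2 - 3/4 * (2 * v x * (s x + \<xi> x) - (s x + \<xi> x)\<^sup>2) * \<xi> x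
     - 1/4 * (\<xi> x) ^ 3 - 1/4 * (2 * f x * (r x + \<theta> x) - (r x + \<theta> x)\<^sup>2) * \<xi> x"
  let ?g = "\<lambda>x. ?L x - (- 1/2 * ?T1 x + 1/2 * ?T2 x + 1/2 * ?T3 x + ?R x) - (r x * \<xi>x x - sx x * \<theta> x)"
  have "J ?g = ?G 1 - ?G 0"
  proof (rule J_FTC[OF S])
    show "continuous_on {0..1} ?G" by (intro continuous_intros cont)
    fix x assume "x \<in> {0<..<1} - S"
    then have x: "x \<in> {0..1} - S" by auto
    show "(?G has_real_derivative ?g x) (at x within {0..1})"
      apply (rule derivative_eq_intros der[OF x] refl)+
      apply (simp add: field_simps power2_eq_square power3_eq_cube)
      done
  qed
  also have "... = 0" using bd by simp
  finally have 0: "J ?g = 0" .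
  have pf: "pwc f" "pwc v" "pwc r" "pwc s" "pwc \<theta>" "pwc \<xi>" using cont by (auto intro: pwc_continuous)
  have pL: "pwc ?L" by (intro pwc_rules pf pw)
  have pT: "pwc (\<lambda>x. - 1/2 * ?T1 x)" "pwc (\<lambda>x. 1/2 * ?T2 x)" "pwc (\<lambda>x. 1/2 * ?T3 x)" "pwc ?R" 
    by (intro pwc_rules pf pw)+
  have po: "pwc (\<lambda>x. r x * \<xi>x x)" "pwc (\<lambda>x. sx x * \<theta> x)" by (intro pwc_rules pf pw)+
  have "J ?g = J ?L - (J (\<lambda>x. - 1/2 * ?T1 x) + J (\<lambda>x. 1/2 * ?T2 x) + J (\<lambda>x. 1/2 * ?T3 x) + J ?R) - (0 - 0)"
    using J_diff[OF pwc_diff[OF pL pwc_add[OF pwc_add[OF pwc_add[OF pT(1,2)] pT(3)] pT(4)]] pwc_diff[OF po]]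
      J_diff[OF pL pwc_add[OF pwc_add[OF pwc_add[OF pT(1,2)] pT(3)] pT(4)]]
      J_add[OF pwc_add[OF pwc_add[OF pT(1,2)] pT(3)] pT(4)] J_add[OF pwc_add[OF pT(1,2)] pT(3)] J_add[OF pT(1,2)]
      J_diff[OF po] orth by linarith
  with 0 show ?thesis by (simp only: J_cmult)
qed

lemma abs_mult3_le:
  fixes x y z :: real
  assumes "\<bar>x\<bar> \<le> A" "\<bar>y\<bar> \<le> B" "\<bar>z\<bar> \<le> D"
  shows "\<bar>x * y * z\<bar> \<le> A * B * D"
proof -
  have "0 \<le> A" "0 \<le> B" "0 \<le> D" using assms by linarith+
  then show ?thesis unfolding abs_mult using assms by (intro mult_mono) auto
qed

text \<open>
  On a cell \<open>f\<close> differs from each of its end values by at most \<open>M h\<close>, and the coefficients of \<open>lin N c\<close> there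
  are at most \<open>\<bar>lin N c x\<bar> + h \<bar>slope N c x\<bar>\<close>.
\<close>

lemma superapproximation:
  assumes N: "1 \<le> N" and f: "f \<in> Ck 1" and M: "\<And>x. x \<in> {0..1} \<Longrightarrow> \<bar>Dx f x\<bar> \<le> M"
    and x: "x \<in> {0..1} - mesh N"
  shows "\<bar>f x * lin N c x - lin N (\<lambda>i. f (nd N i) * c i) x\<bar> \<le> 2 * M * (1 / real N) * (\<bar>lin N c x\<bar> + \<bar>1 / real N * slope N c x\<bar>)"
proof -
  obtain i where i: "i < N" "x \<in> {nd N i<..<nd N (Suc i)}" using exists_open_cell[OF N x] .
  then have i': "x \<in> cell N i" by auto
  have N': "0 < real N" using N by simp
  have M0: "0 \<le> M" using M[of 0] by auto
  note b = cell_bounds[OF N i(1) i']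
  define h where "h = 1 / real N"
  define w where "w = real N * x - real i"
  define B where "B = \<bar>lin N c x\<bar> + \<bar>h * slope N c x\<bar>"
  have w: "0 \<le> w" "w \<le> 1" using b by (auto simp: w_def)
  have x01: "x \<in> {0..1}" using x by simp
  have sl: "h * slope N c x = c (Suc i) - c i" unfolding slope_cell[OF N i] using N' by (simp add: h_def)
  have l: "lin N c x = c i * (1 - w) + c (Suc i) * w" unfolding lin_cell[OF N i(1) i'] by (simp add: w_def algebra_simps)
  have lz: "lin N (\<lambda>i. f (nd N i) * c i) x = f (nd N i) * c i * (1 - w) + f (nd N (Suc i)) * c (Suc i) * w"
    unfolding lin_cell[OF N i(1) i'] by (simp add: w_def algebra_simps)
  have ff: "\<bar>f x - f y\<bar> \<le> M * h" if "y \<in> {0..1}" "\<bar>x - y\<bar> \<le> h" for y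
  proof -
    have "\<bar>f x - f y\<bar> \<le> M * \<bar>x - y\<bar>"
      using field_differentiable_bound[of "{0..1}" f "Dx f" M x y] Ck_has_derivative[OF f, of 0] M that x01 by auto
    also have "... \<le> M * h" using that M0 by (intro mult_left_mono)
    finally show ?thesis .
  qed
  have d: "\<bar>x - nd N i\<bar> \<le> h" "\<bar>x - nd N (Suc i)\<bar> \<le> h" using i by (auto simp: h_def add_divide_distrib abs_le_iff)
  have 1: "\<bar>f x - f (nd N i)\<bar> \<le> M * h" "\<bar>f x - f (nd N (Suc i))\<bar> \<le> M * h"
    using ff[OF nd_in d(1)] ff[OF nd_in d(2)] i by auto
  have ws: "\<bar>w * (h * slope N c x)\<bar> \<le> \<bar>h * slope N c x\<bar>" "\<bar>(1 - w) * (h * slope N c x)\<bar> \<le> \<bar>h * slope N c x\<bar>"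
    using mult_left_le_one_le[of "\<bar>h * slope N c x\<bar>" w] mult_left_le_one_le[of "\<bar>h * slope N c x\<bar>" "1 - w"] w
    by (simp_all only: abs_mult abs_ge_zero) auto
  have "c i = lin N c x - w * (h * slope N c x)" "c (Suc i) = lin N c x + (1 - w) * (h * slope N c x)"
    unfolding l sl by (simp_all add: algebra_simps)
  then have ci: "\<bar>c i\<bar> \<le> B" "\<bar>c (Suc i)\<bar> \<le> B" unfolding B_def using ws by linarith+
  have "f x * lin N c x - lin N (\<lambda>i. f (nd N i) * c i) x
      = (1 - w) * (f x - f (nd N i)) * c i + w * (f x - f (nd N (Suc i))) * c (Suc i)"
    unfolding l lz by (simp add: algebra_simps)
  moreover have "\<bar>(1 - w) * (f x - f (nd N i)) * c i\<bar> \<le> 1 * (M * h) * B"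
    by (intro abs_mult3_le 1 ci) (use w in auto)
  moreover have "\<bar>w * (f x - f (nd N (Suc i))) * c (Suc i)\<bar> \<le> 1 * (M * h) * B"
    by (intro abs_mult3_le 1 ci) (use w in auto)
  ultimately have "\<bar>f x * lin N c x - lin N (\<lambda>i. f (nd N i) * c i) x\<bar> \<le> 2 * M * h * B" by linarith
  then show ?thesis by (simp only: B_def h_def)
qed

lemma orthogonal_superapproximation:
  assumes N: "1 \<le> N" and f: "f \<in> Ck 1" and M: "\<And>x. x \<in> {0..1} \<Longrightarrow> \<bar>Dx f x\<bar> \<le> M"
    and w: "pwc w" and orth: "\<And>c. J (\<lambda>x. w x * lin N c x) = 0" 
    and B: "\<And>x. x \<in> {0..1} \<Longrightarrow> \<bar>w x\<bar> \<le> B * (1 / real N)\<^sup>2"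
  shows "\<bar>J (\<lambda>x. w x * (f x * lin N c x))\<bar> 
    \<le> 2 * M * B * ((1 / real N) ^ 6 + 13 * J (\<lambda>x. (lin N c x)\<^sup>2))"
proof -
  define h where "h = 1 / real N"
  have h: "0 < h" using N by (simp add: h_def)
  have M0: "0 \<le> M" using M[of 0] by auto
  have B0: "0 \<le> B * h\<^sup>2" using B[of 0] by (auto simp: h_def)
  then have B0': "0 \<le> B" using h by (simp add: zero_le_mult_iff)
  have pf: "pwc f" using Ck_continuous[OF f, of 0] by (intro pwc_continuous) auto
  let ?z = "lin N (\<lambda>i. f (nd N i) * c i)"
  let ?S = "\<lambda>x. h ^ 6 + (lin N c x)\<^sup>2 + h\<^sup>2 * (slope N c x)\<^sup>2"
  have p: "pwc (\<lambda>x. w x * (f x * lin N c x))" "pwc (\<lambda>x. w x * ?z x)" by (intro pwc_rules w pf pwc_lin)+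
  have "J (\<lambda>x. w x * (f x * lin N c x)) = J (\<lambda>x. w x * (f x * lin N c x) - w x * ?z x)"
    unfolding J_diff[OF p] orth by simp
  moreover have "\<bar>J (\<lambda>x. w x * (f x * lin N c x) - w x * ?z x)\<bar> \<le> J (\<lambda>x. 2 * M * B * ?S x)"
  proof (rule abs_J_le[where S = "mesh N"])
    fix x assume x: "x \<in> {0..1} - mesh N"
    have "\<bar>w x * (f x * lin N c x - ?z x)\<bar> \<le> (B * h\<^sup>2) * (2 * M * h * (\<bar>lin N c x\<bar> + \<bar>h * slope N c x\<bar>))"
      unfolding abs_mult
      by (intro mult_mono) (use B[of x] superapproximation[OF N f M x] x B0 in \<open>auto simp: h_def\<close>)
    also have "... = (2 * M * B) * (h ^ 3 * \<bar>lin N c x\<bar> + h ^ 3 * \<bar>h * slope N c x\<bar>)"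
      by (simp add: eval_nat_numeral algebra_simps)
    also have "... \<le> (2 * M * B) * ?S x"
    proof (rule mult_left_mono)
      have 6: "(h ^ 3)\<^sup>2 = h ^ 6" by (simp flip: power_mult)
      have "0 \<le> (h ^ 3 - \<bar>lin N c x\<bar>)\<^sup>2" by simp
      then have 1: "2 * (h ^ 3 * \<bar>lin N c x\<bar>) \<le> h ^ 6 + (lin N c x)\<^sup>2" unfolding power2_diff 6 power2_abs by simp
      have "0 \<le> (h ^ 3 - \<bar>h * slope N c x\<bar>)\<^sup>2" by simp
      then have 2: "2 * (h ^ 3 * \<bar>h * slope N c x\<bar>) \<le> h ^ 6 + h\<^sup>2 * (slope N c x)\<^sup>2" 
        unfolding power2_diff 6 power2_abs power_mult_distrib by simp
      show "h ^ 3 * \<bar>lin N c x\<bar> + h ^ 3 * \<bar>h * slope N c x\<bar> \<le> ?S x" using 1 2 zero_le_power2[of "lin N c x"]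
          zero_le_power2[of "h * slope N c x"] unfolding power_mult_distrib by linarith
    qed (use M0 B0' in auto)
    finally show "\<bar>w x * (f x * lin N c x) - w x * ?z x\<bar> \<le> 2 * M * B * ?S x" by (simp only: right_diff_distrib)
  qed (intro pwc_rules w pf pwc_lin pwc_slope[OF N] finite_mesh)+
  moreover have "J (\<lambda>x. 2 * M * B * ?S x) = 2 * M * B * (h ^ 6 + J (\<lambda>x. (lin N c x)\<^sup>2) + h\<^sup>2 * J (\<lambda>x. (slope N c x)\<^sup>2))"
    unfolding J_cmult by (subst J_add, (intro pwc_rules pwc_lin pwc_slope[OF N])+, subst J_add, (intro pwc_rules pwc_lin pwc_slope[OF N])+, simp)
  moreover have "2 * M * B * (h ^ 6 + J (\<lambda>x. (lin N c x)\<^sup>2) + h\<^sup>2 * J (\<lambda>x. (slope N c x)\<^sup>2)) \<le> 2 * M * B * (h ^ 6 + J (\<lambda>x. (lin N c x)\<^sup>2) + 12 * J (\<lambda>x. (lin N c x)\<^sup>2))"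
    using slope_inverse_inequality[OF N, of c] M0 B0' by (intro mult_left_mono add_left_mono) (auto simp: h_def)
  ultimately have "\<bar>J (\<lambda>x. w x * (f x * lin N c x))\<bar> \<le> 2 * M * B * (h ^ 6 + J (\<lambda>x. (lin N c x)\<^sup>2) + 12 * J (\<lambda>x. (lin N c x)\<^sup>2))"
    by linarith
  then show ?thesis by (simp add: h_def algebra_simps)
qed

text \<open>
  Each term is at most \<open>C\<^sup>2\<close> times a product of two of the quantities \<open>h\<^sup>3\<close>, \<open>\<bar>\<theta>\<bar>\<close>, \<open>\<bar>\<xi>\<bar>\<close>, \<open>\<bar>\<xi>x\<bar>\<close>, \<open>h \<bar>\<theta>x\<bar>\<close>, and \<open>Q\<close> is the sum of
  their squares.
\<close>

lemma energy_remainder_bound: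
  fixes h C :: real
  assumes h: "0 < h" "h \<le> 1" and C: "1 \<le> C"
    and b: "\<bar>f\<bar> \<le> C" "\<bar>fx\<bar> \<le> C" "\<bar>v\<bar> \<le> C" "\<bar>vx\<bar> \<le> C" "\<bar>r\<bar> \<le> C * h\<^sup>2" "\<bar>s\<bar> \<le> C * h ^ 3" "\<bar>st\<bar> \<le> C * h ^ 3"
    and Q: "Q = h ^ 6 + \<theta>\<^sup>2 + \<xi>\<^sup>2 + \<xi>x\<^sup>2 + h\<^sup>2 * \<theta>x\<^sup>2"
  shows "- 1/2 * (fx * s * \<theta>) - 1/2 * (fx * \<xi> * \<theta>) - 1/2 * (f * \<xi>x * \<theta>) 
        - 1/4 * (vx * \<theta> * \<theta>) - 1/2 * (r * s * \<theta>x) - 1/2 * (r * \<xi> * \<theta>x) - 1/2 * (s * \<theta> * \<theta>x) 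
        + 1/2 * (f * \<theta> * \<xi>x) - 1/4 * (r * r * \<xi>x) - 1/2 * (r * \<theta> * \<xi>x)
        + 3/2 * (v * s * \<xi>x) + 3/2 * (v * \<xi> * \<xi>x) - 3/4 * (s * s * \<xi>x) - 3/2 * (s * \<xi> * \<xi>x) - st * \<xi>
      \<le> 12 * C\<^sup>2 * Q"
proof -
  define H where "H = h ^ 3"
  define g where "g = h * \<theta>x"
  have H: "0 \<le> H" "H \<le> 1" "h\<^sup>2 \<le> 1" "h ^ 4 \<le> H" using h by (auto simp: H_def power_le_one intro: power_decreasing)
  have Q': "Q = H\<^sup>2 + \<theta>\<^sup>2 + \<xi>\<^sup>2 + \<xi>x\<^sup>2 + g\<^sup>2" by (simp add: Q H_def g_def power_mult_distrib flip: power_mult)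
  have am: "\<bar>a\<bar> * \<bar>b\<bar> \<le> a\<^sup>2 + b\<^sup>2" for a b :: real
  proof -
    have "0 \<le> (\<bar>a\<bar> - \<bar>b\<bar>)\<^sup>2" "0 \<le> a\<^sup>2 + b\<^sup>2" by simp_all
    then show ?thesis unfolding power2_diff power2_abs by linarith
  qed
  have sq: "0 \<le> H\<^sup>2" "0 \<le> \<theta>\<^sup>2" "0 \<le> \<xi>\<^sup>2" "0 \<le> \<xi>x\<^sup>2" "0 \<le> g\<^sup>2" by simp_all
  have aa: "\<bar>\<theta>\<bar> * \<bar>\<theta>\<bar> = \<theta>\<^sup>2" by (simp add: power2_eq_square)
  have HH: "\<bar>H\<bar> = H" using H by simp
  have pr: "H * \<bar>\<theta>\<bar> \<le> Q" "H * \<bar>\<xi>\<bar> \<le> Q" "H * \<bar>\<xi>x\<bar> \<le> Q" "H * \<bar>g\<bar> \<le> Q" "\<bar>\<theta>\<bar> * \<bar>\<xi>\<bar> \<le> Q" "\<bar>\<theta>\<bar> * \<bar>\<xi>x\<bar> \<le> Q" "\<bar>\<theta>\<bar> * \<bar>g\<bar> \<le> Q"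
    "\<bar>\<xi>\<bar> * \<bar>\<xi>x\<bar> \<le> Q" "\<bar>\<xi>\<bar> * \<bar>g\<bar> \<le> Q" "\<bar>\<theta>\<bar> * \<bar>\<theta>\<bar> \<le> Q"
    using am[of H \<theta>] am[of H \<xi>] am[of H \<xi>x] am[of H g] am[of \<theta> \<xi>] am[of \<theta> \<xi>x] am[of \<theta> g]
      am[of \<xi> \<xi>x] am[of \<xi> g] am[of \<theta> \<theta>] sq aa
    unfolding Q' HH by linarith+
  have Q0: "0 \<le> Q" unfolding Q' using sq by linarith
  have CC: "C \<le> C\<^sup>2" "0 \<le> C\<^sup>2" "1 \<le> C\<^sup>2" using C by (auto simp: power2_eq_square intro: mult_right_mono[of 1 C C, simplified] order_trans)
  have bnd: "\<bar>x * y * z\<bar> \<le> C\<^sup>2 * Q" 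
    if "\<bar>x\<bar> \<le> A" "\<bar>y\<bar> \<le> B" "\<bar>z\<bar> \<le> D" and "A * B * D \<le> C\<^sup>2 * P" "P \<le> Q" for x y z A B D P
    using abs_mult3_le[OF that(1-3)] that(4) mult_left_mono[OF that(5) CC(2)] by linarith
  have C0: "0 \<le> C" using C by simp
  have Cm: "C * p \<le> C\<^sup>2 * p" if "0 \<le> p" for p using CC that by (intro mult_right_mono)
  have hm: "C * h\<^sup>2 * p \<le> C * p" if "0 \<le> p" for p
    using mult_right_mono[OF mult_left_mono[OF H(3) C0] that] by simp
  have t1: "\<bar>fx * s * \<theta>\<bar> \<le> C\<^sup>2 * Q" by (rule bnd[OF b(2,6) order_refl _ pr(1)]) (simp add: H_def power2_eq_square)
  have t2: "\<bar>fx * \<xi> * \<theta>\<bar> \<le> C\<^sup>2 * Q" by (rule bnd[OF b(2) order_refl order_refl _ pr(5)]) (use Cm[of "\<bar>\<theta>\<bar> * \<bar>\<xi>\<bar>"] in \<open>simp add: mult_ac\<close>)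
  have t3: "\<bar>f * \<xi>x * \<theta>\<bar> \<le> C\<^sup>2 * Q" by (rule bnd[OF b(1) order_refl order_refl _ pr(6)]) (use Cm[of "\<bar>\<theta>\<bar> * \<bar>\<xi>x\<bar>"] in \<open>simp add: mult_ac\<close>)
  have t4: "\<bar>vx * \<theta> * \<theta>\<bar> \<le> C\<^sup>2 * Q" by (rule bnd[OF b(4) order_refl order_refl _ pr(10)]) (use Cm[of "\<bar>\<theta>\<bar> * \<bar>\<theta>\<bar>"] in \<open>simp add: mult_ac\<close>)
  have t5: "\<bar>r * s * \<theta>x\<bar> \<le> C\<^sup>2 * Q"
  proof (rule bnd[OF b(5,6) order_refl _ pr(4)])
    have "C * h\<^sup>2 * (C * h ^ 3) * \<bar>\<theta>x\<bar> = C\<^sup>2 * (h ^ 4 * \<bar>g\<bar>)" using h by (simp add: g_def abs_mult eval_nat_numeral)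
    also have "... \<le> C\<^sup>2 * (H * \<bar>g\<bar>)" using H by (intro mult_left_mono mult_right_mono) auto
    finally show "C * h\<^sup>2 * (C * h ^ 3) * \<bar>\<theta>x\<bar> \<le> C\<^sup>2 * (H * \<bar>g\<bar>)" .
  qed
  have t6: "\<bar>r * \<xi> * \<theta>x\<bar> \<le> C\<^sup>2 * Q"
  proof (rule bnd[OF b(5) order_refl order_refl _ pr(9)])
    have "C * h\<^sup>2 * \<bar>\<xi>\<bar> * \<bar>\<theta>x\<bar> = h * (C * (\<bar>\<xi>\<bar> * \<bar>g\<bar>))" using h by (simp add: g_def abs_mult power2_eq_square)
    also have "... \<le> C * (\<bar>\<xi>\<bar> * \<bar>g\<bar>)" using h C0 by (intro mult_left_le_one_le) auto
    also have "... \<le> C\<^sup>2 * (\<bar>\<xi>\<bar> * \<bar>g\<bar>)" by (rule Cm) simp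
    finally show "C * h\<^sup>2 * \<bar>\<xi>\<bar> * \<bar>\<theta>x\<bar> \<le> C\<^sup>2 * (\<bar>\<xi>\<bar> * \<bar>g\<bar>)" .
  qed
  have t7: "\<bar>s * \<theta> * \<theta>x\<bar> \<le> C\<^sup>2 * Q"
  proof (rule bnd[OF b(6) order_refl order_refl _ pr(7)])
    have "C * h ^ 3 * \<bar>\<theta>\<bar> * \<bar>\<theta>x\<bar> = C * h\<^sup>2 * (\<bar>\<theta>\<bar> * \<bar>g\<bar>)" using h by (simp add: g_def abs_mult eval_nat_numeral)
    also have "... \<le> C * (\<bar>\<theta>\<bar> * \<bar>g\<bar>)" by (rule hm) simp
    also have "... \<le> C\<^sup>2 * (\<bar>\<theta>\<bar> * \<bar>g\<bar>)" by (rule Cm) simp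
    finally show "C * h ^ 3 * \<bar>\<theta>\<bar> * \<bar>\<theta>x\<bar> \<le> C\<^sup>2 * (\<bar>\<theta>\<bar> * \<bar>g\<bar>)" .
  qed
  have t8: "\<bar>f * \<theta> * \<xi>x\<bar> \<le> C\<^sup>2 * Q" using t3 by (simp add: mult_ac)
  have t9: "\<bar>r * r * \<xi>x\<bar> \<le> C\<^sup>2 * Q"
  proof (rule bnd[OF b(5,5) order_refl _ pr(3)])
    have "C * h\<^sup>2 * (C * h\<^sup>2) * \<bar>\<xi>x\<bar> = C\<^sup>2 * (h ^ 4 * \<bar>\<xi>x\<bar>)" by (simp add: eval_nat_numeral)
    also have "... \<le> C\<^sup>2 * (H * \<bar>\<xi>x\<bar>)" using H by (intro mult_left_mono mult_right_mono) auto
    finally show "C * h\<^sup>2 * (C * h\<^sup>2) * \<bar>\<xi>x\<bar> \<le> C\<^sup>2 * (H * \<bar>\<xi>x\<bar>)" .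
  qed
  have t10: "\<bar>r * \<theta> * \<xi>x\<bar> \<le> C\<^sup>2 * Q"
    by (rule bnd[OF b(5) order_refl order_refl _ pr(6)]) 
       (use hm[of "\<bar>\<theta>\<bar> * \<bar>\<xi>x\<bar>"] Cm[of "\<bar>\<theta>\<bar> * \<bar>\<xi>x\<bar>"] in \<open>simp add: mult.assoc\<close>)
  have t11: "\<bar>v * s * \<xi>x\<bar> \<le> C\<^sup>2 * Q" by (rule bnd[OF b(3,6) order_refl _ pr(3)]) (simp add: H_def power2_eq_square)
  have t12: "\<bar>v * \<xi> * \<xi>x\<bar> \<le> C\<^sup>2 * Q" by (rule bnd[OF b(3) order_refl order_refl _ pr(8)]) (use Cm[of "\<bar>\<xi>\<bar> * \<bar>\<xi>x\<bar>"] in \<open>simp add: mult_ac\<close>)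
  have t13: "\<bar>s * s * \<xi>x\<bar> \<le> C\<^sup>2 * Q"
  proof (rule bnd[OF b(6,6) order_refl _ pr(3)])
    have "C * h ^ 3 * (C * h ^ 3) * \<bar>\<xi>x\<bar> = H * (C\<^sup>2 * (H * \<bar>\<xi>x\<bar>))" by (simp add: H_def power2_eq_square)
    also have "... \<le> C\<^sup>2 * (H * \<bar>\<xi>x\<bar>)" using H by (intro mult_left_le_one_le) auto
    finally show "C * h ^ 3 * (C * h ^ 3) * \<bar>\<xi>x\<bar> \<le> C\<^sup>2 * (H * \<bar>\<xi>x\<bar>)" .
  qed
  have t14: "\<bar>s * \<xi> * \<xi>x\<bar> \<le> C\<^sup>2 * Q"
  proof (rule bnd[OF b(6) order_refl order_refl _ pr(8)])
    have "C * h ^ 3 * \<bar>\<xi>\<bar> * \<bar>\<xi>x\<bar> = H * (C * (\<bar>\<xi>\<bar> * \<bar>\<xi>x\<bar>))" by (simp add: H_def)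
    also have "... \<le> C * (\<bar>\<xi>\<bar> * \<bar>\<xi>x\<bar>)" using H C0 by (intro mult_left_le_one_le) auto
    also have "... \<le> C\<^sup>2 * (\<bar>\<xi>\<bar> * \<bar>\<xi>x\<bar>)" by (rule Cm) simp
    finally show "C * h ^ 3 * \<bar>\<xi>\<bar> * \<bar>\<xi>x\<bar> \<le> C\<^sup>2 * (\<bar>\<xi>\<bar> * \<bar>\<xi>x\<bar>)" .
  qed
  have t15: "\<bar>1 * st * \<xi>\<bar> \<le> C\<^sup>2 * Q"
    by (rule bnd[of 1 1, OF _ b(7) order_refl _ pr(2)]) (use Cm[of "H * \<bar>\<xi>\<bar>"] H in \<open>simp_all add: H_def mult.assoc\<close>)
  then have "\<bar>st * \<xi>\<bar> \<le> C\<^sup>2 * Q" by simp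
  note t = t1[THEN abs_le_D2] t2[THEN abs_le_D2] t3[THEN abs_le_D2] t4[THEN abs_le_D2] t5[THEN abs_le_D2]
    t6[THEN abs_le_D2] t7[THEN abs_le_D2] t8[THEN abs_le_D1] t9[THEN abs_le_D2] t10[THEN abs_le_D2]
    t11[THEN abs_le_D1] t12[THEN abs_le_D1] t13[THEN abs_le_D2] t14[THEN abs_le_D2] this[THEN abs_le_D2]
  have "0 \<le> C\<^sup>2 * Q" using Q0 by simp
  with t show ?thesis unfolding mult.assoc[of 12] by linarith
qed

text \<open>
  On the left is half the time derivative of the energy at a fixed time, where \<open>ch\<close> and \<open>dh\<close> are the nodal values of \<open>\<eta>h\<close> and of the derivative
  of \<open>uh\<close>, and \<open>st\<close> is the error of the elliptic projection of \<open>u\<^sub>t\<close>.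
\<close>

lemma energy_bound:
  fixes f v st :: "real \<Rightarrow> real" and ch dh :: "nat \<Rightarrow> real" and N :: nat
  defines "h \<equiv> 1 / real N" and "c \<equiv> \<lambda>i. Pc N f i - ch i" and "d \<equiv> \<lambda>i. Pc N (Dx v) i - dh i"
  assumes N: "1 \<le> N" and C: "1 \<le> C"
    and f: "f \<in> Ck 4" "\<And>j x. j \<le> 4 \<Longrightarrow> x \<in> {0..1} \<Longrightarrow> \<bar>(Dx ^^ j) f x\<bar> \<le> C"
    and v: "v \<in> Ck0 2" "\<And>j x. j \<le> 2 \<Longrightarrow> x \<in> {0..1} \<Longrightarrow> \<bar>(Dx ^^ j) v x\<bar> \<le> C"
    and rho: "\<And>x. x \<in> {0..1} \<Longrightarrow> \<bar>f x - lin N (Pc N f) x\<bar> \<le> C * h\<^sup>2"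
    and sigx: "\<And>x. x \<in> {0..1} \<Longrightarrow> \<bar>Dx v x - lin N (Pc N (Dx v)) x\<bar> \<le> C * h\<^sup>2"
    and sig: "\<And>x. x \<in> {0..1} \<Longrightarrow> \<bar>v x - prim N (Pc N (Dx v)) x\<bar> \<le> C * h ^ 3"
    and st: "pwc st" "\<And>x. x \<in> {0..1} \<Longrightarrow> \<bar>st x\<bar> \<le> C * h ^ 3"
    and P1: "prim N (Pc N (Dx v)) 1 = 0" and d1: "prim N d 1 = 0"
  shows "J (\<lambda>x. - (Dx v x - lin N dh x) * lin N c x
       - 1/2 * ((Dx f x * v x + f x * Dx v x) - (slope N ch x * prim N dh x + lin N ch x * lin N dh x)) * lin N c x
       - (Dx f x - slope N ch x) * prim N d x
       - 3/2 * (v x * Dx v x - prim N dh x * lin N dh x) * prim N d x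
       - 1/2 * (f x * Dx f x - lin N ch x * slope N ch x) * prim N d x)
       - J (\<lambda>x. st x * prim N d x)
    \<le> 1000 * C\<^sup>2 * (h ^ 6 + (J (\<lambda>x. (lin N c x)\<^sup>2) + J (\<lambda>x. (prim N d x)\<^sup>2) + 1/3 * J (\<lambda>x. (lin N d x)\<^sup>2)))"
    (is "J ?L - J ?St \<le> 1000 * C\<^sup>2 * (h ^ 6 + (?A + ?B + 1/3 * ?D))")
proof -
  have h: "0 < h" "h \<le> 1" using N by (auto simp: h_def)
  define r s rx sx where "r = (\<lambda>x. f x - lin N (Pc N f) x)" and "s = (\<lambda>x. v x - prim N (Pc N (Dx v)) x)"
    and "rx = (\<lambda>x. Dx f x - slope N (Pc N f) x)" and "sx = (\<lambda>x. Dx v x - lin N (Pc N (Dx v)) x)"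
  note defs = r_def s_def rx_def sx_def
  have v2: "v \<in> Ck 2" "v 0 = 0" "v 1 = 0" using v by (auto simp: Ck0_def)
  have cont: "continuous_on {0..1} f" "continuous_on {0..1} (Dx f)" "continuous_on {0..1} v" "continuous_on {0..1} (Dx v)"
    using Ck_continuous[OF f(1), of 0] Ck_continuous[OF f(1), of 1] Ck_continuous[OF v2(1), of 0] Ck_continuous[OF v2(1), of 1] by auto
  have pf: "pwc f" "pwc (Dx f)" "pwc v" "pwc (Dx v)" using cont by (auto intro: pwc_continuous)
  have prs: "pwc r" "pwc s" "pwc rx" "pwc sx" unfolding defs
    by (intro pwc_rules pf pwc_lin pwc_prim pwc_slope[OF N])+
  have f1: "f \<in> Ck 1" using f(1) by (rule Ck_mono) simp
  have orth_r: "J (\<lambda>x. r x * lin N e x) = 0" for e unfolding r_def by (rule Pc_orthogonal[OF N pf(1)])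
  have orth_s: "J (\<lambda>x. sx x * lin N e x) = 0" for e unfolding sx_def by (rule Pc_orthogonal[OF N pf(4)])
  let ?T1 = "\<lambda>x. sx x * (f x * lin N c x)" and ?T2 = "\<lambda>x. r x * v x * slope N c x" and ?T3 = "\<lambda>x. r x * (f x * lin N d x)"
  let ?R = "\<lambda>x. - 1/2 * (Dx f x * s x * lin N c x) - 1/2 * (Dx f x * prim N d x * lin N c x) - 1/2 * (f x * lin N d x * lin N c x) 
        - 1/4 * (Dx v x * lin N c x * lin N c x) - 1/2 * (r x * s x * slope N c x) - 1/2 * (r x * prim N d x * slope N c x) - 1/2 * (s x * lin N c x * slope N c x) 
        + 1/2 * (f x * lin N c x * lin N d x) - 1/4 * (r x * r x * lin N d x) - 1/2 * (r x * lin N c x * lin N d x)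
        + 3/2 * (v x * s x * lin N d x) + 3/2 * (v x * prim N d x * lin N d x) - 3/4 * (s x * s x * lin N d x) - 3/2 * (s x * prim N d x * lin N d x)"
  let ?Q = "\<lambda>x. h ^ 6 + (lin N c x)\<^sup>2 + (prim N d x)\<^sup>2 + (lin N d x)\<^sup>2 + h\<^sup>2 * (slope N c x)\<^sup>2"
  have "J ?L = J (\<lambda>x. - (sx x + lin N d x) * lin N c x
       - 1/2 * ((Dx f x * v x + f x * Dx v x) - ((Dx f x - rx x - slope N c x) * (v x - s x - prim N d x) + (f x - r x - lin N c x) * (Dx v x - sx x - lin N d x))) * lin N c x
       - (rx x + slope N c x) * prim N d x
       - 3/2 * (v x * Dx v x - (v x - s x - prim N d x) * (Dx v x - sx x - lin N d x)) * prim N d x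
       - 1/2 * (f x * Dx f x - (f x - r x - lin N c x) * (Dx f x - rx x - slope N c x)) * prim N d x)"
  proof (rule integral_cong)
    fix x :: real assume x: "x \<in> {0..1}"
    have e: "lin N c x = f x - r x - lin N ch x" "slope N c x = Dx f x - rx x - slope N ch x"
      "lin N d x = Dx v x - sx x - lin N dh x" "prim N d x = v x - s x - prim N dh x"
      unfolding c_def d_def defs lin_diff slope_diff prim_diff[OF x] by simp_all
    have e': "lin N ch x = f x - r x - lin N c x" "slope N ch x = Dx f x - rx x - slope N c x"
      "lin N dh x = Dx v x - sx x - lin N d x" "prim N dh x = v x - s x - prim N d x"
      using e by simp_all
    have e2: "Dx v x - (Dx v x - sx x - lin N d x) = sx x + lin N d x" "Dx f x - (Dx f x - rx x - slope N c x) = rx x + slope N c x"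
      by simp_all
    show "?L x = - (sx x + lin N d x) * lin N c x
       - 1/2 * ((Dx f x * v x + f x * Dx v x) - ((Dx f x - rx x - slope N c x) * (v x - s x - prim N d x) + (f x - r x - lin N c x) * (Dx v x - sx x - lin N d x))) * lin N c x
       - (rx x + slope N c x) * prim N d x
       - 3/2 * (v x * Dx v x - (v x - s x - prim N d x) * (Dx v x - sx x - lin N d x)) * prim N d x
       - 1/2 * (f x * Dx f x - (f x - r x - lin N c x) * (Dx f x - rx x - slope N c x)) * prim N d x"
      unfolding e' e2 ..
  qed
  also have "... = - 1/2 * J ?T1 + 1/2 * J ?T2 + 1/2 * J ?T3 + J ?R"
  proof (rule energy_identity[OF finite_mesh[of N]])
    fix x assume x: "x \<in> {0..1} - mesh N"
    then have x01: "x \<in> {0..1}" by simp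
    show fd: "(f has_real_derivative Dx f x) (at x within {0..1})"
      using Ck_has_derivative[OF f(1), of 0 x] x01 by simp
    show vd: "(v has_real_derivative Dx v x) (at x within {0..1})"
      using Ck_has_derivative[OF v2(1), of 0 x] x01 by simp
    show "(r has_real_derivative rx x) (at x within {0..1})" unfolding defs
      by (intro DERIV_diff fd lin_has_derivative[OF N x])
    show "(s has_real_derivative sx x) (at x within {0..1})" unfolding defs
      by (intro DERIV_diff vd prim_has_derivative[OF x01])
    show "(lin N c has_real_derivative slope N c x) (at x within {0..1})" by (rule lin_has_derivative[OF N x])
    show "(prim N d has_real_derivative lin N d x) (at x within {0..1})" by (rule prim_has_derivative[OF x01])
  next
    show "continuous_on {0..1} r" "continuous_on {0..1} s" unfolding defs
      by (intro continuous_on_diff cont lin_continuous prim_continuous)+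
    show "J (\<lambda>x. sx x * lin N c x) = 0" "J (\<lambda>x. r x * lin N d x) = 0" using orth_s orth_r by blast+
  qed (use cont pf prs N v2 P1 d1 in \<open>auto simp: s_def intro: lin_continuous prim_continuous\<close>)
  finally have main: "J ?L = - 1/2 * J ?T1 + 1/2 * J ?T2 + 1/2 * J ?T3 + J ?R" .
  have pR: "pwc ?R" by (intro pwc_rules pf prs pwc_lin pwc_prim pwc_slope[OF N])
  have pSt: "pwc ?St" by (intro pwc_rules st(1) pwc_prim)
  have pQ: "pwc (\<lambda>x. 12 * C\<^sup>2 * ?Q x)" by (intro pwc_rules pf prs pwc_lin pwc_prim pwc_slope[OF N])
  have "J ?R - J ?St = J (\<lambda>x. ?R x - ?St x)" by (rule J_diff[OF pR pSt, symmetric])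
  also have "... \<le> J (\<lambda>x. 12 * C\<^sup>2 * ?Q x)"
  proof (rule J_mono_finite[OF pwc_diff[OF pR pSt] pQ finite.emptyI])
    fix x :: real assume "x \<in> {0..1} - {}"
    then have x: "x \<in> {0..1}" by simp
    show "?R x - ?St x \<le> 12 * C\<^sup>2 * ?Q x"
      by (rule energy_remainder_bound[OF h C _ _ _ _ _ _ _ refl])
         (use f(2)[of 0 x] f(2)[of 1 x] v(2)[of 0 x] v(2)[of 1 x] rho[OF x] sig[OF x] st(2)[OF x] x in \<open>auto simp: defs\<close>)
  qed
  also have "... = 12 * C\<^sup>2 * (h ^ 6 + ?A + ?B + ?D + h\<^sup>2 * J (\<lambda>x. (slope N c x)\<^sup>2))"
  proof -
    have q: "pwc (\<lambda>x. h ^ 6)" "pwc (\<lambda>x. (lin N c x)\<^sup>2)" "pwc (\<lambda>x. (prim N d x)\<^sup>2)" "pwc (\<lambda>x. (lin N d x)\<^sup>2)" "pwc (\<lambda>x. h\<^sup>2 * (slope N c x)\<^sup>2)"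
      by (intro pwc_rules pwc_lin pwc_prim pwc_slope[OF N])+
    show ?thesis unfolding J_cmult
      using J_add[OF pwc_add[OF pwc_add[OF pwc_add[OF q(1,2)] q(3)] q(4)] q(5)]
        J_add[OF pwc_add[OF pwc_add[OF q(1,2)] q(3)] q(4)] J_add[OF pwc_add[OF q(1,2)] q(3)] J_add[OF q(1,2)] by simp
  qed
  also have "... \<le> 12 * C\<^sup>2 * (h ^ 6 + ?A + ?B + ?D + 12 * ?A)"
    using slope_inverse_inequality[OF N, of c] by (intro mult_left_mono add_left_mono) (auto simp: h_def)
  finally have RS: "J ?R - J ?St \<le> 12 * C\<^sup>2 * (h ^ 6 + ?A + ?B + ?D + 12 * ?A)" .
  have T1: "\<bar>J ?T1\<bar> \<le> 2 * C * C * (h ^ 6 + 13 * ?A)" unfolding h_def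
    by (rule orthogonal_superapproximation[OF N f1 _ prs(4) orth_s])
       (use f(2)[of 1] sigx in \<open>auto simp: defs h_def\<close>)
  have T3: "\<bar>J ?T3\<bar> \<le> 2 * C * C * (h ^ 6 + 13 * ?D)" unfolding h_def
    by (rule orthogonal_superapproximation[OF N f1 _ prs(1) orth_r])
       (use f(2)[of 1] rho in \<open>auto simp: defs h_def\<close>)
  have T2: "\<bar>J ?T2\<bar> \<le> 40 * C\<^sup>2 * (h ^ 6 + 12 * ?A)" unfolding r_def h_def
    by (rule superconvergent_flux[OF N f v])
  define X where "X = C\<^sup>2"
  have nn: "0 \<le> X * ?A" "0 \<le> X * ?B" "0 \<le> X * ?D" "0 \<le> X * h ^ 6"
    by (auto simp: X_def intro!: mult_nonneg_nonneg J_nonneg)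
  have CC: "2 * C * C = 2 * X" by (simp add: X_def power2_eq_square)
  have "J ?L - J ?St \<le> 1/2 * (2 * X * (h ^ 6 + 13 * ?A)) + 1/2 * (40 * X * (h ^ 6 + 12 * ?A)) + 1/2 * (2 * X * (h ^ 6 + 13 * ?D))
      + 12 * X * (h ^ 6 + ?A + ?B + ?D + 12 * ?A)"
    unfolding main using T1 T2 T3 RS unfolding CC X_def[symmetric] by linarith
  also have "... = 34 * (X * h ^ 6) + 409 * (X * ?A) + 12 * (X * ?B) + 25 * (X * ?D)" by (simp add: algebra_simps)
  also have "... \<le> 1000 * (X * h ^ 6) + 1000 * (X * ?A) + 1000 * (X * ?B) + 1000 * (1/3 * (X * ?D))" using nn by linarith
  also have "... = 1000 * X * (h ^ 6 + (?A + ?B + 1/3 * ?D))" by (simp add: algebra_simps)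
  finally show ?thesis unfolding X_def .
qed



section \<open>Time derivatives of the discrete quantities\<close>

lemma Dx_cong:
  assumes "\<And>y. y \<in> {0..1} \<Longrightarrow> f y = g y" "x \<in> {0..1}"
  shows "Dx f x = Dx g x"
proof -
  have "(f has_vector_derivative D) (at x within {0..1}) \<longleftrightarrow> (g has_vector_derivative D) (at x within {0..1})" for D
    using assms by (auto intro: has_vector_derivative_transform[rotated 2])
  then show ?thesis unfolding Dx_def vector_derivative_def by simp
qed


lemma has_real_derivative_cong_on:
  fixes f g :: "real \<Rightarrow> real"
  assumes "(f has_real_derivative D) (at t within S)" "\<And>s. s \<in> S \<Longrightarrow> g s = f s" "t \<in> S"
  shows "(g has_real_derivative D) (at t within S)"
  using assms has_field_derivative_transform_within[of f D t S 1 g] by auto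

lemma derivative_within_Icc_unique:
  fixes f :: "real \<Rightarrow> real"
  assumes "(f has_real_derivative D) (at t within {0..T})" "(f has_real_derivative D') (at t within {0..T})"
    and "t \<in> {0..T}" "0 < T"
  shows "D = D'"
  using Dt_eqI[of "\<lambda>s _. f s" undefined D t T] Dt_eqI[of "\<lambda>s _. f s" undefined D' t T] assms by simp

lemma ip_eq_J_cong:
  assumes "pwc f" "pwc g" "finite S"
    and "\<And>x. x \<in> {0..1} - S \<Longrightarrow> f' x = f x" "\<And>x. x \<in> {0..1} - S \<Longrightarrow> g' x = g x"
  shows "ip f' g' = J (\<lambda>x. f x * g x)"
proof -
  have "ip f' g' = J (\<lambda>x. f' x * g' x)"
    by (rule ip_eq_J) (rule pwc_cong_finite[OF assms(1,3,4)] pwc_cong_finite[OF assms(2,3,5)], assumption)+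
  also have "... = J (\<lambda>x. f x * g x)" by (rule J_cong_finite[OF assms(3)]) (use assms(4,5) in auto)
  finally show ?thesis .
qed

lemma lin_time_derivative:
  assumes "\<And>i. i \<le> N \<Longrightarrow> ((\<lambda>s. c s i) has_real_derivative c' i) (at t within S)"
  shows "((\<lambda>s. lin N (c s) x) has_real_derivative lin N c' x) (at t within S)"
  unfolding lin_def by (intro DERIV_sum DERIV_cmult_right assms) simp

lemma prim_time_derivative:
  assumes "\<And>i. i \<le> N \<Longrightarrow> ((\<lambda>s. c s i) has_real_derivative c' i) (at t within S)" "x \<in> {0..1}"
  shows "((\<lambda>s. prim N (c s) x) has_real_derivative prim N c' x) (at t within S)"
  unfolding prim_eq_sum[OF assms(2)] by (intro DERIV_sum DERIV_cmult_right assms(1)) simp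

text \<open>
  For functions in the span of fixed \<open>B i\<close> the integral is a quadratic form in the coefficients, so that differentiability
  of the coefficients suffices.
\<close>

lemma J_square_time_derivative:
  fixes B :: "nat \<Rightarrow> real \<Rightarrow> real" and c :: "real \<Rightarrow> nat \<Rightarrow> real"
  assumes B: "\<And>i. i \<le> N \<Longrightarrow> pwc (B i)"
    and c: "\<And>i. i \<le> N \<Longrightarrow> ((\<lambda>s. c s i) has_real_derivative c' i) (at t within S)"
  shows "((\<lambda>s. J (\<lambda>x. (\<Sum>i\<le>N. c s i * B i x)\<^sup>2)) has_real_derivative
     2 * J (\<lambda>x. (\<Sum>i\<le>N. c' i * B i x) * (\<Sum>i\<le>N. c t i * B i x))) (at t within S)"
proof -
  define m where "m = (\<lambda>i j. J (\<lambda>x. B i x * B j x))"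
  have Q: "J (\<lambda>x. (\<Sum>i\<le>N. a i * B i x) * (\<Sum>i\<le>N. b i * B i x)) = (\<Sum>i\<le>N. \<Sum>j\<le>N. a i * b j * m i j)" for a b
  proof -
    have "J (\<lambda>x. (\<Sum>i\<le>N. a i * B i x) * (\<Sum>i\<le>N. b i * B i x)) = J (\<lambda>x. \<Sum>i\<le>N. \<Sum>j\<le>N. a i * b j * (B i x * B j x))"
      unfolding sum_product by (simp add: mult_ac)
    also have "... = (\<Sum>i\<le>N. J (\<lambda>x. \<Sum>j\<le>N. a i * b j * (B i x * B j x)))"
      by (rule J_sum) (auto intro!: pwc_rules B)
    also have "... = (\<Sum>i\<le>N. \<Sum>j\<le>N. J (\<lambda>x. a i * b j * (B i x * B j x)))"
      by (intro sum.cong refl J_sum) (auto intro!: pwc_rules B)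
    finally show ?thesis by (simp only: m_def J_cmult)
  qed
  have "((\<lambda>s. \<Sum>i\<le>N. \<Sum>j\<le>N. c s i * c s j * m i j) has_real_derivative 
      (\<Sum>i\<le>N. \<Sum>j\<le>N. (c' i * c t j + c' j * c t i) * m i j)) (at t within S)"
    by (intro DERIV_sum DERIV_cmult_right DERIV_mult c) auto
  moreover have "(\<Sum>i\<le>N. \<Sum>j\<le>N. (c' i * c t j + c' j * c t i) * m i j) = 2 * (\<Sum>i\<le>N. \<Sum>j\<le>N. c' i * c t j * m i j)"
  proof -
    have "(\<Sum>i\<le>N. \<Sum>j\<le>N. c' j * c t i * m i j) = (\<Sum>j\<le>N. \<Sum>i\<le>N. c' j * c t i * m j i)"
      by (subst sum.swap) (simp add: m_def mult.commute)
    then show ?thesis by (simp add: sum.distrib distrib_right)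
  qed
  ultimately show ?thesis unfolding power2_eq_square Q by simp
qed

text \<open>
  The derivative of a quadratic polynomial at an end point of a cell is a difference quotient of its values at the end points and
  at the midpoint.  In this way differentiability in time passes from the values of \<open>uh\<close> to its spatial derivative.
\<close>

lemma prim_coefficient_from_values:
  assumes N: "1 \<le> N" and i: "i \<le> N"
  shows "\<exists>p q r a b g. p \<in> {0..1} \<and> q \<in> {0..1} \<and> r \<in> {0..1} \<and>
     (\<forall>d. d i = a * prim N d p + b * prim N d q + g * prim N d r)"
proof -
  have N': "0 < real N" using N by simp
  define k where "k = (if i < N then i else N - 1)"
  have k: "k < N" using N by (auto simp: k_def)
  have mN: "mid N k \<in> cell N k" "nd N (Suc k) \<in> cell N k"
    using N' by (auto simp: field_simps)
  have m01: "nd N k \<in> {0..1}" "mid N k \<in> {0..1}" "nd N (Suc k) \<in> {0..1}"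
    using nd_in[of k N] nd_in[of "Suc k" N] mid_in[OF N k] k by auto
  have w: "real N * mid N k - real k = 1/2" "real N * nd N (Suc k) - real k = 1" using N' by (auto simp: field_simps)
  have 1: "real N * prim N d (mid N k) = real N * prim N d (nd N k) + (d k * 3 / 8 + d (Suc k) / 8)" for d
    using prim_cell[OF N k mN(1), of d] N' unfolding w by (simp add: field_simps power2_eq_square)
  have 2: "real N * prim N d (nd N (Suc k)) = real N * prim N d (nd N k) + (d k / 2 + d (Suc k) / 2)" for d
    using prim_cell[OF N k mN(2), of d] N' unfolding w by (simp add: field_simps power2_eq_square)
  show ?thesis
  proof (cases "i < N")
    case True
    then have "k = i" by (simp add: k_def)
    have "d i = -3 * (real N * prim N d (nd N k)) + 4 * (real N * prim N d (mid N k)) - 1 * (real N * prim N d (nd N (Suc k)))" for d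
      using 1[of d] 2[of d] unfolding \<open>k = i\<close> by linarith
    note 3 = this
    have "d i = (-3 * real N) * prim N d (nd N k) + (4 * real N) * prim N d (mid N k) + (- real N) * prim N d (nd N (Suc k))" for d
      using 3[of d] by (simp add: mult.assoc)
    then show ?thesis using m01 by blast
  next
    case False
    then have "Suc k = i" using i N by (auto simp: k_def)
    have "d i = real N * prim N d (nd N k) - 4 * (real N * prim N d (mid N k)) + 3 * (real N * prim N d (nd N (Suc k)))" for d
      using 1[of d] 2[of d] unfolding \<open>Suc k = i\<close> by linarith
    note 3 = this
    have "d i = real N * prim N d (nd N k) + (- 4 * real N) * prim N d (mid N k) + (3 * real N) * prim N d (nd N (Suc k))" for d
      using 3[of d] by (simp add: mult.assoc)
    then show ?thesis using m01 by blast
  qed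
qed

lemma Sh30_coefficients_differentiable:
  assumes N: "1 \<le> N" and S: "\<And>s. s \<in> {0..T} \<Longrightarrow> uh s \<in> Sh30 N" and t: "t \<in> {0..T}"
    and d: "\<And>x. x \<in> {0..1} \<Longrightarrow> (\<lambda>s. uh s x) differentiable_on {0..T}"
  shows "\<exists>dd. \<forall>i\<le>N. ((\<lambda>s. Dx (uh s) (nd N i)) has_real_derivative dd i) (at t within {0..T})"
proof -
  have "\<exists>D. ((\<lambda>s. Dx (uh s) (nd N i)) has_real_derivative D) (at t within {0..T})" if i: "i \<le> N" for i
  proof -
    obtain p q r a b g where p: "p \<in> {0..1}" "q \<in> {0..1}" "r \<in> {0..1}"
      and e: "\<forall>d. d i = a * prim N d p + b * prim N d q + g * prim N d r"
      using prim_coefficient_from_values[OF N i] by blast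
    have "((\<lambda>s. a * uh s p + b * uh s q + g * uh s r) has_real_derivative
       a * Dt T uh t p + b * Dt T uh t q + g * Dt T uh t r) (at t within {0..T})"
      by (intro DERIV_add DERIV_cmult differentiable_Dt d p t)
    then have "((\<lambda>s. Dx (uh s) (nd N i)) has_real_derivative
       a * Dt T uh t p + b * Dt T uh t q + g * Dt T uh t r) (at t within {0..T})"
    proof (rule has_real_derivative_cong_on[OF _ _ t])
      fix s assume s: "s \<in> {0..T}"
      show "Dx (uh s) (nd N i) = a * uh s p + b * uh s q + g * uh s r"
        using e[rule_format, of "\<lambda>i. Dx (uh s) (nd N i)"] Sh30_eq_prim[OF N S[OF s]] p by simp
    qed
    then show ?thesis by blast
  qed
  then show ?thesis by metis
qed

lemma J_by_parts_lin:
  assumes N: "1 \<le> N" and f: "f \<in> Ck0 1"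
  shows "J (\<lambda>x. Dx f x * lin N c x) = - J (\<lambda>x. f x * slope N c x)"
proof -
  have f1: "f \<in> Ck 1" "f 0 = 0" "f 1 = 0" using f by (auto simp: Ck0_def)
  have c: "continuous_on {0..1} f" "continuous_on {0..1} (Dx f)"
    using Ck_continuous[OF f1(1), of 0] Ck_continuous[OF f1(1), of 1] by auto
  have "J (\<lambda>x. Dx f x * lin N c x + f x * slope N c x) = f 1 * lin N c 1 - f 0 * lin N c 0"
  proof (rule J_FTC[OF finite_mesh[of N]])
    show "continuous_on {0..1} (\<lambda>x. f x * lin N c x)" by (intro continuous_intros c)
    fix x assume x: "x \<in> {0<..<1} - mesh N"
    then have x': "x \<in> {0..1} - mesh N" "x \<in> {0..1}" by auto
    show "((\<lambda>x. f x * lin N c x) has_real_derivative Dx f x * lin N c x + f x * slope N c x) (at x within {0..1})"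
      using DERIV_mult[OF Ck_has_derivative[OF f1(1), of 0 x] lin_has_derivative[OF N x'(1), of c]] x'(2)
      by (simp add: mult.commute)
  qed
  moreover have "J (\<lambda>x. Dx f x * lin N c x + f x * slope N c x) = J (\<lambda>x. Dx f x * lin N c x) + J (\<lambda>x. f x * slope N c x)"
    by (rule J_add) (use c N in \<open>auto intro!: pwc_mult intro: pwc_continuous\<close>)
  ultimately show ?thesis using f1 by simp
qed

lemma J_by_parts_prim:
  assumes N: "1 \<le> N" and f: "f \<in> Ck0 2" and c1: "prim N c 1 = 0"
  shows "J (\<lambda>x. Dx (Dx f) x * prim N c x) = J (\<lambda>x. f x * slope N c x)"
proof -
  have f1: "f \<in> Ck 2" "f \<in> Ck0 1" using f Ck_mono[of f 2 1] by (auto simp: Ck0_def)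
  have c: "continuous_on {0..1} (Dx f)" "continuous_on {0..1} (Dx (Dx f))"
    using Ck_continuous[OF f1(1), of 1] Ck_continuous[OF f1(1), of 2] by (auto simp: numeral_2_eq_2)
  have "J (\<lambda>x. Dx (Dx f) x * prim N c x + Dx f x * lin N c x) = Dx f 1 * prim N c 1 - Dx f 0 * prim N c 0"
  proof (rule J_FTC[OF finite.emptyI])
    show "continuous_on {0..1} (\<lambda>x. Dx f x * prim N c x)" by (intro continuous_intros c prim_continuous)
    fix x :: real assume x: "x \<in> {0<..<1} - {}"
    then have x': "x \<in> {0..1}" by auto
    show "((\<lambda>x. Dx f x * prim N c x) has_real_derivative Dx (Dx f) x * prim N c x + Dx f x * lin N c x) (at x within {0..1})"
      using DERIV_mult[OF Ck_has_derivative[OF f1(1), of 1 x] prim_has_derivative[of x N c]] x'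
      by (simp add: mult.commute)
  qed
  moreover have "J (\<lambda>x. Dx (Dx f) x * prim N c x + Dx f x * lin N c x) = J (\<lambda>x. Dx (Dx f) x * prim N c x) + J (\<lambda>x. Dx f x * lin N c x)"
    by (rule J_add) (use c N in \<open>auto intro!: pwc_mult intro: pwc_continuous\<close>)
  ultimately show ?thesis using c1 J_by_parts_lin[OF N f1(2), of c] by simp
qed

lemma Pc_time_derivative:
  assumes cont: "\<And>t. t \<in> {0..T} \<Longrightarrow> continuous_on {0..1} (f t)"
    and der: "\<And>x. x \<in> {0..1} \<Longrightarrow> (\<lambda>s. f s x) differentiable_on {0..T}"
    and bnd: "\<And>t x. t \<in> {0..T} \<Longrightarrow> x \<in> {0..1} \<Longrightarrow> \<bar>Dt T f t x\<bar> \<le> M"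
    and t: "t \<in> {0..T}"
  shows "((\<lambda>s. Pc N (f s) j) has_real_derivative Pc N (Dt T f t) j) (at t within {0..T})"
  unfolding Pc_def
  by (intro DERIV_sum DERIV_cmult_right J_has_derivative_in_time[of T f "Dt T f" M] cont bnd t pwc_hat differentiable_Dt der)

text \<open>
  The spatial derivative of \<open>u\<close> need not be differentiable in time pointwise.  Its moments are, because integration
  by parts moves the derivative to the hat functions.
\<close>

lemma Pc_Dx_time_derivative:
  assumes N: "1 \<le> N" and u: "\<And>t. t \<in> {0..T} \<Longrightarrow> u t \<in> Ck0 1" "\<And>t. t \<in> {0..T} \<Longrightarrow> Dt T u t \<in> Ck0 1"
    and der: "\<And>x. x \<in> {0..1} \<Longrightarrow> (\<lambda>s. u s x) differentiable_on {0..T}"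
    and bnd: "\<And>t x. t \<in> {0..T} \<Longrightarrow> x \<in> {0..1} \<Longrightarrow> \<bar>Dt T u t x\<bar> \<le> M"
    and t: "t \<in> {0..T}"
  shows "((\<lambda>s. Pc N (Dx (u s)) j) has_real_derivative Pc N (Dx (Dt T u t)) j) (at t within {0..T})"
proof -
  have hat: "J (\<lambda>x. Dx f x * hat N i x) = - J (\<lambda>x. f x * slope N (\<lambda>j. if j = i then 1 else 0) x)" if "i \<le> N" "f \<in> Ck0 1" for i f
    unfolding hat_eq_lin[OF that(1)] by (rule J_by_parts_lin[OF N that(2)])
  have cont: "continuous_on {0..1} (u s)" if "s \<in> {0..T}" for s
    using Ck_continuous[of "u s" 1 0] u(1)[OF that] by (simp add: Ck0_def)
  have "((\<lambda>s. J (\<lambda>x. Dx (u s) x * hat N i x)) has_real_derivative J (\<lambda>x. Dx (Dt T u t) x * hat N i x)) (at t within {0..T})"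
    if i: "i \<le> N" for i
    unfolding hat[OF i u(2)[OF t]]
    by (rule has_real_derivative_cong_on[of "\<lambda>s. - J (\<lambda>x. u s x * slope N (\<lambda>j. if j = i then 1 else 0) x)"])
       (intro DERIV_minus J_has_derivative_in_time[of T u "Dt T u" M] cont bnd t pwc_slope[OF N] differentiable_Dt der, 
        simp_all add: hat[OF i u(1)] t[simplified])
  then show ?thesis unfolding Pc_def by (intro DERIV_sum DERIV_cmult_right) auto
qed

section \<open>Weak forms of the exact and of the semidiscrete problem\<close>

lemma SCB_weak_mass:
  assumes sol: "SCB_solution T \<eta>0 u0 \<eta> u" and t: "t \<in> {0..T}"
  shows "J (\<lambda>x. Dt T \<eta> t x * \<phi> x) = - J (\<lambda>x. (Dx (u t) x + 1/2 * (Dx (\<eta> t) x * u t x + \<eta> t x * Dx (u t) x)) * \<phi> x)"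
proof -
  have "J (\<lambda>x. Dt T \<eta> t x * \<phi> x) = J (\<lambda>x. - ((Dx (u t) x + 1/2 * (Dx (\<eta> t) x * u t x + \<eta> t x * Dx (u t) x)) * \<phi> x))"
  proof (rule integral_cong)
    fix x :: real assume x: "x \<in> {0..1}"
    have "Dx (\<lambda>y. \<eta> t y * u t y) x = Dx (\<eta> t) x * u t x + \<eta> t x * Dx (u t) x"
      using DERIV_mult[OF differentiable_Dx differentiable_Dx, of "\<eta> t" x "u t"] sol t x
      by (intro Dx_eqI) (auto simp: SCB_solution_def mult.commute)
    moreover have "Dt T \<eta> t x + Dx (u t) x + 1/2 * Dx (\<lambda>y. \<eta> t y * u t y) x = 0"
      using sol t x by (auto simp: SCB_solution_def)
    ultimately have eq: "Dt T \<eta> t x = - (Dx (u t) x + 1/2 * (Dx (\<eta> t) x * u t x + \<eta> t x * Dx (u t) x))" by simp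
    show "Dt T \<eta> t x * \<phi> x = - ((Dx (u t) x + 1/2 * (Dx (\<eta> t) x * u t x + \<eta> t x * Dx (u t) x)) * \<phi> x)"
      by (simp only: eq mult_minus_left)
  qed
  then show ?thesis by simp
qed

text \<open>
  Only the term with \<open>u\<^sub>x\<^sub>x\<^sub>t\<close> is delicate.  The integral of \<open>u\<^sub>x\<^sub>x\<close> against the test function equals the
  integral of \<open>u\<close> against its piecewise constant second derivative.  Differentiating both in time and integrating the
  second one by parts once more yields the form with the spatial derivative of \<open>u\<^sub>t\<close>.
\<close>

lemma SCB_weak_momentum:
  assumes T: "0 < T" and N: "1 \<le> N" and sol: "SCB_solution T \<eta>0 u0 \<eta> u" and t: "t \<in> {0..T}" and c1: "prim N c 1 = 0"
    and \<eta>: "\<And>t. t \<in> {0..T} \<Longrightarrow> \<eta> t \<in> Ck 1" "\<And>t x j. t \<in> {0..T} \<Longrightarrow> x \<in> {0..1} \<Longrightarrow> j \<le> 1 \<Longrightarrow> \<bar>(Dx ^^ j) (\<eta> t) x\<bar> \<le> M"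
    and u: "\<And>t. t \<in> {0..T} \<Longrightarrow> u t \<in> Ck0 2" "\<And>t x j. t \<in> {0..T} \<Longrightarrow> x \<in> {0..1} \<Longrightarrow> j \<le> 1 \<Longrightarrow> \<bar>(Dx ^^ j) (u t) x\<bar> \<le> M"
    and ut: "\<And>t. t \<in> {0..T} \<Longrightarrow> Dt T u t \<in> Ck0 1" "\<And>t x. t \<in> {0..T} \<Longrightarrow> x \<in> {0..1} \<Longrightarrow> \<bar>Dt T u t x\<bar> \<le> M"
  shows "J (\<lambda>x. Dt T u t x * prim N c x) + 1/3 * J (\<lambda>x. Dx (Dt T u t) x * lin N c x)
    = - J (\<lambda>x. (Dx (\<eta> t) x + 3/2 * (u t x * Dx (u t) x) + 1/2 * (\<eta> t x * Dx (\<eta> t) x)) * prim N c x)"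
proof -
  let ?G = "\<lambda>s. Dx (Dx (u s))" and ?G' = "Dt T (\<lambda>s. Dx (Dx (u s)))"
  let ?F = "\<lambda>t x. Dx (\<eta> t) x + 3/2 * (u t x * Dx (u t) x) + 1/2 * (\<eta> t x * Dx (\<eta> t) x)"
  have M0: "0 \<le> M" using ut(2)[OF t, of 0] by auto
  \<comment> \<open>The equation itself bounds the time derivative of the second spatial derivative.\<close>
  have eq: "?G' s x = 3 * (Dt T u s x + ?F s x)" if "s \<in> {0..T}" "x \<in> {0..1}" for s x
  proof -
    have "Dt T u s x + Dx (\<eta> s) x + 3/2 * u s x * Dx (u s) x + 1/2 * \<eta> s x * Dx (\<eta> s) x - 1/3 * ?G' s x = 0"
      using sol that by (auto simp: SCB_solution_def)
    then show ?thesis by (simp add: field_simps)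
  qed
  have bnd: "\<bar>?G' s x\<bar> \<le> 3 * (2 * M + 2 * (M * M))" if s: "s \<in> {0..T}" and x: "x \<in> {0..1}" for s x
  proof -
    have "\<bar>u s x * Dx (u s) x\<bar> \<le> M * M" "\<bar>\<eta> s x * Dx (\<eta> s) x\<bar> \<le> M * M" unfolding abs_mult
      using u(2)[OF s x, of 0] u(2)[OF s x, of 1] \<eta>(2)[OF s x, of 0] \<eta>(2)[OF s x, of 1] M0
      by (auto intro!: mult_mono)
    then have "\<bar>Dt T u s x + ?F s x\<bar> \<le> 2 * M + 2 * (M * M)"
      using ut(2)[OF s x] \<eta>(2)[OF s x, of 1] by simp
    then show ?thesis unfolding eq[OF s x] abs_mult by simp
  qed
  have contG: "continuous_on {0..1} (?G s)" if "s \<in> {0..T}" for s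
    using Ck_continuous[of "u s" 2 2] u(1)[OF that] by (simp add: Ck0_def numeral_2_eq_2)
  have contu: "continuous_on {0..1} (u s)" if "s \<in> {0..T}" for s
    using Ck_continuous[of "u s" 2 0] u(1)[OF that] by (simp add: Ck0_def)
  have d1: "((\<lambda>s. J (\<lambda>x. ?G s x * prim N c x)) has_real_derivative J (\<lambda>x. ?G' t x * prim N c x)) (at t within {0..T})"
    by (rule J_has_derivative_in_time[OF contG _ bnd pwc_prim t]; (rule differentiable_Dt)?)
       (use sol in \<open>auto simp: SCB_solution_def\<close>)
  have "((\<lambda>s. J (\<lambda>x. u s x * slope N c x)) has_real_derivative J (\<lambda>x. Dt T u t x * slope N c x)) (at t within {0..T})"
    by (rule J_has_derivative_in_time[OF contu _ ut(2) pwc_slope[OF N] t]; (rule differentiable_Dt)?)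
       (use sol in \<open>auto simp: SCB_solution_def\<close>)
  then have d2: "((\<lambda>s. J (\<lambda>x. ?G s x * prim N c x)) has_real_derivative J (\<lambda>x. Dt T u t x * slope N c x)) (at t within {0..T})"
    by (rule has_real_derivative_cong_on[OF _ _ t]) (rule J_by_parts_prim[OF N u(1) c1])
  have "J (\<lambda>x. ?G' t x * prim N c x) = J (\<lambda>x. Dt T u t x * slope N c x)"
    by (rule derivative_within_Icc_unique[OF d1 d2 t T])
  also have "... = - J (\<lambda>x. Dx (Dt T u t) x * lin N c x)" using J_by_parts_lin[OF N ut(1)[OF t], of c] by simp
  finally have 1: "J (\<lambda>x. ?G' t x * prim N c x) = - J (\<lambda>x. Dx (Dt T u t) x * lin N c x)" .
  have c: "continuous_on {0..1} (Dt T u t)" "continuous_on {0..1} (u t)" "continuous_on {0..1} (Dx (u t))" "continuous_on {0..1} (\<eta> t)" "continuous_on {0..1} (Dx (\<eta> t))"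
    using Ck_continuous[of "Dt T u t" 1 0] ut(1)[OF t] Ck_continuous[of "u t" 2 0] Ck_continuous[of "u t" 2 1] u(1)[OF t]
      Ck_continuous[OF \<eta>(1)[OF t], of 0] Ck_continuous[OF \<eta>(1)[OF t], of 1] by (auto simp: Ck0_def)
  have p: "pwc (\<lambda>x. Dt T u t x * prim N c x)" "pwc (\<lambda>x. ?F t x * prim N c x)"
    by (intro pwc_rules pwc_prim pwc_continuous c)+
  have "J (\<lambda>x. ?G' t x * prim N c x) = J (\<lambda>x. 3 * (Dt T u t x * prim N c x + ?F t x * prim N c x))"
    by (rule integral_cong) (simp add: eq[OF t] algebra_simps)
  also have "... = 3 * (J (\<lambda>x. Dt T u t x * prim N c x) + J (\<lambda>x. ?F t x * prim N c x))"
    unfolding J_cmult J_add[OF p] ..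
  finally have 2: "J (\<lambda>x. ?G' t x * prim N c x) = 3 * (J (\<lambda>x. Dt T u t x * prim N c x) + J (\<lambda>x. ?F t x * prim N c x))" .
  have "a + 1/3 * d = - b" if "X = 3 * (a + b)" "X = - d" for X a b d :: real
    using that by simp
  from this[OF 2 1] show ?thesis .
qed

lemma semidiscrete_weak_mass:
  fixes \<eta>h uh :: "real \<Rightarrow> real \<Rightarrow> real"
  assumes T: "0 < T" and N: "1 \<le> N" and sol: "semidiscrete_solution T N \<eta>0 u0 \<eta>h uh" and t: "t \<in> {0..T}"
  defines "ch \<equiv> \<lambda>i. \<eta>h t (nd N i)" and "dh \<equiv> \<lambda>i. Dx (uh t) (nd N i)"
  shows "J (\<lambda>x. lin N (\<lambda>i. Dt T \<eta>h t (nd N i)) x * lin N c x)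
     = - J (\<lambda>x. (lin N dh x + 1/2 * (slope N ch x * prim N dh x + lin N ch x * lin N dh x)) * lin N c x)"
proof -
  have Sh: "\<eta>h s \<in> Sh2 N" "uh s \<in> Sh30 N" if "s \<in> {0..T}" for s
    using sol that by (auto simp: semidiscrete_solution_def)
  have eh: "\<eta>h t x = lin N ch x" and eu: "uh t x = prim N dh x" and ed: "Dx (uh t) x = lin N dh x" if "x \<in> {0..1}" for x
    using Sh2_eq_lin[OF N Sh(1)[OF t] that] Sh30_eq_prim[OF N Sh(2)[OF t] that] Sh30_derivative[OF N Sh(2)[OF t] that]
    by (simp_all add: ch_def dh_def)
  have dt: "Dt T \<eta>h t x = lin N (\<lambda>i. Dt T \<eta>h t (nd N i)) x" if x: "x \<in> {0..1}" for x
  proof (rule Dt_eqI[OF _ t T])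
    have "((\<lambda>s. lin N (\<lambda>i. \<eta>h s (nd N i)) x) has_real_derivative lin N (\<lambda>i. Dt T \<eta>h t (nd N i)) x) (at t within {0..T})"
      by (rule lin_time_derivative, rule differentiable_Dt[OF _ t])
         (use sol nd_in[of _ N] in \<open>auto simp: semidiscrete_solution_def\<close>)
    then show "((\<lambda>s. \<eta>h s x) has_real_derivative lin N (\<lambda>i. Dt T \<eta>h t (nd N i)) x) (at t within {0..T})"
      by (rule has_real_derivative_cong_on[OF _ _ t]) (rule Sh2_eq_lin[OF N Sh(1) x])
  qed
  have prod: "Dx (\<lambda>x. \<eta>h t x * uh t x) x = slope N ch x * prim N dh x + lin N ch x * lin N dh x" if x: "x \<in> {0..1} - mesh N" for x
  proof (rule Dx_eqI)
    have "((\<lambda>x. lin N ch x * prim N dh x) has_real_derivative slope N ch x * prim N dh x + lin N ch x * lin N dh x) (at x within {0..1})"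
      using DERIV_mult[OF lin_has_derivative[OF N x, of ch "{0..1}"] prim_has_derivative[of x N dh]] x by (simp add: mult.commute)
    then show "((\<lambda>x. \<eta>h t x * uh t x) has_real_derivative slope N ch x * prim N dh x + lin N ch x * lin N dh x) (at x within {0..1})"
      by (rule has_real_derivative_cong_on) (use x eh eu in auto)
  qed (use x in auto)
  have pp: "pwc (\<lambda>x. slope N ch x * prim N dh x + lin N ch x * lin N dh x)"
    by (intro pwc_rules pwc_lin pwc_prim pwc_slope[OF N])
  have "ip (Dt T \<eta>h t) (lin N c) + ip (Dx (uh t)) (lin N c) + 1/2 * ip (Dx (\<lambda>x. \<eta>h t x * uh t x)) (lin N c) = 0"
    using sol t lin_in_Sh2[OF N] by (auto simp: semidiscrete_solution_def)
  moreover have "ip (Dt T \<eta>h t) (lin N c) = J (\<lambda>x. lin N (\<lambda>i. Dt T \<eta>h t (nd N i)) x * lin N c x)"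
    by (rule ip_eq_J_cong[of _ _ "{}"]) (use dt in auto)
  moreover have "ip (Dx (uh t)) (lin N c) = J (\<lambda>x. lin N dh x * lin N c x)"
    by (rule ip_eq_J_cong[of _ _ "{}"]) (use ed in auto)
  moreover have "ip (Dx (\<lambda>x. \<eta>h t x * uh t x)) (lin N c) = J (\<lambda>x. (slope N ch x * prim N dh x + lin N ch x * lin N dh x) * lin N c x)"
    by (rule ip_eq_J_cong[OF pp pwc_lin finite_mesh[of N]]) (use prod in auto)
  moreover have "J (\<lambda>x. (lin N dh x + 1/2 * (slope N ch x * prim N dh x + lin N ch x * lin N dh x)) * lin N c x)
     = J (\<lambda>x. lin N dh x * lin N c x) + 1/2 * J (\<lambda>x. (slope N ch x * prim N dh x + lin N ch x * lin N dh x) * lin N c x)"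
  proof -
    have "J (\<lambda>x. (lin N dh x + 1/2 * (slope N ch x * prim N dh x + lin N ch x * lin N dh x)) * lin N c x)
      = J (\<lambda>x. lin N dh x * lin N c x + 1/2 * ((slope N ch x * prim N dh x + lin N ch x * lin N dh x) * lin N c x))"
      by (rule integral_cong) (simp add: algebra_simps)
    also have "... = J (\<lambda>x. lin N dh x * lin N c x) + J (\<lambda>x. 1/2 * ((slope N ch x * prim N dh x + lin N ch x * lin N dh x) * lin N c x))"
      by (rule J_add) (intro pwc_rules pwc_lin pwc_prim pwc_slope[OF N])+
    finally show ?thesis by (simp only: J_cmult)
  qed
  ultimately show ?thesis by linarith
qed

lemma semidiscrete_weak_momentum:
  fixes \<eta>h uh :: "real \<Rightarrow> real \<Rightarrow> real"
  assumes T: "0 < T" and N: "1 \<le> N" and sol: "semidiscrete_solution T N \<eta>0 u0 \<eta>h uh" and t: "t \<in> {0..T}"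
    and dd: "\<And>i. i \<le> N \<Longrightarrow> ((\<lambda>s. Dx (uh s) (nd N i)) has_real_derivative dd i) (at t within {0..T})"
    and c1: "prim N c 1 = 0"
  defines "ch \<equiv> \<lambda>i. \<eta>h t (nd N i)" and "dh \<equiv> \<lambda>i. Dx (uh t) (nd N i)"
  shows "J (\<lambda>x. prim N dd x * prim N c x) + 1/3 * J (\<lambda>x. lin N dd x * lin N c x)
     = - J (\<lambda>x. (slope N ch x + 3/2 * (prim N dh x * lin N dh x) + 1/2 * (lin N ch x * slope N ch x)) * prim N c x)"
proof -
  have Sh: "\<eta>h s \<in> Sh2 N" "uh s \<in> Sh30 N" if "s \<in> {0..T}" for s
    using sol that by (auto simp: semidiscrete_solution_def)
  have eh: "\<eta>h t x = lin N ch x" and eu: "uh t x = prim N dh x" and ed: "Dx (uh t) x = lin N dh x" if "x \<in> {0..1}" for x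
    using Sh2_eq_lin[OF N Sh(1)[OF t] that] Sh30_eq_prim[OF N Sh(2)[OF t] that] Sh30_derivative[OF N Sh(2)[OF t] that]
    by (simp_all add: ch_def dh_def)
  have dt: "Dt T uh t x = prim N dd x" if x: "x \<in> {0..1}" for x
  proof (rule Dt_eqI[OF _ t T])
    have "((\<lambda>s. prim N (\<lambda>i. Dx (uh s) (nd N i)) x) has_real_derivative prim N dd x) (at t within {0..T})"
      by (rule prim_time_derivative[OF dd x])
    then show "((\<lambda>s. uh s x) has_real_derivative prim N dd x) (at t within {0..T})"
      by (rule has_real_derivative_cong_on[OF _ _ t]) (rule Sh30_eq_prim[OF N Sh(2) x])
  qed
  have dtx: "Dx (Dt T uh t) x = lin N dd x" if x: "x \<in> {0..1}" for x
    using Dx_cong[of "Dt T uh t" "prim N dd" x] dt x Dx_prim[OF x] by simp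
  have dh: "Dx (\<eta>h t) x = slope N ch x" if x: "x \<in> {0..1} - mesh N" for x
  proof (rule Dx_eqI)
    show "(\<eta>h t has_real_derivative slope N ch x) (at x within {0..1})"
      by (rule has_real_derivative_cong_on[OF lin_has_derivative[OF N x]]) (use x eh in auto)
  qed (use x in auto)
  have psl: "pwc (slope N ch)" "pwc (\<lambda>x. lin N ch x * slope N ch x)" "pwc (\<lambda>x. prim N dh x * lin N dh x)"
    by (intro pwc_rules pwc_lin pwc_prim pwc_slope[OF N])+
  have "prim N c \<in> Sh30 N" by (rule prim_in_Sh30[OF N c1])
  then have "a_form (Dt T uh t) (prim N c) + ip (Dx (\<eta>h t)) (prim N c) + 3/2 * ip (\<lambda>x. uh t x * Dx (uh t) x) (prim N c)
          + 1/2 * ip (\<lambda>x. \<eta>h t x * Dx (\<eta>h t) x) (prim N c) = 0"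
    using sol t by (auto simp: semidiscrete_solution_def)
  moreover have "ip (Dt T uh t) (prim N c) = J (\<lambda>x. prim N dd x * prim N c x)"
    by (rule ip_eq_J_cong[of _ _ "{}"]) (use dt in auto)
  moreover have "ip (Dx (Dt T uh t)) (Dx (prim N c)) = J (\<lambda>x. lin N dd x * lin N c x)"
    by (rule ip_eq_J_cong[of _ _ "{}"]) (use dtx Dx_prim in auto)
  moreover have "ip (Dx (\<eta>h t)) (prim N c) = J (\<lambda>x. slope N ch x * prim N c x)"
    by (rule ip_eq_J_cong[OF psl(1) pwc_prim finite_mesh[of N]]) (use dh in auto)
  moreover have "ip (\<lambda>x. uh t x * Dx (uh t) x) (prim N c) = J (\<lambda>x. (prim N dh x * lin N dh x) * prim N c x)"
    by (rule ip_eq_J_cong[OF psl(3) pwc_prim finite.emptyI]) (use eu ed in auto)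
  moreover have "ip (\<lambda>x. \<eta>h t x * Dx (\<eta>h t) x) (prim N c) = J (\<lambda>x. (lin N ch x * slope N ch x) * prim N c x)"
    by (rule ip_eq_J_cong[OF psl(2) pwc_prim finite_mesh[of N]]) (use eh dh in auto)
  moreover have "J (\<lambda>x. (slope N ch x + 3/2 * (prim N dh x * lin N dh x) + 1/2 * (lin N ch x * slope N ch x)) * prim N c x)
    = J (\<lambda>x. slope N ch x * prim N c x) + 3/2 * J (\<lambda>x. (prim N dh x * lin N dh x) * prim N c x) + 1/2 * J (\<lambda>x. (lin N ch x * slope N ch x) * prim N c x)"
    (is "_ = J ?A + 3/2 * J ?B + 1/2 * J ?C")
  proof -
    have p: "pwc ?A" "pwc (\<lambda>x. 3/2 * ?B x)" "pwc (\<lambda>x. 1/2 * ?C x)"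
      by (intro pwc_rules pwc_lin pwc_prim pwc_slope[OF N])+
    have "J (\<lambda>x. (slope N ch x + 3/2 * (prim N dh x * lin N dh x) + 1/2 * (lin N ch x * slope N ch x)) * prim N c x)
      = J (\<lambda>x. ?A x + 3/2 * ?B x + 1/2 * ?C x)"
      by (rule integral_cong) (simp add: algebra_simps)
    also have "... = J ?A + J (\<lambda>x. 3/2 * ?B x) + J (\<lambda>x. 1/2 * ?C x)"
      using J_add[OF pwc_add[OF p(1,2)] p(3)] J_add[OF p(1,2)] by simp
    finally show ?thesis by (simp only: J_cmult)
  qed
  ultimately show ?thesis unfolding a_form_def by linarith
qed



section \<open>The error bound\<close>

text \<open>
  The derivative of the elliptic projection is the \<open>L\<^sup>2\<close> projection of the derivative, so the second bound is the first one
  improved by \<open>orthogonal_primitive_bound\<close>.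
\<close>

lemma elliptic_projection_error:
  assumes N: "1 \<le> N" and v: "v \<in> Ck0 3" and M: "\<And>x. x \<in> {0..1} \<Longrightarrow> \<bar>(Dx ^^ 3) v x\<bar> \<le> M"
  shows "x \<in> {0..1} \<Longrightarrow> \<bar>Dx v x - lin N (Pc N (Dx v)) x\<bar> \<le> 14 * M * (1 / real N)\<^sup>2"
    and "x \<in> {0..1} \<Longrightarrow> \<bar>v x - prim N (Pc N (Dx v)) x\<bar> \<le> 28 * M * (1 / real N) ^ 3"
    and "prim N (Pc N (Dx v)) 1 = 0"
proof -
  have v3: "v \<in> Ck 3" "v 0 = 0" "v 1 = 0" using v by (auto simp: Ck0_def)
  have pow: "(Dx ^^ j) (Dx v) = (Dx ^^ (Suc j)) v" for j by (simp add: funpow_Suc_right del: funpow.simps)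
  have Dv: "Dx v \<in> Ck 2"
    unfolding Ck_def
  proof (intro CollectI conjI allI impI)
    fix j :: nat assume "j < 2"
    then have "Suc j < 3" by simp
    then show "(Dx ^^ j) (Dx v) differentiable_on {0..1}" unfolding pow using v3(1) unfolding Ck_def by blast
  next
    show "continuous_on {0..1} ((Dx ^^ 2) (Dx v))"
      unfolding pow using Ck_continuous[OF v3(1), of 3] by (simp add: eval_nat_numeral)
  qed
  have cD: "continuous_on {0..1} (Dx v)" using Ck_continuous[OF Dv, of 0] by simp
  let ?w = "\<lambda>x. Dx v x - lin N (Pc N (Dx v)) x"
  have pw: "pwc ?w" by (intro pwc_rules pwc_lin pwc_continuous cD)
  have 1: "\<bar>?w x\<bar> \<le> 14 * M * (1 / real N)\<^sup>2" if x: "x \<in> {0..1}" for x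
    by (rule Pc_approximation[OF N Dv _ x]) (use M pow[of 2] in \<open>simp add: eval_nat_numeral\<close>)
  then show "x \<in> {0..1} \<Longrightarrow> \<bar>Dx v x - lin N (Pc N (Dx v)) x\<bar> \<le> 14 * M * (1 / real N)\<^sup>2" .
  have orth: "J (\<lambda>x. ?w x * lin N c x) = 0" for c by (rule Pc_orthogonal[OF N pwc_continuous[OF cD]])
  have sig: "v x - prim N (Pc N (Dx v)) x = integral {0..x} ?w" if x: "x \<in> {0..1}" for x
  proof -
    have "(Dx v has_integral (v x - v 0)) {0..x}"
    proof (rule fundamental_theorem_of_calculus)
      fix y assume y: "y \<in> {0..x}"
      have "(v has_real_derivative Dx v y) (at y within {0..1})"
        using Ck_has_derivative[OF v3(1), of 0 y] x y by simp
      then have "(v has_real_derivative Dx v y) (at y within {0..x})" by (rule DERIV_subset) (use x in auto)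
      then show "(v has_vector_derivative Dx v y) (at y within {0..x})"
        by (simp add: has_real_derivative_iff_has_vector_derivative)
    qed (use x in auto)
    moreover have "(lin N (Pc N (Dx v)) has_integral prim N (Pc N (Dx v)) x) {0..x}"
      unfolding prim_def by (intro integrable_integral integrable_continuous_real lin_continuous)
    ultimately have "(?w has_integral (v x - v 0) - prim N (Pc N (Dx v)) x) {0..x}" by (rule has_integral_diff)
    then show ?thesis using v3(2) by (simp only: integral_unique diff_zero)
  qed
  show "\<bar>v x - prim N (Pc N (Dx v)) x\<bar> \<le> 28 * M * (1 / real N) ^ 3" if x: "x \<in> {0..1}"
    unfolding sig[OF x] using orthogonal_primitive_bound[OF N pw orth 1 x] by (simp add: eval_nat_numeral)
  have "J ?w = J (\<lambda>x. ?w x * lin N (\<lambda>_. 1) x)" by (rule integral_cong) (simp only: lin_one[OF N] mult_1_right)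
  then have "J ?w = 0" by (simp only: orth)
  moreover have "v 1 - prim N (Pc N (Dx v)) 1 = J ?w" by (rule sig) simp
  ultimately show "prim N (Pc N (Dx v)) 1 = 0" using v3(3) by linarith
qed

lemma energy_time_derivative:
  assumes c: "\<And>i. i \<le> N \<Longrightarrow> ((\<lambda>s. c s i) has_real_derivative c' i) (at t within S)"
    and d: "\<And>i. i \<le> N \<Longrightarrow> ((\<lambda>s. d s i) has_real_derivative d' i) (at t within S)"
  shows "((\<lambda>s. J (\<lambda>x. (lin N (c s) x)\<^sup>2) + J (\<lambda>x. (prim N (d s) x)\<^sup>2) + 1/3 * J (\<lambda>x. (lin N (d s) x)\<^sup>2)) has_real_derivative
    2 * (J (\<lambda>x. lin N c' x * lin N (c t) x) + J (\<lambda>x. prim N d' x * prim N (d t) x) + 1/3 * J (\<lambda>x. lin N d' x * lin N (d t) x))) (at t within S)"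
proof -
  have 1: "((\<lambda>s. J (\<lambda>x. (lin N (c s) x)\<^sup>2)) has_real_derivative 2 * J (\<lambda>x. lin N c' x * lin N (c t) x)) (at t within S)"
    unfolding lin_def by (rule J_square_time_derivative[OF _ c]) auto
  have 2: "((\<lambda>s. J (\<lambda>x. (lin N (d s) x)\<^sup>2)) has_real_derivative 2 * J (\<lambda>x. lin N d' x * lin N (d t) x)) (at t within S)"
    unfolding lin_def by (rule J_square_time_derivative[OF _ d]) auto
  let ?H = "\<lambda>i x. integral {0..x} (hat N i)"
  have H: "pwc (?H i)" if "i \<le> N" for i
    using pwc_prim[of N "\<lambda>j. if j = i then 1 else 0"] unfolding prim_def hat_eq_lin[OF that] .
  have e: "J (\<lambda>x. prim N a x * prim N b x) = J (\<lambda>x. (\<Sum>i\<le>N. a i * ?H i x) * (\<Sum>i\<le>N. b i * ?H i x))" for a b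
    by (rule integral_cong) (simp add: prim_eq_sum)
  have 3: "((\<lambda>s. J (\<lambda>x. (prim N (d s) x)\<^sup>2)) has_real_derivative 2 * J (\<lambda>x. prim N d' x * prim N (d t) x)) (at t within S)"
    unfolding power2_eq_square e
    using J_square_time_derivative[of N ?H d d' t S, OF H d] unfolding power2_eq_square by simp
  show ?thesis using DERIV_add[OF DERIV_add[OF 1 3] DERIV_cmult[OF 2, of "1/3"]] by simp
qed

text \<open>
  The discrete initial values are the projections of the exact ones, hence the energy of \<open>(\<theta>, \<xi>)\<close> starts at zero.  For \<open>uh\<close>
  the uniqueness of the elliptic projection is seen by testing with the difference of the two candidates.
\<close>

lemma semidiscrete_initial_coefficients:
  assumes T: "0 < T" and N: "1 \<le> N" and sol: "SCB_solution T \<eta>0 u0 \<eta> u"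
    and hsol: "semidiscrete_solution T N \<eta>0 u0 \<eta>h uh"
    and \<eta>: "continuous_on {0..1} (\<eta> 0)" and u: "u 0 \<in> Ck0 3" and i: "i \<le> N"
  shows "\<eta>h 0 (nd N i) = Pc N (\<eta> 0) i" and "Dx (uh 0) (nd N i) = Pc N (Dx (u 0)) i"
proof -
  have 0: "(0::real) \<in> {0..T}" using T by simp
  have Sh: "\<eta>h 0 \<in> Sh2 N" "uh 0 \<in> Sh30 N" using hsol 0 by (auto simp: semidiscrete_solution_def)
  show "\<eta>h 0 (nd N i) = Pc N (\<eta> 0) i"
  proof (rule L2_projection_unique[OF N pwc_continuous[OF \<eta>] _ i, where c = "\<lambda>i. \<eta>h 0 (nd N i)"])
    fix k assume k: "k \<le> N"
    have "ip (\<eta>h 0) (hat N k) = ip \<eta>0 (hat N k)"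
      using hsol lin_in_Sh2[OF N] hat_eq_lin[OF k] by (auto simp: semidiscrete_solution_def is_L2_projection_def)
    moreover have "ip (\<eta>h 0) (hat N k) = J (\<lambda>x. lin N (\<lambda>i. \<eta>h 0 (nd N i)) x * hat N k x)"
      by (rule ip_eq_J_cong[of _ _ "{}"]) (use Sh2_eq_lin[OF N Sh(1)] in auto)
    moreover have "ip \<eta>0 (hat N k) = J (\<lambda>x. \<eta> 0 x * hat N k x)"
      by (rule ip_eq_J_cong[of _ _ "{}"]) (use sol \<eta> in \<open>auto simp: SCB_solution_def intro: pwc_continuous\<close>)
    ultimately show "J (\<lambda>x. lin N (\<lambda>i. \<eta>h 0 (nd N i)) x * hat N k x) = J (\<lambda>x. \<eta> 0 x * hat N k x)" by simp
  qed
  let ?p = "Pc N (Dx (u 0))" and ?dh = "\<lambda>i. Dx (uh 0) (nd N i)"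
  define d where "d = (\<lambda>i. ?p i - ?dh i)"
  have u3: "u 0 \<in> Ck 3" using u by (simp add: Ck0_def)
  have cD: "continuous_on {0..1} (Dx (u 0))" using Ck_continuous[OF u3, of 1] by simp
  have "prim N ?p 1 = 0"
    by (rule elliptic_projection_error(3)[OF N u Ck_norm_bounds[OF u3]]) auto
  moreover have "uh 0 1 = 0" using Sh(2) by (auto simp: Sh30_def Ck0_def)
  ultimately have "prim N d 1 = 0"
    unfolding d_def using Sh30_eq_prim[OF N Sh(2), of 1] by (simp add: prim_diff)
  then have "prim N d \<in> Sh30 N" by (rule prim_in_Sh30[OF N])
  then have "ip (Dx (uh 0)) (Dx (prim N d)) = ip (Dx u0) (Dx (prim N d))"
    using hsol by (auto simp: semidiscrete_solution_def is_elliptic_projection_def)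
  moreover have "ip (Dx (uh 0)) (Dx (prim N d)) = J (\<lambda>x. lin N ?dh x * lin N d x)"
    by (rule ip_eq_J_cong[of _ _ "{}"]) (use Sh30_derivative[OF N Sh(2)] Dx_prim in auto)
  moreover have "ip (Dx u0) (Dx (prim N d)) = J (\<lambda>x. Dx (u 0) x * lin N d x)"
    by (rule ip_eq_J_cong[of _ _ "{}"])
       (use sol cD Dx_prim in \<open>auto simp: SCB_solution_def intro!: pwc_continuous Dx_cong\<close>)
  moreover have "J (\<lambda>x. (Dx (u 0) x - lin N ?p x) * lin N d x) = 0"
    by (rule Pc_orthogonal[OF N pwc_continuous[OF cD]])
  moreover have "J (\<lambda>x. (lin N d x)\<^sup>2) = J (\<lambda>x. Dx (u 0) x * lin N d x - (Dx (u 0) x - lin N ?p x) * lin N d x - lin N ?dh x * lin N d x)"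
  proof (rule integral_cong)
    fix x
    have "lin N d x = lin N ?p x - lin N ?dh x" unfolding d_def by (rule lin_diff)
    then have "(lin N d x)\<^sup>2 = (lin N ?p x - lin N ?dh x) * lin N d x" by (simp add: power2_eq_square)
    then show "(lin N d x)\<^sup>2 = Dx (u 0) x * lin N d x - (Dx (u 0) x - lin N ?p x) * lin N d x - lin N ?dh x * lin N d x"
      by (simp only:) (simp add: algebra_simps)
  qed
  moreover have "... = J (\<lambda>x. Dx (u 0) x * lin N d x) - J (\<lambda>x. (Dx (u 0) x - lin N ?p x) * lin N d x) - J (\<lambda>x. lin N ?dh x * lin N d x)"
  proof -
    have p: "pwc (\<lambda>x. Dx (u 0) x * lin N d x)" "pwc (\<lambda>x. (Dx (u 0) x - lin N ?p x) * lin N d x)" "pwc (\<lambda>x. lin N ?dh x * lin N d x)"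
      by (intro pwc_rules pwc_lin pwc_continuous[OF cD])+
    show ?thesis using J_diff[OF pwc_diff[OF p(1,2)] p(3)] J_diff[OF p(1,2)] by simp
  qed
  ultimately have "J (\<lambda>x. (lin N d x)\<^sup>2) = 0" by simp
  then have "(lin N d (nd N i))\<^sup>2 \<le> 0" using lin_sup_bound[OF N nd_in[OF i], of d] by simp
  then show "Dx (uh 0) (nd N i) = Pc N (Dx (u 0)) i" using lin_node[OF N i] by (simp add: d_def)
qed

text \<open>
  The coefficients \<open>c\<close> and \<open>d\<close> describe \<open>\<theta>\<close> and the spatial derivative of \<open>\<xi>\<close>.  The weak forms, tested with \<open>\<theta>\<close> and \<open>\<xi>\<close>,
  turn the time derivative of the energy into the expression estimated in \<open>energy_bound\<close>.
\<close>

lemma error_energy_bound: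
  fixes T :: real and \<eta>0 u0 :: "real \<Rightarrow> real" and \<eta> u \<eta>h uh :: "real \<Rightarrow> real \<Rightarrow> real"
  defines "c \<equiv> \<lambda>N t i. Pc N (\<eta> t) i - \<eta>h t (nd N i)" and "d \<equiv> \<lambda>N t i. Pc N (Dx (u t)) i - Dx (uh t) (nd N i)"
  assumes T: "0 < T" and N: "1 \<le> N" and M1: "1 \<le> M"
    and sol: "SCB_solution T \<eta>0 u0 \<eta> u" and hsol: "semidiscrete_solution T N \<eta>0 u0 \<eta>h uh"
    and \<eta>: "\<And>t. t \<in> {0..T} \<Longrightarrow> \<eta> t \<in> Ck 4" "\<And>t j x. t \<in> {0..T} \<Longrightarrow> j \<le> 4 \<Longrightarrow> x \<in> {0..1} \<Longrightarrow> \<bar>(Dx ^^ j) (\<eta> t) x\<bar> \<le> M"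
    and \<eta>t: "\<And>t. t \<in> {0..T} \<Longrightarrow> Dt T \<eta> t \<in> Ck 2" "\<And>t x. t \<in> {0..T} \<Longrightarrow> x \<in> {0..1} \<Longrightarrow> \<bar>Dt T \<eta> t x\<bar> \<le> M"
    and u: "\<And>t. t \<in> {0..T} \<Longrightarrow> u t \<in> Ck0 3" "\<And>t j x. t \<in> {0..T} \<Longrightarrow> j \<le> 3 \<Longrightarrow> x \<in> {0..1} \<Longrightarrow> \<bar>(Dx ^^ j) (u t) x\<bar> \<le> M"
    and ut: "\<And>t. t \<in> {0..T} \<Longrightarrow> Dt T u t \<in> Ck0 3" "\<And>t j x. t \<in> {0..T} \<Longrightarrow> j \<le> 3 \<Longrightarrow> x \<in> {0..1} \<Longrightarrow> \<bar>(Dx ^^ j) (Dt T u t) x\<bar> \<le> M"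
    and t: "t \<in> {0..T}"
  shows "J (\<lambda>x. (lin N (c N t) x)\<^sup>2) + J (\<lambda>x. (prim N (d N t) x)\<^sup>2) + 1/3 * J (\<lambda>x. (lin N (d N t) x)\<^sup>2)
     \<le> exp (2000 * (28 * M)\<^sup>2 * T) * (1 / real N) ^ 6"
proof -
  define h where "h = 1 / real N"
  define C where "C = 28 * M"
  have C: "1 \<le> C" "M \<le> C" using M1 by (auto simp: C_def)
  define E where "E = (\<lambda>t. J (\<lambda>x. (lin N (c N t) x)\<^sup>2) + J (\<lambda>x. (prim N (d N t) x)\<^sup>2) + 1/3 * J (\<lambda>x. (lin N (d N t) x)\<^sup>2))"
  have Sh: "\<eta>h s \<in> Sh2 N" "uh s \<in> Sh30 N" if "s \<in> {0..T}" for s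
    using hsol that by (auto simp: semidiscrete_solution_def)
  have u2: "u s \<in> Ck0 2" "u s \<in> Ck0 1" if "s \<in> {0..T}" for s
    using u(1)[OF that] Ck_mono[of "u s" 3 2] Ck_mono[of "u s" 3 1] by (auto simp: Ck0_def)
  have ut1: "Dt T u s \<in> Ck0 1" if "s \<in> {0..T}" for s
    using ut(1)[OF that] Ck_mono[of "Dt T u s" 3 1] by (auto simp: Ck0_def)
  have ct: "continuous_on {0..1} (\<eta> s)" "continuous_on {0..1} (Dt T \<eta> s)" "continuous_on {0..1} (Dt T u s)" "continuous_on {0..1} (Dx (Dt T u s))"
    "continuous_on {0..1} (Dx (u s))" "continuous_on {0..1} (u s)" "continuous_on {0..1} (Dx (\<eta> s))" if s: "s \<in> {0..T}" for s
    using Ck_continuous[OF \<eta>(1)[OF s], of 0] Ck_continuous[OF \<eta>t(1)[OF s], of 0] ut1[OF s] Ck_continuous[of "Dt T u s" 1 0]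
      Ck_continuous[of "Dt T u s" 1 1] u2[OF s] Ck_continuous[of "u s" 2 1] Ck_continuous[of "u s" 2 0] Ck_continuous[OF \<eta>(1)[OF s], of 1] by (auto simp: Ck0_def)
  have td: "(\<lambda>s. \<eta> s x) differentiable_on {0..T}" "(\<lambda>s. u s x) differentiable_on {0..T}" 
    "(\<lambda>s. \<eta>h s x) differentiable_on {0..T}" "(\<lambda>s. uh s x) differentiable_on {0..T}" if "x \<in> {0..1}" for x
    using sol hsol that by (auto simp: SCB_solution_def semidiscrete_solution_def)
  have P1: "prim N (Pc N (Dx (u s))) 1 = 0" if s: "s \<in> {0..T}" for s
    by (rule elliptic_projection_error(3)[OF N u(1)[OF s] u(2)[OF s]]) auto
  have d1: "prim N (d N s) 1 = 0" if s: "s \<in> {0..T}" for s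
  proof -
    have "uh s 1 = 0" using Sh(2)[OF s] by (auto simp: Sh30_def Ck0_def)
    then show ?thesis unfolding d_def using P1[OF s] Sh30_eq_prim[OF N Sh(2)[OF s], of 1] by (simp add: prim_diff)
  qed
  have "\<exists>dd. \<forall>i\<le>N. ((\<lambda>s. Dx (uh s) (nd N i)) has_real_derivative dd i) (at t within {0..T})" if "t \<in> {0..T}" for t
    by (rule Sh30_coefficients_differentiable[OF N Sh(2) that td(4)])
  then obtain dd where dd: "\<And>t i. t \<in> {0..T} \<Longrightarrow> i \<le> N \<Longrightarrow> ((\<lambda>s. Dx (uh s) (nd N i)) has_real_derivative dd t i) (at t within {0..T})"
    by metis
  define c' where "c' = (\<lambda>t i. Pc N (Dt T \<eta> t) i - Dt T \<eta>h t (nd N i))"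
  define d' where "d' = (\<lambda>t i. Pc N (Dx (Dt T u t)) i - dd t i)"
  define E' where "E' = (\<lambda>t. 2 * (J (\<lambda>x. lin N (c' t) x * lin N (c N t) x) + J (\<lambda>x. prim N (d' t) x * prim N (d N t) x) + 1/3 * J (\<lambda>x. lin N (d' t) x * lin N (d N t) x)))"
  have der: "(E has_real_derivative E' t) (at t within {0..T})" if t: "t \<in> {0..T}" for t
    unfolding E_def E'_def
  proof (rule energy_time_derivative)
    fix i assume i: "i \<le> N"
    show "((\<lambda>s. c N s i) has_real_derivative c' t i) (at t within {0..T})" unfolding c_def c'_def
      by (intro DERIV_diff Pc_time_derivative[OF ct(1) td(1) \<eta>t(2) t] differentiable_Dt td(3) t nd_in[OF i])
    show "((\<lambda>s. d N s i) has_real_derivative d' t i) (at t within {0..T})" unfolding d_def d'_def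
      by (intro DERIV_diff Pc_Dx_time_derivative[OF N u2(2) ut1 td(2) _ t, of M] dd t i)
         (use ut(2)[of _ 0] in auto)
  qed
  have le: "E' t \<le> 2000 * C\<^sup>2 * (E t + h ^ 6)" if t: "t \<in> {0..T}" for t
  proof -
    let ?ch = "\<lambda>i. \<eta>h t (nd N i)" and ?dh = "\<lambda>i. Dx (uh t) (nd N i)"
    let ?c = "c N t" and ?d = "d N t"
    define st where "st = (\<lambda>x. Dt T u t x - prim N (Pc N (Dx (Dt T u t))) x)"
    have st: "pwc st" unfolding st_def by (intro pwc_rules pwc_prim pwc_continuous ct t)
    have stb: "\<bar>st x\<bar> \<le> C * h ^ 3" if "x \<in> {0..1}" for x
      using elliptic_projection_error(2)[OF N ut(1)[OF t] ut(2)[OF t] that] by (simp add: st_def C_def h_def)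
    let ?A1 = "\<lambda>x. Dx (u t) x + 1/2 * (Dx (\<eta> t) x * u t x + \<eta> t x * Dx (u t) x)"
    let ?A2 = "\<lambda>x. lin N ?dh x + 1/2 * (slope N ?ch x * prim N ?dh x + lin N ?ch x * lin N ?dh x)"
    let ?B1 = "\<lambda>x. Dx (\<eta> t) x + 3/2 * (u t x * Dx (u t) x) + 1/2 * (\<eta> t x * Dx (\<eta> t) x)"
    let ?B2 = "\<lambda>x. slope N ?ch x + 3/2 * (prim N ?dh x * lin N ?dh x) + 1/2 * (lin N ?ch x * slope N ?ch x)"
    note pc = pwc_continuous[OF ct(1)[OF t]] pwc_continuous[OF ct(2)[OF t]] pwc_continuous[OF ct(3)[OF t]] pwc_continuous[OF ct(4)[OF t]]
      pwc_continuous[OF ct(5)[OF t]] pwc_continuous[OF ct(6)[OF t]] pwc_continuous[OF ct(7)[OF t]]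
    have proj: "J (\<lambda>x. lin N (Pc N f) x * lin N e x) = J (\<lambda>x. f x * lin N e x)" if "pwc f" for f e
    proof -
      have "J (\<lambda>x. (f x - lin N (Pc N f) x) * lin N e x) = J (\<lambda>x. f x * lin N e x) - J (\<lambda>x. lin N (Pc N f) x * lin N e x)"
        unfolding left_diff_distrib by (rule J_diff) (use that in auto)
      then show ?thesis using Pc_orthogonal[OF N that] by simp
    qed
    have "J (\<lambda>x. lin N (c' t) x * lin N ?c x) = J (\<lambda>x. lin N (Pc N (Dt T \<eta> t)) x * lin N ?c x) - J (\<lambda>x. lin N (\<lambda>i. Dt T \<eta>h t (nd N i)) x * lin N ?c x)"
      unfolding c'_def lin_diff left_diff_distrib by (rule J_diff) auto
    also have "... = - J (\<lambda>x. ?A1 x * lin N ?c x) + J (\<lambda>x. ?A2 x * lin N ?c x)"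
      unfolding proj[OF pc(2)] SCB_weak_mass[OF sol t] semidiscrete_weak_mass[OF T N hsol t] by simp
    finally have 1: "J (\<lambda>x. lin N (c' t) x * lin N ?c x) = - J (\<lambda>x. ?A1 x * lin N ?c x) + J (\<lambda>x. ?A2 x * lin N ?c x)" .
    have "J (\<lambda>x. prim N (d' t) x * prim N ?d x) = J (\<lambda>x. Dt T u t x * prim N ?d x - st x * prim N ?d x - prim N (dd t) x * prim N ?d x)"
      by (rule integral_cong) (simp add: d'_def st_def prim_diff algebra_simps)
    also have "... = J (\<lambda>x. Dt T u t x * prim N ?d x) - J (\<lambda>x. st x * prim N ?d x) - J (\<lambda>x. prim N (dd t) x * prim N ?d x)"
    proof -
      have p: "pwc (\<lambda>x. Dt T u t x * prim N ?d x)" "pwc (\<lambda>x. st x * prim N ?d x)" "pwc (\<lambda>x. prim N (dd t) x * prim N ?d x)"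
        by (intro pwc_rules pc st pwc_prim)+
      show ?thesis using J_diff[OF pwc_diff[OF p(1,2)] p(3)] J_diff[OF p(1,2)] by simp
    qed
    finally have 2: "J (\<lambda>x. prim N (d' t) x * prim N ?d x) = J (\<lambda>x. Dt T u t x * prim N ?d x) - J (\<lambda>x. st x * prim N ?d x) - J (\<lambda>x. prim N (dd t) x * prim N ?d x)" .
    have "J (\<lambda>x. lin N (d' t) x * lin N ?d x) = J (\<lambda>x. lin N (Pc N (Dx (Dt T u t))) x * lin N ?d x) - J (\<lambda>x. lin N (dd t) x * lin N ?d x)"
      unfolding d'_def lin_diff left_diff_distrib by (rule J_diff) auto
    then have 3: "J (\<lambda>x. lin N (d' t) x * lin N ?d x) = J (\<lambda>x. Dx (Dt T u t) x * lin N ?d x) - J (\<lambda>x. lin N (dd t) x * lin N ?d x)"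
      unfolding proj[OF pc(4)] .
    have 4: "J (\<lambda>x. Dt T u t x * prim N ?d x) + 1/3 * J (\<lambda>x. Dx (Dt T u t) x * lin N ?d x) = - J (\<lambda>x. ?B1 x * prim N ?d x)"
    proof (rule SCB_weak_momentum[OF T N sol t d1[OF t], of M])
      fix s :: real assume s: "s \<in> {0..T}"
      show "\<eta> s \<in> Ck 1" using \<eta>(1)[OF s] by (rule Ck_mono) simp
      show "u s \<in> Ck0 2" "Dt T u s \<in> Ck0 1" using u2(1)[OF s] ut1[OF s] by auto
      fix x :: real assume x: "x \<in> {0..1}"
      show "\<bar>Dt T u s x\<bar> \<le> M" using ut(2)[OF s _ x, of 0] by simp
      fix j :: nat assume "j \<le> 1"
      then show "\<bar>(Dx ^^ j) (\<eta> s) x\<bar> \<le> M" "\<bar>(Dx ^^ j) (u s) x\<bar> \<le> M" using \<eta>(2)[OF s _ x, of j] u(2)[OF s _ x, of j] by auto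
    qed
    have 5: "J (\<lambda>x. prim N (dd t) x * prim N ?d x) + 1/3 * J (\<lambda>x. lin N (dd t) x * lin N ?d x) = - J (\<lambda>x. ?B2 x * prim N ?d x)"
      by (rule semidiscrete_weak_momentum[OF T N hsol t dd[OF t] d1[OF t]])
    let ?L = "\<lambda>x. - (Dx (u t) x - lin N ?dh x) * lin N ?c x
       - 1/2 * ((Dx (\<eta> t) x * u t x + \<eta> t x * Dx (u t) x) - (slope N ?ch x * prim N ?dh x + lin N ?ch x * lin N ?dh x)) * lin N ?c x
       - (Dx (\<eta> t) x - slope N ?ch x) * prim N ?d x
       - 3/2 * (u t x * Dx (u t) x - prim N ?dh x * lin N ?dh x) * prim N ?d x
       - 1/2 * (\<eta> t x * Dx (\<eta> t) x - lin N ?ch x * slope N ?ch x) * prim N ?d x"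
    have 6: "J ?L = J (\<lambda>x. ?A2 x * lin N ?c x) - J (\<lambda>x. ?A1 x * lin N ?c x) + J (\<lambda>x. ?B2 x * prim N ?d x) - J (\<lambda>x. ?B1 x * prim N ?d x)"
    proof -
      have p: "pwc (\<lambda>x. ?A2 x * lin N ?c x)" "pwc (\<lambda>x. ?A1 x * lin N ?c x)" "pwc (\<lambda>x. ?B2 x * prim N ?d x)" "pwc (\<lambda>x. ?B1 x * prim N ?d x)"
        by (intro pwc_rules pc pwc_prim pwc_lin pwc_slope[OF N])+
      have "J ?L = J (\<lambda>x. ?A2 x * lin N ?c x - ?A1 x * lin N ?c x + ?B2 x * prim N ?d x - ?B1 x * prim N ?d x)"
        by (rule integral_cong) (simp add: algebra_simps)
      then show ?thesis
        using J_diff[OF pwc_add[OF pwc_diff[OF p(1,2)] p(3)] p(4)] J_add[OF pwc_diff[OF p(1,2)] p(3)] J_diff[OF p(1,2)] by simp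
    qed
    \<comment> \<open>The six facts above combined: the projected exact solution obeys the exact weak forms up to
      the error of the elliptic projection, so that only differences of fluxes remain.\<close>
    have alg: "2 * (a1 + a2 + 1/3 * a3) = 2 * (L - S)"
      if "a1 = - A1 + A2" "a2 = p - S - q" "a3 = p' - q'" "p + 1/3 * p' = - B1" "q + 1/3 * q' = - B2" "L = A2 - A1 + B2 - B1"
      for a1 a2 a3 A1 A2 p S q p' q' B1 B2 L :: real
    proof -
      have "B1 = - p - p' / 3" "B2 = - q - q' / 3" using that(4,5) by simp_all
      then show ?thesis unfolding that(1-3,6) by (simp add: field_simps)
    qed
    have "E' t = 2 * (J ?L - J (\<lambda>x. st x * prim N ?d x))" unfolding E'_def by (rule alg[OF 1 2 3 4 5 6])
    moreover have "J ?L - J (\<lambda>x. st x * prim N ?d x) \<le> 1000 * C\<^sup>2 * (h ^ 6 + E t)"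
      unfolding E_def c_def d_def h_def
    proof (rule energy_bound[OF N C(1) \<eta>(1)[OF t] _ u2(1)[OF t] _ _ _ _ st])
      show "\<bar>(Dx ^^ j) (\<eta> t) x\<bar> \<le> C" if "j \<le> 4" "x \<in> {0..1}" for j x using \<eta>(2)[OF t that] C by linarith
      show "\<bar>(Dx ^^ j) (u t) x\<bar> \<le> C" if "j \<le> 2" "x \<in> {0..1}" for j x using u(2)[OF t _ that(2), of j] that C by linarith
      show "\<bar>\<eta> t x - lin N (Pc N (\<eta> t)) x\<bar> \<le> C * (1 / real N)\<^sup>2" if x: "x \<in> {0..1}" for x
      proof -
        have "\<bar>\<eta> t x - lin N (Pc N (\<eta> t)) x\<bar> \<le> 14 * M * (1 / real N)\<^sup>2"
          by (rule Pc_approximation[OF N Ck_mono[OF \<eta>(1)[OF t]] _ x]) (use \<eta>(2)[OF t, of 2] in auto)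
        also have "... \<le> C * (1 / real N)\<^sup>2" using M1 by (intro mult_right_mono) (auto simp: C_def)
        finally show ?thesis .
      qed
      show "\<bar>Dx (u t) x - lin N (Pc N (Dx (u t))) x\<bar> \<le> C * (1 / real N)\<^sup>2" if x: "x \<in> {0..1}" for x
      proof -
        have "\<bar>Dx (u t) x - lin N (Pc N (Dx (u t))) x\<bar> \<le> 14 * M * (1 / real N)\<^sup>2"
          by (rule elliptic_projection_error(1)[OF N u(1)[OF t] u(2)[OF t] x]) auto
        also have "... \<le> C * (1 / real N)\<^sup>2" using M1 by (intro mult_right_mono) (auto simp: C_def)
        finally show ?thesis .
      qed
      show "\<bar>u t x - prim N (Pc N (Dx (u t))) x\<bar> \<le> C * (1 / real N) ^ 3" if x: "x \<in> {0..1}" for x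
        using elliptic_projection_error(2)[OF N u(1)[OF t] u(2)[OF t] x] by (simp add: C_def)
      show "\<bar>st x\<bar> \<le> C * (1 / real N) ^ 3" if x: "x \<in> {0..1}" for x using stb[OF x] by (simp add: h_def)
      show "prim N (Pc N (Dx (u t))) 1 = 0" by (rule P1[OF t])
      show "prim N (\<lambda>i. Pc N (Dx (u t)) i - Dx (uh t) (nd N i)) 1 = 0" using d1[OF t] by (simp add: d_def)
    qed
    ultimately show ?thesis by (simp add: algebra_simps)
  qed
  have E0: "E 0 = 0"
  proof -
    have 0: "(0::real) \<in> {0..T}" using T by simp
    have "continuous_on {0..1} (\<eta> 0)" by (rule ct(1)[OF 0])
    note init = semidiscrete_initial_coefficients[OF T N sol hsol this u(1)[OF 0]]
    have c0: "c N 0 i = 0" and d0: "d N 0 i = 0" if i: "i \<le> N" for i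
      using init[OF i] by (simp_all add: c_def d_def)
    have "lin N (c N 0) x = 0" "lin N (d N 0) x = 0" for x unfolding lin_def using c0 d0 by auto
    moreover have "prim N (d N 0) x = 0" if "x \<in> {0..1}" for x unfolding prim_eq_sum[OF that] using d0 by auto
    moreover from this have "J (\<lambda>x. (prim N (d N 0) x)\<^sup>2) = J (\<lambda>x. 0)" by (intro integral_cong) auto
    ultimately show ?thesis by (simp add: E_def)
  qed
  have "E t \<le> exp (2000 * C\<^sup>2 * T) * h ^ 6"
    by (rule Gronwall_linear[OF der le E0 t]) (auto simp: h_def)
  then show ?thesis by (simp add: E_def h_def C_def)
qed

text \<open>
  For the primitive, \<open>\<bar>lin N d y\<bar> \<le> h\<^sup>3/2 + (lin N d y)\<^sup>2 / (2 h\<^sup>3)\<close> replaces the Cauchy-Schwarz inequality.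
\<close>

lemma pointwise_from_energy:
  assumes N: "1 \<le> N" and A: "1 \<le> A"
    and E: "J (\<lambda>x. (lin N c x)\<^sup>2) + J (\<lambda>x. (prim N d x)\<^sup>2) + 1/3 * J (\<lambda>x. (lin N d x)\<^sup>2) \<le> A * (1 / real N) ^ 6"
    and x: "x \<in> {0..1}"
  shows "\<bar>lin N c x\<bar> \<le> 6 * A * (1 / real N)\<^sup>2" and "\<bar>prim N d x\<bar> \<le> 2 * A * (1 / real N) ^ 3"
proof -
  define h where "h = 1 / real N"
  have h: "0 < h" "h \<le> 1" using N by (auto simp: h_def)
  have Nh: "real N * h = 1" using N by (simp add: h_def)
  have nn: "0 \<le> J (\<lambda>x. (lin N c x)\<^sup>2)" "0 \<le> J (\<lambda>x. (prim N d x)\<^sup>2)" "0 \<le> J (\<lambda>x. (lin N d x)\<^sup>2)"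
    by (auto intro!: J_nonneg)
  have Ec: "J (\<lambda>x. (lin N c x)\<^sup>2) \<le> A * h ^ 6" and Ed: "J (\<lambda>x. (lin N d x)\<^sup>2) \<le> 3 * (A * h ^ 6)"
    using E nn unfolding h_def by linarith+
  have "(lin N c x)\<^sup>2 \<le> 6 * real N * (A * h ^ 6)"
    using lin_sup_bound[OF N x, of c] mult_left_mono[OF Ec, of "6 * real N"] by linarith
  also have "... = (6 * A) * h ^ 5 * (real N * h)" by (simp add: eval_nat_numeral)
  also have "... \<le> (6 * A)\<^sup>2 * h ^ 4"
  proof -
    have "(6 * A) * h ^ 5 \<le> (6 * A)\<^sup>2 * h ^ 4"
      using A h by (intro mult_mono power_decreasing) (auto simp: power2_eq_square)
    then show ?thesis by (simp add: Nh)
  qed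
  also have "... = (6 * A * h\<^sup>2)\<^sup>2" by (simp add: power_mult_distrib flip: power_mult)
  finally have "\<bar>lin N c x\<bar> \<le> \<bar>6 * A * h\<^sup>2\<bar>" by (simp only: abs_le_square_iff)
  then show "\<bar>lin N c x\<bar> \<le> 6 * A * (1 / real N)\<^sup>2" using A by (simp add: h_def abs_mult)
  have "\<bar>prim N d x\<bar> \<le> integral {0..x} (\<lambda>y. \<bar>lin N d y\<bar>)"
  proof -
    have "lin N d integrable_on {0..x}" "(\<lambda>y. \<bar>lin N d y\<bar>) integrable_on {0..x}"
      by (intro integrable_continuous_real continuous_on_rabs lin_continuous)+
    then show ?thesis
      using integral_norm_bound_integral[of "lin N d" "{0..x}" "\<lambda>y. \<bar>lin N d y\<bar>"] by (simp add: prim_def)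
  qed
  also have "... \<le> J (\<lambda>y. \<bar>lin N d y\<bar>)"
    using x by (intro integral_subset_le integrable_continuous_real continuous_intros) auto
  also have "... \<le> J (\<lambda>y. h ^ 3 / 2 + (lin N d y)\<^sup>2 / (2 * h ^ 3))"
  proof (rule J_mono_finite[OF _ _ finite.emptyI])
    fix y
    have "0 \<le> (h ^ 3 - \<bar>lin N d y\<bar>)\<^sup>2" by simp
    then have "2 * h ^ 3 * \<bar>lin N d y\<bar> \<le> (h ^ 3)\<^sup>2 + (lin N d y)\<^sup>2" unfolding power2_diff power2_abs by simp
    then show "\<bar>lin N d y\<bar> \<le> h ^ 3 / 2 + (lin N d y)\<^sup>2 / (2 * h ^ 3)"
      using h by (simp add: field_simps power2_eq_square)
  qed (intro pwc_rules pwc_lin)+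
  also have "... = h ^ 3 / 2 + J (\<lambda>x. (lin N d x)\<^sup>2) / (2 * h ^ 3)"
    by (subst J_add) (auto intro!: pwc_rules pwc_lin)
  also have "... \<le> h ^ 3 / 2 + 3 * (A * h ^ 6) / (2 * h ^ 3)"
    using h Ed by (intro add_left_mono divide_right_mono) auto
  also have "... = h ^ 3 / 2 + 3 / 2 * (A * h ^ 3)" using h by (simp add: field_simps eval_nat_numeral)
  also have "... \<le> 2 * A * h ^ 3"
  proof -
    have "h ^ 3 \<le> A * h ^ 3" using mult_right_mono[OF A, of "h ^ 3"] h by simp
    then show ?thesis unfolding mult.assoc[of 2] by linarith
  qed
  finally show "\<bar>prim N d x\<bar> \<le> 2 * A * (1 / real N) ^ 3" by (simp add: h_def)
qed

lemma L2_norm01_le: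
  assumes "continuous_on {0..1} f" "\<And>x. x \<in> {0..1} \<Longrightarrow> \<bar>f x\<bar> \<le> B"
  shows "L2_norm01 f \<le> B"
proof -
  have B0: "0 \<le> B" using assms(2)[of 0] by auto
  have p: "pwc f" using assms(1) by (rule pwc_continuous)
  have "ip f f \<le> J (\<lambda>x. B\<^sup>2)" unfolding ip_eq_J[OF p p]
  proof (rule J_mono_finite[OF _ _ finite.emptyI])
    fix x :: real assume "x \<in> {0..1} - {}"
    then have "\<bar>f x\<bar> \<le> B" using assms(2) by auto
    then have "\<bar>f x\<bar> * \<bar>f x\<bar> \<le> B * B" using B0 by (intro mult_mono) auto
    then show "f x * f x \<le> B\<^sup>2" by (simp add: power2_eq_square)
  qed (intro pwc_rules p)+
  then have "ip f f \<le> B\<^sup>2" by simp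
  then show ?thesis unfolding L2_norm01_def using B0 by (simp add: real_le_lsqrt)
qed

lemma Linf_norm01_le:
  assumes "continuous_on {0..1} f" "\<And>x. x \<in> {0..1} \<Longrightarrow> \<bar>f x\<bar> \<le> B"
  shows "Linf_norm01 f \<le> ereal B"
  unfolding Linf_norm01_def
proof (rule esssup_I)
  have "f \<in> borel_measurable (lebesgue_on {0<..<1})"
    by (rule continuous_imp_measurable_on_sets_lebesgue) (auto intro: continuous_on_subset[OF assms(1)])
  then show "(\<lambda>x. ereal \<bar>f x\<bar>) \<in> borel_measurable (lebesgue_on {0<..<1})" by measurable
  show "AE x in lebesgue_on {0<..<1}. ereal \<bar>f x\<bar> \<le> ereal B"
    by (rule AE_I2) (use assms(2) in auto)
qed

theorem theorem5p1:
  fixes T :: real and \<eta>0 u0 :: "real \<Rightarrow> real" and \<eta> u :: "real \<Rightarrow> real \<Rightarrow> real"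
  assumes "0 < T"
    and "SCB_solution T \<eta>0 u0 \<eta> u"
    and "\<eta> \<in> C0T T (Ck 4) (Ck_norm 4)"
    and "Dt T \<eta> \<in> C0T T (Ck 2) (Ck_norm 2)"
    and "u \<in> C0T T (Ck0 3) (Ck_norm 3)"
    and "Dt T u \<in> C0T T (Ck0 3) (Ck_norm 3)"
  shows "\<exists>C::real. \<forall>N\<ge>2. \<forall>\<eta>h uh. semidiscrete_solution T N \<eta>0 u0 \<eta>h uh \<longrightarrow>
    (\<forall>t\<in>{0..T}. L2_norm01 (\<lambda>x. u t x - uh t x)
        + mesh_size N * L2_norm01 (\<lambda>x. \<eta> t x - \<eta>h t x) \<le> C * mesh_size N ^ 3) \<and>
    (\<forall>t\<in>{0..T}. Linf_norm01 (\<lambda>x. u t x - uh t x)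
        + ereal (mesh_size N) * Linf_norm01 (\<lambda>x. \<eta> t x - \<eta>h t x) \<le> ereal (C * mesh_size N ^ 3))"
proof -
  note T = assms(1) and sol = assms(2)
  obtain M1 where M1: "1 \<le> M1" "\<And>t j x. t \<in> {0..T} \<Longrightarrow> j \<le> 4 \<Longrightarrow> x \<in> {0..1} \<Longrightarrow> \<bar>(Dx ^^ j) (\<eta> t) x\<bar> \<le> M1"
    using C0T_uniform_bound[OF assms(3) _ T] by blast
  obtain M2 where M2: "1 \<le> M2" "\<And>t j x. t \<in> {0..T} \<Longrightarrow> j \<le> 2 \<Longrightarrow> x \<in> {0..1} \<Longrightarrow> \<bar>(Dx ^^ j) (Dt T \<eta> t) x\<bar> \<le> M2"
    using C0T_uniform_bound[OF assms(4) _ T] by blast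
  have sub: "Ck0 3 \<subseteq> Ck 3" by (auto simp: Ck0_def)
  obtain M3 where M3: "1 \<le> M3" "\<And>t j x. t \<in> {0..T} \<Longrightarrow> j \<le> 3 \<Longrightarrow> x \<in> {0..1} \<Longrightarrow> \<bar>(Dx ^^ j) (u t) x\<bar> \<le> M3"
    using C0T_uniform_bound[OF assms(5) sub T] by blast
  obtain M4 where M4: "1 \<le> M4" "\<And>t j x. t \<in> {0..T} \<Longrightarrow> j \<le> 3 \<Longrightarrow> x \<in> {0..1} \<Longrightarrow> \<bar>(Dx ^^ j) (Dt T u t) x\<bar> \<le> M4"
    using C0T_uniform_bound[OF assms(6) sub T] by blast
  define M where "M = M1 + M2 + M3 + M4"
  have M: "1 \<le> M" "M1 \<le> M" "M2 \<le> M" "M3 \<le> M" "M4 \<le> M" using M1(1) M2(1) M3(1) M4(1) by (auto simp: M_def)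
  define A where "A = exp (2000 * (28 * M)\<^sup>2 * T)"
  have A: "1 \<le> A" using T by (simp add: A_def)
  have mem: "\<eta> t \<in> Ck 4" "Dt T \<eta> t \<in> Ck 2" "u t \<in> Ck0 3" "Dt T u t \<in> Ck0 3" if "t \<in> {0..T}" for t
    using assms(3-6) that by (auto simp: C0T_def)
  have bnd: "\<bar>(Dx ^^ j) (\<eta> t) x\<bar> \<le> M" if "t \<in> {0..T}" "j \<le> 4" "x \<in> {0..1}" for t j x
    using M1(2)[OF that] M(2) by linarith
  have bndt: "\<bar>Dt T \<eta> t x\<bar> \<le> M" if "t \<in> {0..T}" "x \<in> {0..1}" for t x
    using M2(2)[OF that(1) _ that(2), of 0] M(3) by simp
  have bndu: "\<bar>(Dx ^^ j) (u t) x\<bar> \<le> M" if "t \<in> {0..T}" "j \<le> 3" "x \<in> {0..1}" for t j x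
    using M3(2)[OF that] M(4) by linarith
  have bndut: "\<bar>(Dx ^^ j) (Dt T u t) x\<bar> \<le> M" if "t \<in> {0..T}" "j \<le> 3" "x \<in> {0..1}" for t j x
    using M4(2)[OF that] M(5) by linarith
  have main: "(\<forall>x\<in>{0..1}. \<bar>u t x - uh t x\<bar> \<le> (28 * M + 2 * A) * mesh_size N ^ 3 \<and> \<bar>\<eta> t x - \<eta>h t x\<bar> \<le> (14 * M + 6 * A) * mesh_size N ^ 2)
     \<and> continuous_on {0..1} (\<lambda>x. u t x - uh t x) \<and> continuous_on {0..1} (\<lambda>x. \<eta> t x - \<eta>h t x)"
    if N2: "2 \<le> N" and hsol: "semidiscrete_solution T N \<eta>0 u0 \<eta>h uh" and t: "t \<in> {0..T}" for N \<eta>h uh t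
  proof -
    have N: "1 \<le> N" using N2 by simp
    have Sh: "\<eta>h t \<in> Sh2 N" "uh t \<in> Sh30 N" using hsol t by (auto simp: semidiscrete_solution_def)
    let ?c = "\<lambda>i. Pc N (\<eta> t) i - \<eta>h t (nd N i)" and ?d = "\<lambda>i. Pc N (Dx (u t)) i - Dx (uh t) (nd N i)"
    have E: "J (\<lambda>x. (lin N ?c x)\<^sup>2) + J (\<lambda>x. (prim N ?d x)\<^sup>2) + 1/3 * J (\<lambda>x. (lin N ?d x)\<^sup>2) \<le> A * (1 / real N) ^ 6"
      unfolding A_def by (rule error_energy_bound[OF T N M(1) sol hsol]) (fact mem bnd bndt bndu bndut t)+
    note P = pointwise_from_energy[OF N A E]
    have "\<bar>u t x - uh t x\<bar> \<le> (28 * M + 2 * A) * mesh_size N ^ 3 \<and> \<bar>\<eta> t x - \<eta>h t x\<bar> \<le> (14 * M + 6 * A) * mesh_size N ^ 2" if x: "x \<in> {0..1}" for x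
    proof
      have "\<bar>u t x - prim N (Pc N (Dx (u t))) x\<bar> \<le> 28 * M * (1 / real N) ^ 3"
        by (rule elliptic_projection_error(2)[OF N mem(3)[OF t] bndu[OF t] x]) auto
      moreover have "prim N (\<lambda>i. Pc N (Dx (u t)) i - Dx (uh t) (nd N i)) x = prim N (Pc N (Dx (u t))) x - uh t x"
        unfolding prim_diff[OF x] Sh30_eq_prim[OF N Sh(2) x, symmetric] ..
      ultimately have "\<bar>u t x - uh t x\<bar> \<le> 28 * M * (1 / real N) ^ 3 + 2 * A * (1 / real N) ^ 3"
        using P(2)[OF x] by linarith
      then show "\<bar>u t x - uh t x\<bar> \<le> (28 * M + 2 * A) * mesh_size N ^ 3" by (simp add: mesh_size_def algebra_simps)
      have "\<bar>\<eta> t x - lin N (Pc N (\<eta> t)) x\<bar> \<le> 14 * M * (1 / real N)\<^sup>2"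
        by (rule Pc_approximation[OF N Ck_mono[OF mem(1)[OF t]] _ x]) (use bnd[OF t, of 2] in auto)
      moreover have "lin N (\<lambda>i. Pc N (\<eta> t) i - \<eta>h t (nd N i)) x = lin N (Pc N (\<eta> t)) x - \<eta>h t x"
        unfolding lin_diff Sh2_eq_lin[OF N Sh(1) x, symmetric] ..
      ultimately have "\<bar>\<eta> t x - \<eta>h t x\<bar> \<le> 14 * M * (1 / real N)\<^sup>2 + 6 * A * (1 / real N)\<^sup>2"
        using P(1)[OF x] by linarith
      then show "\<bar>\<eta> t x - \<eta>h t x\<bar> \<le> (14 * M + 6 * A) * mesh_size N ^ 2" by (simp add: mesh_size_def algebra_simps)
    qed
    moreover have "continuous_on {0..1} (u t)" "continuous_on {0..1} (\<eta> t)" "continuous_on {0..1} (uh t)" "continuous_on {0..1} (\<eta>h t)"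
      using mem(3)[OF t] Ck_continuous[of "u t" 3 0] Ck_continuous[OF mem(1)[OF t], of 0] Sh Ck_continuous[of "uh t" 1 0]
        Ck_continuous[of "\<eta>h t" 0 0] by (auto simp: Ck0_def Sh2_def Sh30_def)
    ultimately show ?thesis by (auto intro: continuous_on_diff)
  qed
  define C where "C = (28 * M + 2 * A) + (14 * M + 6 * A)"
  show ?thesis
  proof (intro exI[of _ C] allI impI conjI ballI)
    fix N :: nat and \<eta>h uh t
    assume N: "2 \<le> N" and hsol: "semidiscrete_solution T N \<eta>0 u0 \<eta>h uh" and t: "t \<in> {0..T}"
    note m = main[OF N hsol t]
    have h: "0 \<le> mesh_size N" by (simp add: mesh_size_def)
    have eq: "(28 * M + 2 * A) * mesh_size N ^ 3 + mesh_size N * ((14 * M + 6 * A) * mesh_size N ^ 2) = C * mesh_size N ^ 3"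
      by (simp add: C_def eval_nat_numeral algebra_simps)
    have "L2_norm01 (\<lambda>x. u t x - uh t x) \<le> (28 * M + 2 * A) * mesh_size N ^ 3"
      by (rule L2_norm01_le) (use m in auto)
    moreover have "L2_norm01 (\<lambda>x. \<eta> t x - \<eta>h t x) \<le> (14 * M + 6 * A) * mesh_size N ^ 2"
      by (rule L2_norm01_le) (use m in auto)
    ultimately show "L2_norm01 (\<lambda>x. u t x - uh t x) + mesh_size N * L2_norm01 (\<lambda>x. \<eta> t x - \<eta>h t x) \<le> C * mesh_size N ^ 3"
      unfolding eq[symmetric] using h by (intro add_mono mult_left_mono)
    have "Linf_norm01 (\<lambda>x. u t x - uh t x) \<le> ereal ((28 * M + 2 * A) * mesh_size N ^ 3)"
      by (rule Linf_norm01_le) (use m in auto)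
    moreover have "Linf_norm01 (\<lambda>x. \<eta> t x - \<eta>h t x) \<le> ereal ((14 * M + 6 * A) * mesh_size N ^ 2)"
      by (rule Linf_norm01_le) (use m in auto)
    ultimately have "Linf_norm01 (\<lambda>x. u t x - uh t x) + ereal (mesh_size N) * Linf_norm01 (\<lambda>x. \<eta> t x - \<eta>h t x)
       \<le> ereal ((28 * M + 2 * A) * mesh_size N ^ 3) + ereal (mesh_size N) * ereal ((14 * M + 6 * A) * mesh_size N ^ 2)"
      using h by (intro add_mono ereal_mult_left_mono) auto
    then show "Linf_norm01 (\<lambda>x. u t x - uh t x) + ereal (mesh_size N) * Linf_norm01 (\<lambda>x. \<eta> t x - \<eta>h t x) \<le> ereal (C * mesh_size N ^ 3)"
      unfolding eq[symmetric] by simp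
  qed
qed


end
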